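(* Let $\mathcal M^a_t$ denote the set of all probability measures $\mu$ on $(\Omega,\mathcal B(\Omega))$ such that $\mu(\Omega^R_{-p})=1$ for some $p=p(\mu)>d$, and such that $\mu$ is quasi-invariant with respect to the shifts $\omega\mapsto\omega+\theta h_i$, $\theta\in\mathbb R$, $i=(k,n)\in\mathbb Z^d\times\mathbb Z$, with the Radon–Nikodym derivatives $$\frac{d\mu(\omega+\theta h_i)}{d\mu(\omega)}=a_{\theta h_i}(\omega).$$ Then $\mathcal G_t=\mathcal M^a_t$, where $\mathcal G_t$ is the set of tempered Euclidean Gibbs measures.
   Context: Fix $d\in\mathbb N$, $\beta,\mathfrak m>0$, $a^2>0$, $R\ge2$, $N\in\{2,3,\dots\}\cup\{\infty\}$. Loops. $S_\beta$ is the circle of length $\beta$ with Lebesgue measure $d\tau$; $C_\beta$ the continuous functions $S_\beta\to\mathbb R$ with sup-norm; $L^r_\beta=L^r(S_\beta,d\tau)$; $H=L^2_\beta$ with inner product $(\cdot,\cdot)_H$. $A_\beta=-\mathfrak m\,d^2/d\tau^2+a^2\mathbf 1$ is self-adjoint in $H$, with orthonormal eigenbasis $\varphi_0=\beta^{-1/2}$, $\varphi_n(\tau)=(2/\beta)^{1/2}\cos(2\pi n\tau/\beta)$ for $n\ge1$, $\varphi_n(\tau)=-(2/\beta)^{1/2}\sin(2\pi n\tau/\beta)$ for $n\le-1$. $\gamma_\beta$ is the centered Gaussian measure on $C_\beta$ with covariance operator $A_\beta^{-1}$. Interaction (assumed throughout). (W) For every set $\{k_1,\dots,k_M\}\subset\mathbb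 Z^d$ of $M$ distinct points, $2\le M\le N$ ($M<\infty$), $W_{\{k_1,\dots,k_M\}}\in C^2(\mathbb R^M)$ is a symmetric function, and there are symmetric matrices with entries $J_{k_1,\dots,k_M}\ge0$ (zero if two indices coincide) such that $|W_{\{k_1,\dots,k_M\}}|\le J_{k_1,\dots,k_M}(1+\sum_l|q_l|)^R$, $|\partial_1W_{\{k_1,\dots,k_M\}}|\le J_{k_1,\dots,k_M}(1+\sum_l|q_l|)^{R-1}$, $|\partial_1\partial_lW_{\{k_1,\dots,k_M\}}|\le J_{k_1,\dots,k_M}(1+\sum_l|q_l|)^{R-2}$, $1\le l\le M$. (J) For every $p\ge0$, $\|\mathbf J\|_p:=\sum_{M=2}^NM^R\sup_{k_1}\sum_{\{k_2,\dots,k_M\}}J_{k_1,\dots,k_M}(1+\sum_{l=1}^M|k_1-k_l|)^p<\infty$. (V) $V_k\in C^2(\mathbb R)$, and uniformly in $k\in\mathbb Z^d$, $q\in\mathbb R$: $V_k'(q)q\ge\max\{K_1^{-1}(|V_k'(q)|+|V_k''(q)|-L_1),\,K_2^{-1}(|V_k''(q)q|-L_2),\,K_3^{-1}(|q|^R-L_3),\,K_4^{-1}(q^2-L_4)\}$ and $|V_k''(q)|\le K_0(|V_k'(q)|+|q|^{R-1})+L_0$, where $K_0,K_1,K_2>0$ are some fixed constants, $0<K_3<(2^{R-2}R\|\mathbf J\|_0)^{-1}$ is a fixed small constant, $K_4>0$ may be taken arbitrarily small, and $L_0,\dots,L_4>0$ are corresponding constants. Configurations. $\Omega=[C_\beta]^{\mathbb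 Z^d}$ with the product topology and Borel $\sigma$-algebra $\mathcal B(\Omega)$. For $p>d$, $\|\omega\|^2_{-p,R}=\sum_k(1+|k|)^{-p}|\omega_k|^2_{L^R_\beta}$, $\Omega^R_{-p}=\{\omega\in\Omega:\|\omega\|_{-p,R}<\infty\}$, $\Omega_t=\bigcup_{p}\Omega^R_{-p}$. Gibbs measures. For finite non-empty $\Lambda\subset\mathbb Z^d$ and $\xi\in\Omega_t$, $$\pi_\Lambda(\Delta|\xi)=Z_\Lambda(\xi)^{-1}\int_{[C_\beta]^\Lambda}e^{-\mathcal I^W_\Lambda(\omega|\xi)}\mathbf 1_\Delta(\omega_\Lambda,\xi_{\Lambda^c})\prod_{k\in\Lambda}e^{-\int_{S_\beta}V_k(\omega_k)d\tau}d\gamma_\beta(\omega_k),$$ $\mathcal I^W_\Lambda(\omega|\xi)=\sum_{M=2}^N\sum\int_{S_\beta}W_{\{k_1,\dots,k_M\}}d\tau$, the inner sum over all $M$-point sets meeting $\Lambda$, with the argument attached to the point $k_l$ equal to $\omega_{k_l}$ if $k_l\in\Lambda$ and $\xi_{k_l}$ if $k_l\in\Lambda^c$; $Z_\Lambda(\xi)$ normalizes to a probability measure; $\pi_\Lambda(\cdot|\xi)=0$ for $\xi\in\Omega\setminus\Omega_t$. $\mathcal G$ is the set of probability measures $\mu$ on $(\Omega,\mathcal B(\Omega))$ with $\int\mu(d\omega)\pi_\Lambda(\Delta|\omega)=\mu(\Delta)$ for all such $\Lambda$ and $\Delta\in\mathcal B(\Omega)$; $\mathcal G_t=\{\mu\in\mathcal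 G:\exists p=p(\mu)>d,\ \mu(\Omega^R_{-p})=1\}$. Shifts. For $i=(k,n)\in\mathbb Z^d\times\mathbb Z$, $h_i=(\delta_{k-k'}\varphi_n)_{k'\in\mathbb Z^d}\in\Omega$. For $\omega\in\Omega_t$, $\theta\in\mathbb R$, $$a_{\theta h_i}(\omega)=\exp\Big\{-\theta(A_\beta\varphi_n,\omega_k)_H-\tfrac{\theta^2}2(A_\beta\varphi_n,\varphi_n)_H-\int_{S_\beta}[V_k(\omega_k+\theta\varphi_n)-V_k(\omega_k)]d\tau-\mathcal I^W_{rel}(\omega|\theta h_i)\Big\},$$ $$\mathcal I^W_{rel}(\omega|\theta h_i)=\sum_{M=2}^N\ \sum_{\{k_1,\dots,k_M\}\subset\mathbb Z^d,\,k_1=k}\int_{S_\beta}[W_{\{k_1,\dots,k_M\}}(\omega_{k_1}+\theta\varphi_n,\omega_{k_2},\dots,\omega_{k_M})-W_{\{k_1,\dots,k_M\}}(\omega_{k_1},\dots,\omega_{k_M})]d\tau.$$ Here $d\mu(\omega+\theta h)$ denotes the measure $\Delta\mapsto\mu(\Delta+\theta h)$; thus the quasi-invariance means $\int f(\omega)a_{\theta h_i}(\omega)d\mu(\omega)=\int f(\omega-\theta h_i)d\mu(\omega)$ for all bounded measurable $f:\Omega\to\mathbb R$. *)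

theory Defs
  imports "HOL-Probability.Probability"
begin

section \<open>Loops\<close>

text \<open>
  The lattice is \<open>int ^ 'd\<close>, so \<open>d = CARD('d) \<ge> 1\<close>; \<open>site_norm\<close> is the Euclidean norm.
  Functions on the circle of length \<open>\<beta>\<close> are \<open>\<beta>\<close>-periodic functions on the line, and Lebesgue
  measure on the circle is Lebesgue measure on \<open>{0..<\<beta>}\<close>. The norm of \<open>real \<Rightarrow>\<^sub>C real\<close> is the
  sup-norm.
\<close>

type_synonym 'd site = "int ^ 'd"

definition site_norm :: "'d::finite site \<Rightarrow> real" where
  "site_norm k = norm (\<chi> i. real_of_int (k $ i))"

type_synonym loop = "real \<Rightarrow>\<^sub>C real"
type_synonym 'd config = "'d site \<Rightarrow> loop"

definition loops :: "real \<Rightarrow> loop set" where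
  "loops \<beta> = {\<omega>. \<forall>\<tau>. apply_bcontfun \<omega> (\<tau> + \<beta>) = apply_bcontfun \<omega> \<tau>}"

definition circle_int :: "real \<Rightarrow> (real \<Rightarrow> real) \<Rightarrow> real" where
  "circle_int \<beta> f = (LINT \<tau>:{0..<\<beta>}|lborel. f \<tau>)"

definition loop_L2 :: "real \<Rightarrow> (real \<Rightarrow> real) set" where
  "loop_L2 \<beta> = {f. set_borel_measurable lborel {0..<\<beta>} f \<and>
                   set_integrable lborel {0..<\<beta>} (\<lambda>\<tau>. (f \<tau>)\<^sup>2)}"

definition loop_inner :: "real \<Rightarrow> (real \<Rightarrow> real) \<Rightarrow> (real \<Rightarrow> real) \<Rightarrow> real" where
  "loop_inner \<beta> f g = circle_int \<beta> (\<lambda>\<tau>. f \<tau> * g \<tau>)"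

definition Lr_norm :: "real \<Rightarrow> real \<Rightarrow> (real \<Rightarrow> real) \<Rightarrow> real" where
  "Lr_norm \<beta> r f = (circle_int \<beta> (\<lambda>\<tau>. \<bar>f \<tau>\<bar> powr r)) powr (1 / r)"

definition phi :: "real \<Rightarrow> int \<Rightarrow> loop" where
  "phi \<beta> n = Bcontfun (\<lambda>\<tau>. if n = 0 then \<beta> powr (- 1 / 2)
     else if n \<ge> 1 then sqrt (2 / \<beta>) * cos (2 * pi * of_int n * \<tau> / \<beta>)
     else - sqrt (2 / \<beta>) * sin (2 * pi * of_int n * \<tau> / \<beta>))"

lemma apply_phi:
  "apply_bcontfun (phi \<beta> n) = (\<lambda>\<tau>. if n = 0 then \<beta> powr (- 1 / 2)
     else if n \<ge> 1 then sqrt (2 / \<beta>) * cos (2 * pi * of_int n * \<tau> / \<beta>)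
     else - sqrt (2 / \<beta>) * sin (2 * pi * of_int n * \<tau> / \<beta>))"
proof -
  consider "n = 0" | "n \<ge> 1" | "n \<noteq> 0" "\<not> n \<ge> 1" by blast
  then have "(\<lambda>\<tau>. if n = 0 then \<beta> powr (- 1 / 2)
     else if n \<ge> 1 then sqrt (2 / \<beta>) * cos (2 * pi * of_int n * \<tau> / \<beta>)
     else - sqrt (2 / \<beta>) * sin (2 * pi * of_int n * \<tau> / \<beta>)) \<in> bcontfun"
  proof cases
    case 1
    then show ?thesis by (simp add: const_bcontfun)
  next
    case 2
    then show ?thesis
      by (intro bcontfun_normI[where b = "\<bar>sqrt (2 / \<beta>)\<bar>"])
         (auto intro!: continuous_intros mult_left_le simp: abs_mult divide_inverse)
  next
    case 3
    then show ?thesis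
      by (intro bcontfun_normI[where b = "\<bar>sqrt (2 / \<beta>)\<bar>"])
         (auto intro!: continuous_intros mult_left_le simp: abs_mult divide_inverse)
  qed
  then show ?thesis unfolding phi_def by (rule Bcontfun_inverse)
qed

text \<open>The differential expression of \<open>A\<^sub>\<beta>\<close>, for twice differentiable arguments.\<close>

definition A_op :: "real \<Rightarrow> real \<Rightarrow> (real \<Rightarrow> real) \<Rightarrow> real \<Rightarrow> real" where
  "A_op m a f = (\<lambda>\<tau>. - m * deriv (deriv f) \<tau> + a\<^sup>2 * f \<tau>)"

definition A_eigenvalue :: "real \<Rightarrow> real \<Rightarrow> real \<Rightarrow> int \<Rightarrow> real" where
  "A_eigenvalue \<beta> m a n = m * (2 * pi * of_int n / \<beta>)\<^sup>2 + a\<^sup>2"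

lemma A_op_phi:
  "A_op m a (apply_bcontfun (phi \<beta> n)) \<tau> = A_eigenvalue \<beta> m a n * apply_bcontfun (phi \<beta> n) \<tau>"
proof -
  define c where "c = 2 * pi * of_int n / \<beta>"
  have arg: "2 * pi * of_int n * \<tau> / \<beta> = c * \<tau>" for \<tau>
    by (simp add: c_def)
  have cos': "deriv (\<lambda>\<tau>. C * cos (c * \<tau>)) = (\<lambda>\<tau>. - C * c * sin (c * \<tau>))"
    and sin': "deriv (\<lambda>\<tau>. C * sin (c * \<tau>)) = (\<lambda>\<tau>. C * c * cos (c * \<tau>))" for C :: real
    by (rule ext, rule DERIV_imp_deriv, auto intro!: derivative_eq_intros)+
  consider "n = 0" | "n \<ge> 1" | "n \<noteq> 0" "\<not> n \<ge> 1" by blast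
  then show ?thesis
  proof cases
    case 1
    then have "apply_bcontfun (phi \<beta> n) = (\<lambda>_. \<beta> powr (- 1 / 2))"
      by (simp add: apply_phi fun_eq_iff)
    moreover have "deriv (\<lambda>_::real. y) = (\<lambda>_. 0)" for y :: real by (simp add: fun_eq_iff)
    ultimately show ?thesis using 1 by (simp add: A_op_def A_eigenvalue_def)
  next
    case 2
    then have "apply_bcontfun (phi \<beta> n) = (\<lambda>\<tau>. sqrt (2 / \<beta>) * cos (c * \<tau>))"
      by (auto simp: apply_phi arg fun_eq_iff)
    then show ?thesis
      unfolding A_op_def A_eigenvalue_def c_def[symmetric]
      by (simp only: cos' sin') (simp add: power2_eq_square algebra_simps)
  next
    case 3
    then have "apply_bcontfun (phi \<beta> n) = (\<lambda>\<tau>. - sqrt (2 / \<beta>) * sin (c * \<tau>))"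
      by (auto simp: apply_phi arg fun_eq_iff)
    then show ?thesis
      unfolding A_op_def A_eigenvalue_def c_def[symmetric]
      by (simp only: sin' cos') (simp add: power2_eq_square algebra_simps)
  qed
qed

text \<open>The quadratic form of \<open>A\<^sub>\<beta>\<^sup>-\<^sup>1\<close>, by spectral calculus in the eigenbasis (@ \<open>phi\<close>).\<close>

definition A_inv_form :: "real \<Rightarrow> real \<Rightarrow> real \<Rightarrow> (real \<Rightarrow> real) \<Rightarrow> (real \<Rightarrow> real) \<Rightarrow> real" where
  "A_inv_form \<beta> m a f g =
     (\<Sum>\<^sub>\<infinity>n. loop_inner \<beta> f (phi \<beta> n) * loop_inner \<beta> (phi \<beta> n) g / A_eigenvalue \<beta> m a n)"

text \<open>Centred Gaussian measure with covariance operator \<open>A\<^sub>\<beta>\<^sup>-\<^sup>1\<close>, through its Fourier transform.\<close>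

definition loop_gaussian :: "real \<Rightarrow> real \<Rightarrow> real \<Rightarrow> loop measure \<Rightarrow> bool" where
  "loop_gaussian \<beta> m a \<gamma> \<longleftrightarrow>
     prob_space \<gamma> \<and> sets \<gamma> = sets (restrict_space borel (loops \<beta>)) \<and>
     (\<forall>f\<in>loop_L2 \<beta>. (LINT \<omega>|\<gamma>. iexp (loop_inner \<beta> f (apply_bcontfun \<omega>)))
                     = of_real (exp (- A_inv_form \<beta> m a f f / 2)))"


section \<open>Interaction\<close>

text \<open>
  The order \<open>N\<close> may be infinite. A function on \<open>\<real>\<^sup>M\<close> whose arguments are attached to the points of
  an \<open>M\<close>-point set \<open>S\<close> is a function of \<open>q :: 'd site \<Rightarrow> real\<close> depending on \<open>q\<close> only through
  its values on \<open>S\<close>. A symmetric matrix \<open>J\<close> that vanishes when two indices coincide is a function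
  on finite sets of sites. Since \<open>k\<^sub>1\<close> can be any point of a set, bounds on the derivatives with
  respect to the first variable are bounds for every point of \<open>S\<close>.
\<close>

definition orders :: "enat \<Rightarrow> nat set" where
  "orders N = {M. 2 \<le> M \<and> enat M \<le> N}"

definition point_sets :: "nat \<Rightarrow> 'd site set set" where
  "point_sets M = {S. finite S \<and> card S = M}"

definition partial :: "'a \<Rightarrow> (('a \<Rightarrow> real) \<Rightarrow> real) \<Rightarrow> ('a \<Rightarrow> real) \<Rightarrow> real" where
  "partial k F q = deriv (\<lambda>t. F (q(k := t))) (q k)"

definition has_partial :: "'a \<Rightarrow> (('a \<Rightarrow> real) \<Rightarrow> real) \<Rightarrow> bool" where
  "has_partial k F \<longleftrightarrow> (\<forall>q. (\<lambda>t. F (q(k := t))) differentiable (at (q k)))"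

text \<open>For \<open>F\<close> depending only on finitely many coordinates, continuity in the product topology is
  continuity in these coordinates.\<close>

definition C2_in :: "'a set \<Rightarrow> (('a \<Rightarrow> real) \<Rightarrow> real) \<Rightarrow> bool" where
  "C2_in S F \<longleftrightarrow>
     (\<forall>q q'. (\<forall>k\<in>S. q k = q' k) \<longrightarrow> F q = F q') \<and> continuous_on UNIV F \<and>
     (\<forall>k\<in>S. has_partial k F \<and> continuous_on UNIV (partial k F)) \<and>
     (\<forall>k\<in>S. \<forall>l\<in>S. has_partial k (partial l F) \<and> continuous_on UNIV (partial k (partial l F)))"

definition C2_real :: "(real \<Rightarrow> real) \<Rightarrow> bool" where
  "C2_real f \<longleftrightarrow> (\<forall>x. f differentiable (at x)) \<and> (\<forall>x. deriv f differentiable (at x)) \<and>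
     continuous_on UNIV (deriv (deriv f))"

definition cond_W ::
  "real \<Rightarrow> enat \<Rightarrow> ('d site set \<Rightarrow> ('d site \<Rightarrow> real) \<Rightarrow> real) \<Rightarrow> ('d site set \<Rightarrow> real) \<Rightarrow> bool"
  where
  "cond_W R N W J \<longleftrightarrow> (\<forall>M\<in>orders N. \<forall>S\<in>point_sets M.
     C2_in S (W S) \<and>
     (\<forall>\<sigma> q. \<sigma> permutes S \<longrightarrow> W S (q \<circ> \<sigma>) = W S q) \<and>
     0 \<le> J S \<and>
     (\<forall>q. \<bar>W S q\<bar> \<le> J S * (1 + (\<Sum>j\<in>S. \<bar>q j\<bar>)) powr R) \<and>
     (\<forall>q. \<forall>k\<in>S. \<bar>partial k (W S) q\<bar> \<le> J S * (1 + (\<Sum>j\<in>S. \<bar>q j\<bar>)) powr (R - 1)) \<and>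
     (\<forall>q. \<forall>k\<in>S. \<forall>l\<in>S.
        \<bar>partial k (partial l (W S)) q\<bar> \<le> J S * (1 + (\<Sum>j\<in>S. \<bar>q j\<bar>)) powr (R - 2)))"

definition J_norm :: "real \<Rightarrow> enat \<Rightarrow> ('d::finite site set \<Rightarrow> real) \<Rightarrow> real \<Rightarrow> ennreal" where
  "J_norm R N J p =
     (\<Sum>\<^sub>\<infinity>M\<in>orders N. ennreal (real M powr R) *
        (SUP k. \<Sum>\<^sub>\<infinity>S\<in>{S \<in> point_sets M. k \<in> S}.
           ennreal (J S * (1 + (\<Sum>l\<in>S. site_norm (k - l))) powr p)))"

definition cond_J :: "real \<Rightarrow> enat \<Rightarrow> ('d::finite site set \<Rightarrow> real) \<Rightarrow> bool" where
  "cond_J R N J \<longleftrightarrow> (\<forall>p\<ge>0. J_norm R N J p < \<infinity>)"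

text \<open>In \<open>ennreal\<close> the inverse of \<open>0\<close> is \<open>\<infinity>\<close>, so the bound on \<open>K3\<close> is void when \<open>J\<close> vanishes.\<close>

definition cond_V ::
  "real \<Rightarrow> enat \<Rightarrow> ('d::finite site set \<Rightarrow> real) \<Rightarrow> ('d site \<Rightarrow> real \<Rightarrow> real) \<Rightarrow> bool" where
  "cond_V R N J V \<longleftrightarrow>
     (\<forall>k. C2_real (V k)) \<and>
     (\<exists>K0>0. \<exists>K1>0. \<exists>K2>0. \<exists>K3>0. \<exists>L0>0. \<exists>L1>0. \<exists>L2>0. \<exists>L3>0.
        ennreal K3 < inverse (ennreal (2 powr (R - 2) * R) * J_norm R N J 0) \<and>
        (\<forall>K4>0. \<exists>L4>0. \<forall>k q.
           deriv (V k) q * q \<ge> Max {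
             (\<bar>deriv (V k) q\<bar> + \<bar>deriv (deriv (V k)) q\<bar> - L1) / K1,
             (\<bar>deriv (deriv (V k)) q * q\<bar> - L2) / K2,
             (\<bar>q\<bar> powr R - L3) / K3,
             (q\<^sup>2 - L4) / K4}) \<and>
        (\<forall>k q. \<bar>deriv (deriv (V k)) q\<bar> \<le> K0 * (\<bar>deriv (V k) q\<bar> + \<bar>q\<bar> powr (R - 1)) + L0))"


section \<open>Configurations\<close>

definition Omega :: "real \<Rightarrow> 'd config set" where
  "Omega \<beta> = {\<omega>. \<forall>k. \<omega> k \<in> loops \<beta>}"

text \<open>The Borel \<open>\<sigma>\<close>-algebra of the product topology on \<open>Omega\<close>.\<close>

definition Omega_space :: "real \<Rightarrow> 'd config measure" where
  "Omega_space \<beta> = restrict_space borel (Omega \<beta>)"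

definition temp_norm_sq :: "real \<Rightarrow> real \<Rightarrow> real \<Rightarrow> 'd::finite config \<Rightarrow> ennreal" where
  "temp_norm_sq \<beta> R p \<omega> =
     (\<Sum>\<^sub>\<infinity>k. ennreal ((1 + site_norm k) powr (- p) * (Lr_norm \<beta> R (apply_bcontfun (\<omega> k)))\<^sup>2))"

definition Omega_p :: "real \<Rightarrow> real \<Rightarrow> real \<Rightarrow> 'd::finite config set" where
  "Omega_p \<beta> R p = {\<omega> \<in> Omega \<beta>. temp_norm_sq \<beta> R p \<omega> < \<infinity>}"

definition Omega_t :: "real \<Rightarrow> real \<Rightarrow> 'd::finite config set" where
  "Omega_t \<beta> R = (\<Union>p\<in>{real CARD('d)<..}. Omega_p \<beta> R p)"


section \<open>Gibbs measures\<close>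

definition W_energy ::
  "real \<Rightarrow> enat \<Rightarrow> ('d site set \<Rightarrow> ('d site \<Rightarrow> real) \<Rightarrow> real) \<Rightarrow> 'd site set \<Rightarrow> 'd config \<Rightarrow> 'd config \<Rightarrow> real"
  where
  "W_energy \<beta> N W \<Lambda> \<omega> \<xi> =
     (\<Sum>\<^sub>\<infinity>M\<in>orders N. \<Sum>\<^sub>\<infinity>S\<in>{S \<in> point_sets M. S \<inter> \<Lambda> \<noteq> {}}.
        circle_int \<beta> (\<lambda>\<tau>. W S (\<lambda>k. if k \<in> \<Lambda> then apply_bcontfun (\<omega> k) \<tau>
                                         else apply_bcontfun (\<xi> k) \<tau>)))"

definition gibbs_weight ::
  "real \<Rightarrow> enat \<Rightarrow> ('d site set \<Rightarrow> ('d site \<Rightarrow> real) \<Rightarrow> real) \<Rightarrow> ('d site \<Rightarrow> real \<Rightarrow> real) \<Rightarrow>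
    'd site set \<Rightarrow> 'd config \<Rightarrow> 'd config \<Rightarrow> real" where
  "gibbs_weight \<beta> N W V \<Lambda> \<xi> \<omega> =
     exp (- W_energy \<beta> N W \<Lambda> \<omega> \<xi>) *
     (\<Prod>k\<in>\<Lambda>. exp (- circle_int \<beta> (\<lambda>\<tau>. V k (apply_bcontfun (\<omega> k) \<tau>))))"

definition partition_fn ::
  "real \<Rightarrow> enat \<Rightarrow> ('d site set \<Rightarrow> ('d site \<Rightarrow> real) \<Rightarrow> real) \<Rightarrow> ('d site \<Rightarrow> real \<Rightarrow> real) \<Rightarrow>
    loop measure \<Rightarrow> 'd site set \<Rightarrow> 'd config \<Rightarrow> ennreal" where
  "partition_fn \<beta> N W V \<gamma> \<Lambda> \<xi> =
     (\<integral>\<^sup>+\<omega>. ennreal (gibbs_weight \<beta> N W V \<Lambda> \<xi> \<omega>) \<partial>(\<Pi>\<^sub>M k\<in>\<Lambda>. \<gamma>))"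

definition gibbs_kernel ::
  "real \<Rightarrow> real \<Rightarrow> enat \<Rightarrow> ('d::finite site set \<Rightarrow> ('d site \<Rightarrow> real) \<Rightarrow> real) \<Rightarrow>
    ('d site \<Rightarrow> real \<Rightarrow> real) \<Rightarrow> loop measure \<Rightarrow> 'd site set \<Rightarrow> 'd config \<Rightarrow> 'd config set \<Rightarrow> ennreal"
  where
  "gibbs_kernel \<beta> R N W V \<gamma> \<Lambda> \<xi> \<Delta> =
     (if \<xi> \<in> Omega_t \<beta> R then
        (\<integral>\<^sup>+\<omega>. ennreal (gibbs_weight \<beta> N W V \<Lambda> \<xi> \<omega>) * indicator \<Delta> (override_on \<xi> \<omega> \<Lambda>)
           \<partial>(\<Pi>\<^sub>M k\<in>\<Lambda>. \<gamma>)) / partition_fn \<beta> N W V \<gamma> \<Lambda> \<xi>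
      else 0)"

definition gibbs_measures ::
  "real \<Rightarrow> real \<Rightarrow> enat \<Rightarrow> ('d::finite site set \<Rightarrow> ('d site \<Rightarrow> real) \<Rightarrow> real) \<Rightarrow>
    ('d site \<Rightarrow> real \<Rightarrow> real) \<Rightarrow> loop measure \<Rightarrow> 'd config measure set" where
  "gibbs_measures \<beta> R N W V \<gamma> =
     {\<mu>. prob_space \<mu> \<and> sets \<mu> = sets (Omega_space \<beta>) \<and>
         (\<forall>\<Lambda>. finite \<Lambda> \<and> \<Lambda> \<noteq> {} \<longrightarrow> (\<forall>\<Delta>\<in>sets (Omega_space \<beta>).
            (\<integral>\<^sup>+\<omega>. gibbs_kernel \<beta> R N W V \<gamma> \<Lambda> \<omega> \<Delta> \<partial>\<mu>) = emeasure \<mu> \<Delta>))}"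

definition tempered_gibbs_measures ::
  "real \<Rightarrow> real \<Rightarrow> enat \<Rightarrow> ('d::finite site set \<Rightarrow> ('d site \<Rightarrow> real) \<Rightarrow> real) \<Rightarrow>
    ('d site \<Rightarrow> real \<Rightarrow> real) \<Rightarrow> loop measure \<Rightarrow> 'd config measure set" where
  "tempered_gibbs_measures \<beta> R N W V \<gamma> =
     {\<mu> \<in> gibbs_measures \<beta> R N W V \<gamma>. \<exists>p>real CARD('d). emeasure \<mu> (Omega_p \<beta> R p) = 1}"


section \<open>Shifts\<close>

definition h_dir :: "real \<Rightarrow> 'd site \<Rightarrow> int \<Rightarrow> 'd config" where
  "h_dir \<beta> k n = (\<lambda>k'. if k' = k then phi \<beta> n else 0)"

definition shift :: "real \<Rightarrow> 'd config \<Rightarrow> 'd config \<Rightarrow> 'd config" where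
  "shift \<theta> h \<omega> = (\<lambda>k. \<omega> k + \<theta> *\<^sub>R h k)"

definition W_relative_energy ::
  "real \<Rightarrow> enat \<Rightarrow> ('d site set \<Rightarrow> ('d site \<Rightarrow> real) \<Rightarrow> real) \<Rightarrow> 'd config \<Rightarrow> real \<Rightarrow> 'd site \<Rightarrow> int \<Rightarrow> real"
  where
  "W_relative_energy \<beta> N W \<omega> \<theta> k n =
     (\<Sum>\<^sub>\<infinity>M\<in>orders N. \<Sum>\<^sub>\<infinity>S\<in>{S \<in> point_sets M. k \<in> S}.
        circle_int \<beta> (\<lambda>\<tau>. W S (\<lambda>l. apply_bcontfun (shift \<theta> (h_dir \<beta> k n) \<omega> l) \<tau>)
                          - W S (\<lambda>l. apply_bcontfun (\<omega> l) \<tau>)))"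

definition shift_density ::
  "real \<Rightarrow> real \<Rightarrow> real \<Rightarrow> enat \<Rightarrow> ('d site set \<Rightarrow> ('d site \<Rightarrow> real) \<Rightarrow> real) \<Rightarrow>
    ('d site \<Rightarrow> real \<Rightarrow> real) \<Rightarrow> real \<Rightarrow> 'd site \<Rightarrow> int \<Rightarrow> 'd config \<Rightarrow> real" where
  "shift_density \<beta> m a N W V \<theta> k n \<omega> =
     exp (- \<theta> * loop_inner \<beta> (A_op m a (phi \<beta> n)) (\<omega> k)
          - \<theta>\<^sup>2 / 2 * loop_inner \<beta> (A_op m a (phi \<beta> n)) (phi \<beta> n)
          - circle_int \<beta> (\<lambda>\<tau>. V k (apply_bcontfun (\<omega> k) \<tau> + \<theta> * apply_bcontfun (phi \<beta> n) \<tau>)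
                              - V k (apply_bcontfun (\<omega> k) \<tau>))
          - W_relative_energy \<beta> N W \<omega> \<theta> k n)"

text \<open>The density is strictly positive, so the equation below makes \<open>\<mu>\<close> and its shifts mutually
  absolutely continuous.\<close>

definition tempered_quasi_invariant_measures ::
  "real \<Rightarrow> real \<Rightarrow> real \<Rightarrow> real \<Rightarrow> enat \<Rightarrow> ('d::finite site set \<Rightarrow> ('d site \<Rightarrow> real) \<Rightarrow> real) \<Rightarrow>
    ('d site \<Rightarrow> real \<Rightarrow> real) \<Rightarrow> 'd config measure set" where
  "tempered_quasi_invariant_measures \<beta> m a R N W V =
     {\<mu>. prob_space \<mu> \<and> sets \<mu> = sets (Omega_space \<beta>) \<and>
         (\<exists>p>real CARD('d). emeasure \<mu> (Omega_p \<beta> R p) = 1) \<and>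
         (\<forall>\<theta> k n. \<forall>\<Delta>\<in>sets (Omega_space \<beta>).
            emeasure \<mu> (shift \<theta> (h_dir \<beta> k n) ` \<Delta>)
              = (\<integral>\<^sup>+\<omega>\<in>\<Delta>. ennreal (shift_density \<beta> m a N W V \<theta> k n \<omega>) \<partial>\<mu>))}"

end

theory Submission
  imports Defs
begin

text \<open>
  Write \<open>w\<close> for the Gibbs weight in a finite volume \<open>\<Lambda>\<close>. On tempered configurations
  the shift density times \<open>w\<close> is the Cameron-Martin density times the shifted \<open>w\<close>. So a Gibbs
  measure is quasi-invariant by the Cameron-Martin formula under the kernel of a one-point volume.

  Conversely, if \<open>\<mu>\<close> is quasi-invariant then \<open>\<sigma> = \<mu> / w\<close> transforms under the shifts
  in \<open>\<Lambda>\<close> like a Gaussian measure: each Fourier coefficient of a loop in \<open>\<Lambda>\<close> is, under \<open>\<sigma>\<close>,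
  Gaussian and independent of everything else. If \<open>\<sigma>\<close> is \<open>\<sigma>\<close>-finite on the events outside
  \<open>\<Lambda>\<close>, it follows that \<open>\<sigma>\<close> is the free measure in \<open>\<Lambda>\<close> times a measure outside, which is the
  Gibbs property; the partition function is then automatically finite almost everywhere. The
  \<open>\<sigma>\<close>-finiteness comes from the integrability of \<open>w\<close> by partial Ornstein-Uhlenbeck moves, which
  preserve \<open>\<sigma>\<close> and damp the Fourier coefficients by Fejer weights.
\<close>

section \<open>Loops and measurability\<close>

text \<open>The interaction part of the shift density is a coboundary, which is why dividing by
  \<open>w\<close> removes it. The price is that \<open>\<sigma>\<close> may be infinite, since
  nothing bounds the \<open>\<mu>\<close>-mean of \<open>1 / w\<close>. As a whole
  \<open>\<sigma>\<close> is \<open>\<sigma>\<close>-finite, but sets cutting it into finite pieces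
  may depend on the loops in \<open>\<Lambda>\<close> and need not survive resampling. The pieces
  used are level sets of an absolute energy in which the loops in \<open>\<Lambda>\<close> are
  replaced by a constant. Fejer means take the place of Fourier partial sums because what is left of
  a loop after damping must be small in sup-norm, and partial sums of a continuous function need not
  converge uniformly. Their multipliers lie in [0,1], so 1 minus a multiplier serves as the
  correlation \<open>r\<close> of a Mehler move whose noise has amplitude
  \<open>sqrt (1 - r^2)\<close>.\<close>

abbreviation loop_space :: "real \<Rightarrow> loop measure" where
  "loop_space \<beta> \<equiv> restrict_space borel (loops \<beta>)"

lemma loop_add_int:
  assumes "z \<in> loops \<beta>"
  shows "apply_bcontfun z (\<tau> + of_int n * \<beta>) = apply_bcontfun z \<tau>"
proof -
  have nat: "apply_bcontfun z (\<tau> + of_nat k * \<beta>) = apply_bcontfun z \<tau>" for k :: nat and \<tau>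
  proof (induction k)
    case (Suc k)
    have "apply_bcontfun z (\<tau> + of_nat (Suc k) * \<beta>) = apply_bcontfun z ((\<tau> + of_nat k * \<beta>) + \<beta>)"
      by (simp add: algebra_simps)
    with Suc assms show ?case by (simp add: loops_def)
  qed simp
  show ?thesis
  proof (cases "n \<ge> 0")
    case True
    then show ?thesis using nat[of \<tau> "nat n"] by simp
  next
    case False
    then show ?thesis using nat[of "\<tau> + of_int n * \<beta>" "nat (-n)"] by simp
  qed
qed

lemma loop_frac:
  assumes "\<beta> > 0" "z \<in> loops \<beta>"
  shows "apply_bcontfun z \<tau> = apply_bcontfun z (frac (\<tau> / \<beta>) * \<beta>)"
proof -
  have "\<tau> = frac (\<tau> / \<beta>) * \<beta> + of_int \<lfloor>\<tau> / \<beta>\<rfloor> * \<beta>"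
    using assms(1) by (simp add: frac_def algebra_simps)
  then show ?thesis using loop_add_int[OF assms(2)] by metis
qed

lemma loops_zero [simp]: "0 \<in> loops \<beta>"
  and loops_const [simp]: "const_bcontfun c \<in> loops \<beta>"
  and loops_add [simp]: "\<And>x y. x \<in> loops \<beta> \<Longrightarrow> y \<in> loops \<beta> \<Longrightarrow> x + y \<in> loops \<beta>"
  and loops_scaleR [simp]: "\<And>x. x \<in> loops \<beta> \<Longrightarrow> c *\<^sub>R x \<in> loops \<beta>"
  by (auto simp: loops_def)

lemma loops_sum [simp]: "(\<And>i. i \<in> I \<Longrightarrow> f i \<in> loops \<beta>) \<Longrightarrow> sum f I \<in> loops \<beta>"
  by (induction I rule: infinite_finite_induct) auto

lemma apply_bcontfun_sum: "apply_bcontfun (sum f I) \<tau> = (\<Sum>i\<in>I. apply_bcontfun (f i) \<tau>)"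
  by (induction I rule: infinite_finite_induct) auto

lemma loop_uniformly_continuous:
  assumes "\<beta> > 0" "z \<in> loops \<beta>" "e > 0"
  obtains d where "d > 0" "\<And>s t. \<bar>s - t\<bar> < d \<Longrightarrow> \<bar>apply_bcontfun z s - apply_bcontfun z t\<bar> < e"
proof -
  \<comment> \<open>A period is added on both sides: once \<open>s\<close> is translated into
    \<open>{0..\<beta>}\<close>, a point closer than \<open>\<beta>\<close> to it stays in the
    window.\<close>
  have "uniformly_continuous_on {- \<beta>..2 * \<beta>} (apply_bcontfun z)"
    by (rule compact_uniformly_continuous) auto
  then obtain d where d: "d > 0" "\<And>s t. s \<in> {- \<beta>..2 * \<beta>} \<Longrightarrow> t \<in> {- \<beta>..2 * \<beta>} \<Longrightarrow> dist s t < d \<Longrightarrow>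
     dist (apply_bcontfun z s) (apply_bcontfun z t) < e"
    unfolding uniformly_continuous_on_def using assms(3) by metis
  have "\<bar>apply_bcontfun z s - apply_bcontfun z t\<bar> < e" if st: "\<bar>s - t\<bar> < min d \<beta>" for s t
  proof -
    define n where "n = \<lfloor>s / \<beta>\<rfloor>"
    have "of_int n \<le> s / \<beta>" "s / \<beta> < of_int n + 1" unfolding n_def by linarith+
    then have "0 \<le> s - of_int n * \<beta>" "s - of_int n * \<beta> \<le> \<beta>"
      using assms(1) by (simp_all add: pos_le_divide_eq pos_divide_less_eq algebra_simps)
    then have "dist (apply_bcontfun z (s + of_int (-n) * \<beta>)) (apply_bcontfun z (t + of_int (-n) * \<beta>)) < e"
      using st by (intro d) (auto simp: dist_real_def)
    then show ?thesis by (simp only: loop_add_int[OF assms(2)] dist_real_def)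
  qed
  then show ?thesis using that[of "min d \<beta>"] d(1) assms(1) by auto
qed

text \<open>No approximating loops are constructed. \<open>D\<close> selects one loop for every step
  function with grid values that some loop follows closely; two loops following the same step
  function are themselves close. Separability is what reduces open sets of configurations to
  countably many balls.\<close>

lemma loops_separable:
  assumes "\<beta> > 0"
  obtains D where "countable D" "D \<subseteq> loops \<beta>" "\<And>z e. z \<in> loops \<beta> \<Longrightarrow> e > 0 \<Longrightarrow> \<exists>d\<in>D. dist z d < e"
proof -
  \<comment> \<open>\<open>n\<close> is the number of time cells, \<open>m\<close> fixes the value
    grid of mesh \<open>1 / (m + 1)\<close>, and \<open>qs\<close> lists the numerators cell by
    cell. The tolerance is two meshes: one for the oscillation within a cell, one for
    rounding.\<close>
  define P where "P = (\<lambda>(n::nat, qs::int list, m::nat) z. z \<in> loops \<beta> \<and>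
    (\<forall>\<tau>\<in>{0..\<beta>}. \<bar>apply_bcontfun z \<tau> - of_int (qs ! nat \<lfloor>\<tau> * n / \<beta>\<rfloor>) / (real m + 1)\<bar> \<le> 2 / (real m + 1)))"
  define D where "D = (\<lambda>i. SOME z. P i z) ` {i. \<exists>z. P i z}"
  show ?thesis
  proof
    show "countable D" by (simp add: D_def)
    have PS: "P i (SOME z. P i z)" if "\<exists>z. P i z" for i using someI_ex[OF that] .
    then show "D \<subseteq> loops \<beta>"
      by (force simp: D_def P_def split: prod.splits)
    fix z and e :: real assume z: "z \<in> loops \<beta>" and e: "e > 0"
    obtain m :: nat where m: "4 / (real m + 1) < e"
    proof -
      obtain m :: nat where "4 / e < real m" using reals_Archimedean2 by blast
      then have "4 < e * (real m + 1)" using e by (simp add: field_simps)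
      then show ?thesis using that[of m] by (simp add: field_simps)
    qed
    obtain d where d: "d > 0" "\<And>s t. \<bar>s - t\<bar> < d \<Longrightarrow>
        \<bar>apply_bcontfun z s - apply_bcontfun z t\<bar> < 1 / (real m + 1)"
      using loop_uniformly_continuous[OF assms z, of "1 / (real m + 1)"] by auto
    obtain n :: nat where n: "real n > \<beta> / d" using reals_Archimedean2 by blast
    have n0: "n > 0" using n assms d(1) by (metis divide_pos_pos gr0I of_nat_0 order_less_asym)
    have bn: "\<beta> / n < d" using n n0 d(1) by (simp add: field_simps)
    \<comment> \<open>One entry more than there are cells, because the closed interval in
      \<open>P\<close> contains \<open>\<tau> = \<beta>\<close>, which falls into cell
      \<open>n\<close>.\<close>
    define qs where "qs = map (\<lambda>j. \<lfloor>apply_bcontfun z (real j * \<beta> / n) * (real m + 1)\<rfloor>) [0..<Suc n]"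
    have Pz: "P (n, qs, m) z"
      unfolding P_def prod.case
    proof (intro conjI z ballI)
      fix \<tau> assume \<tau>: "\<tau> \<in> {0..\<beta>}"
      define j where "j = nat \<lfloor>\<tau> * n / \<beta>\<rfloor>"
      have fl: "0 \<le> \<lfloor>\<tau> * n / \<beta>\<rfloor>" using \<tau> assms by (simp)
      then have j: "real j \<le> \<tau> * n / \<beta>" "\<tau> * n / \<beta> < real j + 1"
        using \<tau> by (auto simp: j_def) 
      have "\<tau> * n / \<beta> \<le> n" using \<tau> assms n0 by (simp add: field_simps)
      then have jn: "j < Suc n" using j by linarith
      have "\<bar>\<tau> - real j * \<beta> / n\<bar> \<le> \<beta> / n"
      proof -
        have "0 \<le> \<tau> * n / \<beta> - real j" "\<tau> * n / \<beta> - real j \<le> 1" using j by auto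
        then have "0 \<le> (\<tau> * n / \<beta> - real j) * (\<beta> / n)" "(\<tau> * n / \<beta> - real j) * (\<beta> / n) \<le> 1 * (\<beta> / n)"
          using assms by (intro mult_nonneg_nonneg mult_right_mono; simp)+
        moreover have "(\<tau> * n / \<beta> - real j) * (\<beta> / n) = \<tau> - real j * \<beta> / n"
          using n0 assms by (simp add: field_simps)
        ultimately show ?thesis by simp
      qed
      then have 1: "\<bar>apply_bcontfun z \<tau> - apply_bcontfun z (real j * \<beta> / n)\<bar> < 1 / (real m + 1)"
        using bn by (intro d) auto
      define y where "y = apply_bcontfun z (real j * \<beta> / n)"
      have fl_y: "\<bar>y * (real m + 1) - of_int \<lfloor>y * (real m + 1)\<rfloor>\<bar> \<le> 1" by linarith
      then have "\<bar>y - of_int \<lfloor>y * (real m + 1)\<rfloor> / (real m + 1)\<bar> \<le> 1 / (real m + 1)"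
      proof -
        have "y - of_int \<lfloor>y * (real m + 1)\<rfloor> / (real m + 1)
            = (y * (real m + 1) - of_int \<lfloor>y * (real m + 1)\<rfloor>) / (real m + 1)"
          by (simp add: diff_divide_distrib)
        then show ?thesis using fl_y by (simp add: abs_divide divide_right_mono)
      qed
      moreover have "qs ! j = \<lfloor>y * (real m + 1)\<rfloor>"
        using jn unfolding qs_def y_def by (subst nth_map) (simp_all del: upt_Suc)
      ultimately show "\<bar>apply_bcontfun z \<tau> - of_int (qs ! nat \<lfloor>\<tau> * n / \<beta>\<rfloor>) / (real m + 1)\<bar> \<le> 2 / (real m + 1)"
        using 1 unfolding j_def[symmetric] y_def[symmetric] by simp
    qed
    define w where "w = (SOME z. P (n, qs, m) z)"
    have Pw: "P (n, qs, m) w" unfolding w_def by (rule PS) (use Pz in blast)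
    have "\<bar>apply_bcontfun z \<tau> - apply_bcontfun w \<tau>\<bar> \<le> 4 / (real m + 1)" for \<tau>
    proof -
      define t where "t = frac (\<tau> / \<beta>) * \<beta>"
      have t: "t \<in> {0..\<beta>}" using assms frac_lt_1[of "\<tau> / \<beta>"] by (auto simp: t_def frac_ge_0)
      have "\<bar>apply_bcontfun z t - apply_bcontfun w t\<bar> \<le> 4 / (real m + 1)"
        using Pz[unfolded P_def prod.case, THEN conjunct2, rule_format, OF t]
         Pw[unfolded P_def prod.case, THEN conjunct2, rule_format, OF t] by argo
      then show ?thesis
        using loop_frac[OF assms, of z \<tau>] loop_frac[OF assms, of w \<tau>] z Pw by (simp add: t_def P_def)
    qed
    then have "dist z w \<le> 4 / (real m + 1)"
      by (intro dist_bound) (simp add: dist_real_def)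
    then have "dist z w < e" using m by simp
    moreover have "w \<in> D" using Pz by (auto simp: D_def w_def)
    ultimately show "\<exists>d\<in>D. dist z d < e" by blast
  qed
qed

section \<open>Borel structure from point evaluations\<close>

lemma continuous_apply_bcontfun: "continuous_on A (\<lambda>z::loop. apply_bcontfun z \<tau>)"
  by (rule continuous_on_subset[of UNIV])
     (auto simp: continuous_on_iff intro: dist_fun_lt_imp_dist_val_lt)

lemma measurable_eval_loop:
  "(\<lambda>z. apply_bcontfun z \<tau>) \<in> borel_measurable (loop_space \<beta>)"
  by (intro measurable_restrict_space1 borel_measurable_continuous_onI continuous_apply_bcontfun)

text \<open>By continuity the supremum in the distance runs over rational times only, so closed
  balls are decided by countably many evaluations.\<close>

lemma measurable_dist_loop:
  assumes "\<And>\<tau>. (\<lambda>\<omega>. apply_bcontfun (g \<omega>) \<tau>) \<in> borel_measurable M"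
  shows "(\<lambda>\<omega>. dist (g \<omega>) (d :: loop)) \<in> borel_measurable M"
proof (rule borel_measurableI_le)
  fix y :: real
  have "dist (g \<omega>) d \<le> y \<longleftrightarrow> (\<forall>q::rat. \<bar>apply_bcontfun (g \<omega>) (of_rat q) - apply_bcontfun d (of_rat q)\<bar> \<le> y)" for \<omega>
  proof
    assume "dist (g \<omega>) d \<le> y"
    then show "\<forall>q::rat. \<bar>apply_bcontfun (g \<omega>) (of_rat q) - apply_bcontfun d (of_rat q)\<bar> \<le> y"
      using dist_bounded[of "g \<omega>" _ d] order_trans by (fastforce simp: dist_real_def)
  next
    assume *: "\<forall>q::rat. \<bar>apply_bcontfun (g \<omega>) (of_rat q) - apply_bcontfun d (of_rat q)\<bar> \<le> y"
    have "closed {\<tau>. \<bar>apply_bcontfun (g \<omega>) \<tau> - apply_bcontfun d \<tau>\<bar> \<le> y}"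
      by (intro closed_Collect_le continuous_intros continuous_on_apply_bcontfun)
    moreover have "\<rat> \<subseteq> {\<tau>. \<bar>apply_bcontfun (g \<omega>) \<tau> - apply_bcontfun d \<tau>\<bar> \<le> y}"
      using * by (auto simp: Rats_def)
    ultimately have "closure \<rat> \<subseteq> {\<tau>. \<bar>apply_bcontfun (g \<omega>) \<tau> - apply_bcontfun d \<tau>\<bar> \<le> y}"
      by (rule closure_minimal[rotated])
    then have "\<bar>apply_bcontfun (g \<omega>) \<tau> - apply_bcontfun d \<tau>\<bar> \<le> y" for \<tau>
      by (auto simp: Rats_closure_real)
    then show "dist (g \<omega>) d \<le> y" by (intro dist_bound) (simp add: dist_real_def)
  qed
  then have "{\<omega> \<in> space M. dist (g \<omega>) d \<le> y} = {\<omega> \<in> space M. \<forall>q::rat. \<bar>apply_bcontfun (g \<omega>) (of_rat q) - apply_bcontfun d (of_rat q)\<bar> \<le> y}"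
    by simp
  also have "\<dots> \<in> sets M" using assms by measurable
  finally show "{\<omega> \<in> space M. dist (g \<omega>) d \<le> y} \<in> sets M" .
qed

lemma space_Omega_space [simp]: "space (Omega_space \<beta>) = Omega \<beta>"
  by (simp add: Omega_space_def space_restrict_space)

lemma OmegaD: "\<omega> \<in> Omega \<beta> \<Longrightarrow> \<omega> k \<in> loops \<beta>"
  by (simp add: Omega_def)

text \<open>Finite lists of sites, centres from a countable dense set and rational radii index a
  countable base, so measurable evaluations suffice for Borel measurability. The basic maps into
  configuration space (moves, mixtures, overriding) are all handled this way.\<close>

lemma measurable_OmegaI:
  fixes g :: "'a \<Rightarrow> 'd::finite config"
  assumes "\<beta> > 0" "\<And>\<omega>. \<omega> \<in> space M \<Longrightarrow> g \<omega> \<in> Omega \<beta>"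
    and "\<And>k \<tau>. (\<lambda>\<omega>. apply_bcontfun (g \<omega> k) \<tau>) \<in> borel_measurable M"
  shows "g \<in> measurable M (Omega_space \<beta>)"
  unfolding Omega_space_def
proof (rule measurable_restrict_space2)
  show "g \<in> space M \<rightarrow> Omega \<beta>" using assms by auto
  obtain D where D: "countable D" "D \<subseteq> loops \<beta>" "\<And>z e. z \<in> loops \<beta> \<Longrightarrow> e > 0 \<Longrightarrow> \<exists>d\<in>D. dist z d < e"
    using loops_separable[OF assms(1)] by blast
  have [measurable]: "(\<lambda>\<omega>. dist (g \<omega> k) d) \<in> borel_measurable M" for k d
    by (rule measurable_dist_loop[OF assms(3)])
  show "g \<in> borel_measurable M"
  proof (rule borel_measurableI)
    fix U :: "'d config set" assume U: "open U"
    define C where "C = (\<lambda>xs::('d site \<times> loop \<times> rat) list. {\<omega>. \<forall>(k,d,q)\<in>set xs. dist (\<omega> k) d < of_rat q})"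
    define I where "I = {xs. set xs \<subseteq> UNIV \<times> D \<times> UNIV \<and> C xs \<subseteq> U}"
    have "countable {xs. set xs \<subseteq> (UNIV :: 'd site set) \<times> D \<times> (UNIV :: rat set)}"
      using countable_lists[of "(UNIV :: 'd site set) \<times> D \<times> (UNIV :: rat set)"] D(1) 
      by (simp add: lists_eq_set)
    then have cI: "countable I" by (rule countable_subset[rotated]) (auto simp: I_def)
    have "g -` U \<inter> space M = (\<Union>xs\<in>I. {\<omega> \<in> space M. g \<omega> \<in> C xs})"
    proof safe
      fix \<omega> assume \<omega>: "\<omega> \<in> space M" "g \<omega> \<in> U"
      obtain X where X: "g \<omega> \<in> Pi\<^sub>E UNIV X" "\<And>k. open (X k)" "finite {k. X k \<noteq> UNIV}" "Pi\<^sub>E UNIV X \<subseteq> U"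
        using product_topology_open_contains_basis[of "\<lambda>_. euclidean" UNIV U "g \<omega>"] U \<omega>(2)
        unfolding open_fun_def by auto
      have "\<exists>d q. d \<in> D \<and> dist (g \<omega> k) d < real_of_rat q \<and> ball d (of_rat q) \<subseteq> X k" for k
      proof -
        have "g \<omega> k \<in> X k" using X(1) by auto
        then obtain e where e: "e > 0" "ball (g \<omega> k) e \<subseteq> X k" using X(2) openE by blast
        obtain q where q: "0 < q" "real_of_rat q < e / 2"
          using of_rat_dense[of 0 "e/2"] e(1) by (auto simp: zero_less_of_rat_iff)
        obtain d where d: "d \<in> D" "dist (g \<omega> k) d < of_rat q"
          using D(3)[of "g \<omega> k" "of_rat q"] q assms(2)[OF \<omega>(1)] by (auto dest: OmegaD)
        have "ball d (of_rat q) \<subseteq> ball (g \<omega> k) e"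
        proof
          fix x assume "x \<in> ball d (real_of_rat q)"
          then show "x \<in> ball (g \<omega> k) e" using dist_triangle[of "g \<omega> k" x d] d q by auto
        qed
        then show ?thesis using d e by blast
      qed
      then obtain d q where dq: "\<And>k. d k \<in> D" "\<And>k. dist (g \<omega> k) (d k) < real_of_rat (q k)"
        "\<And>k. ball (d k) (of_rat (q k)) \<subseteq> X k" by metis
      obtain ks where ks: "set ks = {k. X k \<noteq> UNIV}" using X(3) finite_list by blast
      define xs where "xs = map (\<lambda>k. (k, d k, q k)) ks"
      have "C xs \<subseteq> Pi\<^sub>E UNIV X"
      proof
        fix \<eta> assume \<eta>: "\<eta> \<in> C xs"
        have "\<eta> k \<in> X k" for k
        proof (cases "X k = UNIV")
          case False
          then have "dist (\<eta> k) (d k) < of_rat (q k)" using \<eta> ks by (auto simp: C_def xs_def)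
          then show ?thesis using dq(3)[of k] by (auto simp: dist_commute subset_iff)
        qed simp
        then show "\<eta> \<in> Pi\<^sub>E UNIV X" by auto
      qed
      then have "xs \<in> I" using X(4) dq(1) by (auto simp: I_def xs_def)
      moreover have "g \<omega> \<in> C xs" using dq(2) by (auto simp: C_def xs_def)
      ultimately show "\<omega> \<in> (\<Union>xs\<in>I. {\<omega> \<in> space M. g \<omega> \<in> C xs})" using \<omega> by auto
    qed (auto simp: I_def)
    also have "\<dots> \<in> sets M"
    proof -
      have "{\<omega> \<in> space M. g \<omega> \<in> C xs} \<in> sets M" for xs
        unfolding C_def by (auto simp: case_prod_beta)
      then show ?thesis by (intro sets.countable_UN'[OF cI]) auto
    qed
    finally show "g -` U \<inter> space M \<in> sets M" .
  qed
qed

lemma measurable_eval_Omega: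
  "(\<lambda>\<omega>::'d::finite config. apply_bcontfun (\<omega> k) \<tau>) \<in> borel_measurable (Omega_space \<beta>)"
  unfolding Omega_space_def
  by (intro measurable_restrict_space1 borel_measurable_continuous_onI
      continuous_on_compose2[OF continuous_apply_bcontfun continuous_on_product_coordinates]) auto

text \<open>Rounding \<open>g\<close> down to a grid leaves countably many evaluations, and path
  continuity carries measurability to the limit. This yields joint measurability in configuration
  and time, which integrals over the circle require.\<close>

lemma measurable_eval_pair:
  assumes "\<And>\<tau>. (\<lambda>\<omega>. apply_bcontfun (f \<omega>) \<tau>) \<in> borel_measurable M" "g \<in> borel_measurable M"
  shows "(\<lambda>\<omega>::'a. apply_bcontfun (f \<omega> :: loop) (g \<omega>)) \<in> borel_measurable M"
proof -
  define u where "u = (\<lambda>n (\<omega>::'a). apply_bcontfun (f \<omega>) (of_int \<lfloor>real (Suc n) * g \<omega>\<rfloor> / real (Suc n)))"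
  have lim: "(\<lambda>n. u n \<omega>) \<longlonglongrightarrow> apply_bcontfun (f \<omega>) (g \<omega>)" for \<omega>
  proof -
  have "(\<lambda>n. of_int \<lfloor>real (Suc n) * g \<omega>\<rfloor> / real (Suc n)) \<longlonglongrightarrow> g \<omega>"
  proof (rule real_tendsto_sandwich)
    show "\<forall>\<^sub>F n in sequentially. g \<omega> - 1 / real (Suc n) \<le> of_int \<lfloor>real (Suc n) * g \<omega>\<rfloor> / real (Suc n)"
    proof (rule always_eventually, rule allI)
      fix n
      have "real (Suc n) * g \<omega> - 1 \<le> of_int \<lfloor>real (Suc n) * g \<omega>\<rfloor>" by linarith
      then have "(real (Suc n) * g \<omega> - 1) / real (Suc n) \<le> of_int \<lfloor>real (Suc n) * g \<omega>\<rfloor> / real (Suc n)"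
        by (rule divide_right_mono) simp
      then show "g \<omega> - 1 / real (Suc n) \<le> of_int \<lfloor>real (Suc n) * g \<omega>\<rfloor> / real (Suc n)"
        by (simp add: diff_divide_distrib)
    qed
    show "\<forall>\<^sub>F n in sequentially. of_int \<lfloor>real (Suc n) * g \<omega>\<rfloor> / real (Suc n) \<le> g \<omega>"
      by (rule always_eventually) (auto simp: field_simps)
    show "(\<lambda>n. g \<omega> - 1 / real (Suc n)) \<longlonglongrightarrow> g \<omega>"
      using tendsto_diff[OF tendsto_const LIMSEQ_inverse_real_of_nat, of "g \<omega>"] by (simp add: inverse_eq_divide)
  qed auto
  then show ?thesis
    unfolding u_def by (rule continuous_on_tendsto_compose[OF continuous_on_apply_bcontfun[of UNIV]]) auto
  qed
  have "u n \<in> borel_measurable M" for n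
    unfolding u_def by (rule measurable_compose_countable[where g = "\<lambda>\<omega>. \<lfloor>real (Suc n) * g \<omega>\<rfloor>"
          and f = "\<lambda>i \<omega>. apply_bcontfun (f \<omega>) (of_int i / real (Suc n))"])
       (use assms in measurable)
  from borel_measurable_LIMSEQ_real[OF lim this] show ?thesis .
qed

lemma measurable_circle_int:
  assumes "(\<lambda>(\<omega>, \<tau>). F \<omega> \<tau>) \<in> borel_measurable (M \<Otimes>\<^sub>M lborel)"
  shows "(\<lambda>\<omega>. circle_int \<beta> (F \<omega>)) \<in> borel_measurable M"
proof -
  have "(\<lambda>(\<omega>, \<tau>). indicator {0..<\<beta>} \<tau> *\<^sub>R F \<omega> \<tau>) \<in> borel_measurable (M \<Otimes>\<^sub>M lborel)"
    using assms by measurable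
  then show ?thesis
    unfolding circle_int_def set_lebesgue_integral_def
    by (rule lborel.borel_measurable_lebesgue_integral)
qed

section \<open>Fourier coefficients and Fejer means\<close>

lemma set_integrable_circle:
  "continuous_on {0..\<beta>} f \<Longrightarrow> set_integrable lborel {0..<\<beta>} (f :: real \<Rightarrow> real)"
  by (rule set_integrable_subset[OF borel_integrable_atLeastAtMost']) auto

lemma circle_int_add:
  "continuous_on {0..\<beta>} f \<Longrightarrow> continuous_on {0..\<beta>} g \<Longrightarrow>
    circle_int \<beta> (\<lambda>\<tau>. f \<tau> + g \<tau>) = circle_int \<beta> f + circle_int \<beta> g"
  unfolding circle_int_def by (intro set_integral_add set_integrable_circle)

lemma circle_int_diff:
  "continuous_on {0..\<beta>} f \<Longrightarrow> continuous_on {0..\<beta>} g \<Longrightarrow>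
    circle_int \<beta> (\<lambda>\<tau>. f \<tau> - g \<tau>) = circle_int \<beta> f - circle_int \<beta> g"
  unfolding circle_int_def by (intro set_integral_diff set_integrable_circle)

lemma circle_int_cmult: "circle_int \<beta> (\<lambda>\<tau>. c * f \<tau>) = c * circle_int \<beta> f"
  unfolding circle_int_def by simp

lemma circle_int_sum:
  "(\<And>i. i \<in> I \<Longrightarrow> continuous_on {0..\<beta>} (f i)) \<Longrightarrow>
    circle_int \<beta> (\<lambda>\<tau>. \<Sum>i\<in>I. f i \<tau>) = (\<Sum>i\<in>I. circle_int \<beta> (f i))"
proof (induction I rule: infinite_finite_induct)
  case (insert i I)
  have "continuous_on {0..\<beta>} (\<lambda>\<tau>. \<Sum>i\<in>I. f i \<tau>)" by (intro continuous_on_sum insert) auto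
  then show ?case using insert by (simp add: circle_int_add)
qed (simp_all add: circle_int_def)

lemma circle_int_mono:
  "continuous_on {0..\<beta>} f \<Longrightarrow> continuous_on {0..\<beta>} g \<Longrightarrow> (\<And>\<tau>. \<tau> \<in> {0..<\<beta>} \<Longrightarrow> f \<tau> \<le> g \<tau>) \<Longrightarrow>
    circle_int \<beta> f \<le> circle_int \<beta> g"
  unfolding circle_int_def by (intro set_integral_mono set_integrable_circle)

lemma circle_int_const: "\<beta> > 0 \<Longrightarrow> circle_int \<beta> (\<lambda>\<tau>. c) = \<beta> * c"
  unfolding circle_int_def by (simp add: set_lebesgue_integral_def)

lemma circle_int_abs_le:
  assumes "continuous_on {0..\<beta>} f" "continuous_on {0..\<beta>} g" "\<And>\<tau>. \<tau> \<in> {0..<\<beta>} \<Longrightarrow> \<bar>f \<tau>\<bar> \<le> g \<tau>"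
  shows "\<bar>circle_int \<beta> f\<bar> \<le> circle_int \<beta> g"
proof -
  have "circle_int \<beta> f \<le> circle_int \<beta> g"
    using assms(3) by (intro circle_int_mono assms) (simp add: abs_le_iff)
  moreover have "circle_int \<beta> (\<lambda>\<tau>. (-1) * f \<tau>) \<le> circle_int \<beta> g"
    using assms(3) by (intro circle_int_mono continuous_intros assms) (simp add: abs_le_iff)
  ultimately show ?thesis unfolding circle_int_cmult by linarith
qed

lemma circle_int_FTC:
  assumes "\<beta> > 0" "\<And>\<tau>. (F has_real_derivative f \<tau>) (at \<tau>)" "continuous_on UNIV f"
  shows "circle_int \<beta> f = F \<beta> - F 0"
proof -
  have [measurable]: "f \<in> borel_measurable borel" by (rule borel_measurable_continuous_onI) fact
  have "AE \<tau> in lborel. indicator {0..<\<beta>} \<tau> *\<^sub>R f \<tau> = f \<tau> * indicator {0..\<beta>} \<tau>"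
    using AE_lborel_singleton[of \<beta>] by eventually_elim (auto simp: indicator_def)
  then have "circle_int \<beta> f = (\<integral>\<tau>. f \<tau> * indicator {0..\<beta>} \<tau> \<partial>lborel)"
    unfolding circle_int_def set_lebesgue_integral_def by (intro integral_cong_AE) auto
  also have "\<dots> = F \<beta> - F 0"
    using assms by (intro integral_FTC_Icc_real) (auto simp: continuous_on_eq_continuous_at)
  finally show ?thesis .
qed

section \<open>Orthonormality of the eigenfunctions\<close>

lemma circle_int_cos:
  assumes "\<beta> > 0"
  shows "circle_int \<beta> (\<lambda>\<tau>. cos (2 * pi * of_int n * \<tau> / \<beta>)) = (if n = 0 then \<beta> else 0)"
proof (cases "n = 0")
  case False
  have "circle_int \<beta> (\<lambda>\<tau>. cos (2 * pi * of_int n * \<tau> / \<beta>)) =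
     sin (2 * pi * of_int n * \<beta> / \<beta>) / (2 * pi * of_int n / \<beta>) - sin (2 * pi * of_int n * 0 / \<beta>) / (2 * pi * of_int n / \<beta>)"
    using assms False
    by (intro circle_int_FTC) (auto intro!: derivative_eq_intros continuous_intros simp: field_simps)
  also have "\<dots> = 0" using assms by (simp add: sin_int_2pin)
  finally show ?thesis using False by simp
qed (use assms in \<open>simp add: circle_int_const\<close>)

lemma circle_int_sin:
  assumes "\<beta> > 0"
  shows "circle_int \<beta> (\<lambda>\<tau>. sin (2 * pi * of_int n * \<tau> / \<beta>)) = 0"
proof (cases "n = 0")
  case False
  have "circle_int \<beta> (\<lambda>\<tau>. sin (2 * pi * of_int n * \<tau> / \<beta>)) =
     - cos (2 * pi * of_int n * \<beta> / \<beta>) / (2 * pi * of_int n / \<beta>) - (- cos (2 * pi * of_int n * 0 / \<beta>) / (2 * pi * of_int n / \<beta>))"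
    using assms False
    by (intro circle_int_FTC) (auto intro!: derivative_eq_intros continuous_intros simp: field_simps)
  also have "\<dots> = 0" using assms by (simp add: cos_int_2pin)
  finally show ?thesis by simp
qed (use assms in \<open>simp add: circle_int_const\<close>)

text \<open>Two amplitudes, one of them always zero, put constant, cosine and sine modes into one
  formula. Orthogonality then follows from a single product-to-sum expansion, and only the
  amplitudes need a case split.\<close>

definition phi_cos :: "real \<Rightarrow> int \<Rightarrow> real" where
  "phi_cos \<beta> n = (if n = 0 then \<beta> powr (- 1 / 2) else if n \<ge> 1 then sqrt (2 / \<beta>) else 0)"

definition phi_sin :: "real \<Rightarrow> int \<Rightarrow> real" where
  "phi_sin \<beta> n = (if n < 0 then - sqrt (2 / \<beta>) else 0)"

lemma phi_eq:
  "apply_bcontfun (phi \<beta> n) \<tau> =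
    phi_cos \<beta> n * cos (2 * pi * of_int n * \<tau> / \<beta>) + phi_sin \<beta> n * sin (2 * pi * of_int n * \<tau> / \<beta>)"
  by (auto simp: apply_phi phi_cos_def phi_sin_def)

lemma phi_cos_zero_sq: "\<beta> > 0 \<Longrightarrow> \<beta> powr (- 1 / 2) * \<beta> powr (- 1 / 2) = 1 / (\<beta> :: real)"
  by (simp add: powr_add[symmetric] powr_minus_divide)

lemma phi_in_loops [simp]:
  assumes "\<beta> > 0"
  shows "phi \<beta> n \<in> loops \<beta>"
proof -
  have "2 * pi * of_int n * (\<tau> + \<beta>) / \<beta> = 2 * pi * of_int n * \<tau> / \<beta> + 2 * pi * of_int n" for \<tau>
    using assms by (simp add: field_simps)
  then show ?thesis
    by (simp add: loops_def phi_eq cos_add sin_add cos_int_2pin sin_int_2pin)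
qed

definition loop_coeff :: "real \<Rightarrow> int \<Rightarrow> loop \<Rightarrow> real" where
  "loop_coeff \<beta> n z = loop_inner \<beta> (apply_bcontfun (phi \<beta> n)) (apply_bcontfun z)"

lemma loop_coeff_add: "loop_coeff \<beta> n (x + y) = loop_coeff \<beta> n x + loop_coeff \<beta> n y"
  and loop_coeff_scaleR: "loop_coeff \<beta> n (c *\<^sub>R x) = c * loop_coeff \<beta> n x"
proof -
  show "loop_coeff \<beta> n (x + y) = loop_coeff \<beta> n x + loop_coeff \<beta> n y"
    unfolding loop_coeff_def loop_inner_def
    by (subst circle_int_add[symmetric]) (auto intro!: continuous_intros simp: algebra_simps)
  show "loop_coeff \<beta> n (c *\<^sub>R x) = c * loop_coeff \<beta> n x"
    unfolding loop_coeff_def loop_inner_def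
    by (subst circle_int_cmult[symmetric]) (simp add: algebra_simps)
qed

lemma loop_coeff_zero [simp]: "loop_coeff \<beta> n 0 = 0"
  using loop_coeff_scaleR[of \<beta> n 0 0] by simp

lemma loop_coeff_sum: "loop_coeff \<beta> n (sum f I) = (\<Sum>i\<in>I. loop_coeff \<beta> n (f i))"
  by (induction I rule: infinite_finite_induct) (auto simp: loop_coeff_add)

lemma loop_coeff_phi:
  assumes "\<beta> > 0"
  shows "loop_coeff \<beta> n (phi \<beta> l) = (if n = l then 1 else 0)"
proof -
  define C S where "C = (\<lambda>j \<tau>. cos (2 * pi * of_int j * \<tau> / \<beta>))" and "S = (\<lambda>j \<tau>. sin (2 * pi * of_int j * \<tau> / \<beta>))"
  have arg: "2 * pi * of_int (n - l) * \<tau> / \<beta> = 2 * pi * of_int n * \<tau> / \<beta> - 2 * pi * of_int l * \<tau> / \<beta>"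
    "2 * pi * of_int (n + l) * \<tau> / \<beta> = 2 * pi * of_int n * \<tau> / \<beta> + 2 * pi * of_int l * \<tau> / \<beta>" for \<tau>
    using assms by (simp_all add: field_simps)
  have trig: "C (n - l) \<tau> = C n \<tau> * C l \<tau> + S n \<tau> * S l \<tau>" "C (n + l) \<tau> = C n \<tau> * C l \<tau> - S n \<tau> * S l \<tau>"
    "S (n + l) \<tau> = S n \<tau> * C l \<tau> + C n \<tau> * S l \<tau>" "S (n - l) \<tau> = S n \<tau> * C l \<tau> - C n \<tau> * S l \<tau>" for \<tau>
    unfolding C_def S_def arg by (simp_all add: cos_add cos_diff sin_add sin_diff)
  \<comment> \<open>Product-to-sum coefficients. The sine terms integrate to zero; \<open>a\<close>
    survives only for \<open>n = l\<close>, and \<open>b\<close> only for \<open>n = - l\<close>,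
    where it vanishes for \<open>n \<noteq> 0\<close> because one mode is then a cosine and the
    other a sine.\<close>
  define a b c d where "a = (phi_cos \<beta> n * phi_cos \<beta> l + phi_sin \<beta> n * phi_sin \<beta> l) / 2"
    and "b = (phi_cos \<beta> n * phi_cos \<beta> l - phi_sin \<beta> n * phi_sin \<beta> l) / 2"
    and "c = (phi_cos \<beta> n * phi_sin \<beta> l + phi_sin \<beta> n * phi_cos \<beta> l) / 2"
    and "d = (phi_sin \<beta> n * phi_cos \<beta> l - phi_cos \<beta> n * phi_sin \<beta> l) / 2"
  have "apply_bcontfun (phi \<beta> n) \<tau> * apply_bcontfun (phi \<beta> l) \<tau> =
     a * C (n - l) \<tau> + (b * C (n + l) \<tau> + (c * S (n + l) \<tau> + d * S (n - l) \<tau>))" for \<tau>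
  proof -
    have p: "apply_bcontfun (phi \<beta> j) \<tau> = phi_cos \<beta> j * C j \<tau> + phi_sin \<beta> j * S j \<tau>" for j
      by (simp add: phi_eq C_def S_def)
    show ?thesis unfolding p trig a_def b_def c_def d_def by (simp add: field_simps)
  qed
  moreover have "circle_int \<beta> (\<lambda>\<tau>. a * C (n - l) \<tau> + (b * C (n + l) \<tau> + (c * S (n + l) \<tau> + d * S (n - l) \<tau>)))
    = a * circle_int \<beta> (C (n - l)) + b * circle_int \<beta> (C (n + l))
      + c * circle_int \<beta> (S (n + l)) + d * circle_int \<beta> (S (n - l))"
    unfolding circle_int_cmult[symmetric]
    by (subst circle_int_add; (subst circle_int_add; (subst circle_int_add)?)?)
       (use assms in \<open>auto intro!: continuous_intros simp: C_def S_def\<close>)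
  ultimately have "loop_coeff \<beta> n (phi \<beta> l) = a * (if n = l then \<beta> else 0) + b * (if n = - l then \<beta> else 0)"
    unfolding loop_coeff_def loop_inner_def C_def S_def
    by (simp only: circle_int_cos[OF assms] circle_int_sin[OF assms]) (simp add: eq_neg_iff_add_eq_0)
  also have "\<dots> = (if n = l then 1 else 0)"
  proof -
    have q: "sqrt (2 / \<beta>) * sqrt (2 / \<beta>) = 2 / \<beta>" using assms by simp
    consider "n = 0" "l = 0" | "n = l" "n > 0" | "n = l" "n < 0" | "n = - l" "n > 0" | "n = - l" "n < 0" | "n \<noteq> l" "n \<noteq> - l"
      by linarith
    then show ?thesis
    proof cases
      case 1
      then have "a = 1 / \<beta> / 2" "b = 1 / \<beta> / 2"
        unfolding a_def b_def phi_cos_def phi_sin_def using phi_cos_zero_sq[OF assms] by simp_all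
      with 1 assms show ?thesis by simp
    next
      case 2
      then have "a = 2 / \<beta> / 2" unfolding a_def phi_cos_def phi_sin_def using q by simp
      with 2 assms show ?thesis by simp
    next
      case 3
      then have "a = 2 / \<beta> / 2" unfolding a_def phi_cos_def phi_sin_def using q by simp
      with 3 assms show ?thesis by simp
    qed (simp_all add: b_def phi_cos_def phi_sin_def)
  qed
  finally show ?thesis .
qed

section \<open>Fejer kernel and uniform convergence of Fejer means\<close>

definition fejer_kernel :: "nat \<Rightarrow> real \<Rightarrow> real" where
  "fejer_kernel n t = (\<Sum>i<n. \<Sum>j<n. cos (of_int (int i - int j) * t)) / n"

text \<open>The average of Dirichlet kernels, kept as a sum over pairs, is a squared modulus. This
  gives positivity at once and exposes a geometric series.\<close>

lemma fejer_kernel_eq: "fejer_kernel n t = (norm (\<Sum>i<n. cis (of_nat i * t)))\<^sup>2 / n"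
proof -
  have "(\<Sum>i<n. \<Sum>j<n. cos (of_int (int i - int j) * t)) =
     (\<Sum>i<n. \<Sum>j<n. cos (real i * t) * cos (real j * t) + sin (real i * t) * sin (real j * t))"
    by (intro sum.cong refl) (simp add: left_diff_distrib cos_diff)
  also have "\<dots> = (\<Sum>i<n. cos (real i * t))\<^sup>2 + (\<Sum>i<n. sin (real i * t))\<^sup>2"
    by (simp add: sum.distrib power2_eq_square sum_product)
  also have "\<dots> = (norm (\<Sum>i<n. cis (of_nat i * t)))\<^sup>2"
    by (simp add: cmod_power2)
  finally show ?thesis by (simp add: fejer_kernel_def)
qed

lemma fejer_kernel_nonneg: "fejer_kernel n t \<ge> 0"
  by (simp add: fejer_kernel_eq)

text \<open>Summing the geometric series shows that the kernel concentrates at \<open>0\<close>.\<close>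

lemma fejer_kernel_bound: "fejer_kernel n t * (1 - cos t) \<le> 2 / n"
proof -
  have "(norm (1 - cis t))\<^sup>2 = 2 * (1 - cos t)"
    using sin_cos_squared_add[of t] unfolding cmod_power2 by (simp add: power2_eq_square algebra_simps)
  then have "(norm (\<Sum>i<n. cis (of_nat i * t)))\<^sup>2 * (1 - cos t)
      = (norm ((1 - cis t) * (\<Sum>i<n. cis (of_nat i * t))))\<^sup>2 / 2"
    by (simp add: norm_mult power_mult_distrib)
  also have "(1 - cis t) * (\<Sum>i<n. cis (of_nat i * t)) = 1 - cis t ^ n"
    unfolding one_diff_power_eq[of "cis t" n]
    by (intro arg_cong2[where f = "(*)"] refl sum.cong) (simp add: Complex.DeMoivre)
  also have "norm (1 - cis t ^ n) \<le> 2"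
    using norm_triangle_ineq4[of 1 "cis t ^ n"] by (simp add: norm_power)
  then have "(norm (1 - cis t ^ n))\<^sup>2 / 2 \<le> 2"
    using power_mono[of "norm (1 - cis t ^ n)" 2 2] by simp
  finally show ?thesis unfolding fejer_kernel_eq
    by (simp add: divide_right_mono)
qed

text \<open>For \<open>n > 0\<close> this is the triangle weight \<open>max 0 (1 - |l| / n)\<close>.
  Counting the same pairs as in \<open>fejer_kernel\<close> makes the passage from coefficients to
  the kernel a mere regrouping.\<close>

definition fejer_weight :: "nat \<Rightarrow> int \<Rightarrow> real" where
  "fejer_weight n l = card {(i, j). i < n \<and> j < n \<and> int i - int j = l} / n"

lemma fejer_weight_nonneg: "0 \<le> fejer_weight n l"
  by (simp add: fejer_weight_def)

lemma fejer_weight_le_1: "fejer_weight n l \<le> 1"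
proof -
  have "card {(i, j). i < n \<and> j < n \<and> int i - int j = l} \<le> card {..<n}"
    by (rule card_inj_on_le[of fst]) (auto simp: inj_on_def)
  then show ?thesis by (cases "n = 0") (auto simp: fejer_weight_def divide_le_eq)
qed

definition fejer_mean :: "real \<Rightarrow> nat \<Rightarrow> loop \<Rightarrow> loop" where
  "fejer_mean \<beta> n z = (\<Sum>l\<in>{- int n..int n}. (fejer_weight n l * loop_coeff \<beta> l z) *\<^sub>R phi \<beta> l)"

text \<open>Pairs are grouped by their difference. The range may include \<open>- n\<close> and
  \<open>n\<close> since their weights are zero.\<close>

lemma sum_fejer_weight:
  fixes g :: "int \<Rightarrow> real"
  shows "(\<Sum>l\<in>{- int n..int n}. fejer_weight n l * g l) = (\<Sum>i<n. \<Sum>j<n. g (int i - int j)) / n"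
proof -
  have "(\<Sum>i<n. \<Sum>j<n. g (int i - int j)) = (\<Sum>p\<in>{..<n} \<times> {..<n}. g (int (fst p) - int (snd p)))"
    by (simp add: sum.cartesian_product case_prod_beta)
  also have "\<dots> = (\<Sum>l\<in>{- int n..int n}. \<Sum>p\<in>{p \<in> {..<n} \<times> {..<n}. int (fst p) - int (snd p) = l}. g (int (fst p) - int (snd p)))"
    by (rule sum.group[symmetric]) auto
  also have "\<dots> = (\<Sum>l\<in>{- int n..int n}. real n * fejer_weight n l * g l)"
  proof (rule sum.cong[OF refl])
    fix l
    define A where "A = {p \<in> {..<n} \<times> {..<n}. int (fst p) - int (snd p) = l}"
    have A: "A = {(i, j). i < n \<and> j < n \<and> int i - int j = l}" by (auto simp: A_def)
    have "(\<Sum>p\<in>A. g (int (fst p) - int (snd p))) = (\<Sum>p\<in>A. g l)"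
      by (rule sum.cong) (auto simp: A_def)
    also have "\<dots> = real n * fejer_weight n l * g l"
      unfolding fejer_weight_def A[symmetric] by (cases "n = 0") (simp_all add: A_def)
    finally show "(\<Sum>p\<in>{p \<in> {..<n} \<times> {..<n}. int (fst p) - int (snd p) = l}. g (int (fst p) - int (snd p)))
      = real n * fejer_weight n l * g l" unfolding A_def .
  qed
  also have "\<dots> = n * (\<Sum>l\<in>{- int n..int n}. fejer_weight n l * g l)"
    by (simp add: sum_distrib_left mult.assoc)
  finally show ?thesis by (cases "n = 0") (simp_all add: fejer_weight_def)
qed

text \<open>One mode alone does not give a translation invariant kernel, but sine and cosine of
  equal frequency together do. At \<open>l = 0\<close> the constant mode is counted twice, which
  agrees with the factor 2.\<close>

lemma phi_pair:
  assumes "\<beta> > 0"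
  shows "apply_bcontfun (phi \<beta> l) s * apply_bcontfun (phi \<beta> l) t + apply_bcontfun (phi \<beta> (- l)) s * apply_bcontfun (phi \<beta> (- l)) t
    = 2 / \<beta> * cos (2 * pi * of_int l * (t - s) / \<beta>)"
proof -
  have "2 * pi * of_int l * (t - s) / \<beta> = 2 * pi * of_int l * t / \<beta> - 2 * pi * of_int l * s / \<beta>"
    using assms by (simp add: field_simps)
  then have c: "cos (2 * pi * of_int l * (t - s) / \<beta>) = cos (2 * pi * of_int l * t / \<beta>) * cos (2 * pi * of_int l * s / \<beta>)
     + sin (2 * pi * of_int l * t / \<beta>) * sin (2 * pi * of_int l * s / \<beta>)" by (simp add: cos_diff)
  have r: "sqrt (2 / \<beta>) * a * (sqrt (2 / \<beta>) * b) = 2 / \<beta> * (a * b)" for a b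
  proof -
    have "sqrt (2 / \<beta>) * a * (sqrt (2 / \<beta>) * b) = (sqrt (2 / \<beta>) * sqrt (2 / \<beta>)) * (a * b)" by (simp only: mult_ac)
    also have "sqrt (2 / \<beta>) * sqrt (2 / \<beta>) = 2 / \<beta>" using assms by simp
    finally show ?thesis .
  qed
  consider "l = 0" | "l > 0" | "l < 0" by linarith
  then show ?thesis
  proof cases
    case 1 then show ?thesis using phi_cos_zero_sq[OF assms] by (simp add: apply_phi)
  next
    case 2
    then have "\<not> - l \<ge> 1" by simp
    with 2 show ?thesis unfolding c apply_phi by (simp del: real_sqrt_divide) (simp only: r, simp add: algebra_simps add_divide_distrib)
  next
    case 3
    then have "\<not> l \<ge> 1" "- l \<ge> 1" by simp_all
    with 3 show ?thesis unfolding c apply_phi by (simp del: real_sqrt_divide) (simp only: r, simp add: algebra_simps add_divide_distrib)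
  qed
qed

lemma fejer_mean_eq:
  assumes "\<beta> > 0"
  shows "apply_bcontfun (fejer_mean \<beta> n z) t
    = circle_int \<beta> (\<lambda>s. fejer_kernel n (2 * pi * (t - s) / \<beta>) * apply_bcontfun z s) / \<beta>"
proof -
  define g where "g = (\<lambda>l. loop_coeff \<beta> l z * apply_bcontfun (phi \<beta> l) t)"
  have g2: "g l + g (- l) = circle_int \<beta> (\<lambda>s. 2 / \<beta> * (cos (2 * pi * of_int l * (t - s) / \<beta>) * apply_bcontfun z s))" for l
  proof -
    have "g l + g (- l) = circle_int \<beta> (\<lambda>s. apply_bcontfun (phi \<beta> l) t * (apply_bcontfun (phi \<beta> l) s * apply_bcontfun z s)
       + apply_bcontfun (phi \<beta> (- l)) t * (apply_bcontfun (phi \<beta> (- l)) s * apply_bcontfun z s))"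
      by (subst circle_int_add) (auto intro!: continuous_intros simp: circle_int_cmult g_def loop_coeff_def loop_inner_def)
    also have "(\<lambda>s. apply_bcontfun (phi \<beta> l) t * (apply_bcontfun (phi \<beta> l) s * apply_bcontfun z s)
       + apply_bcontfun (phi \<beta> (- l)) t * (apply_bcontfun (phi \<beta> (- l)) s * apply_bcontfun z s)) = 
       (\<lambda>s. (apply_bcontfun (phi \<beta> l) s * apply_bcontfun (phi \<beta> l) t + apply_bcontfun (phi \<beta> (- l)) s * apply_bcontfun (phi \<beta> (- l)) t) * apply_bcontfun z s)"
      by (simp add: algebra_simps)
    finally show ?thesis unfolding phi_pair[OF assms] by (simp add: mult.assoc)
  qed
  have "apply_bcontfun (fejer_mean \<beta> n z) t = (\<Sum>i<n. \<Sum>j<n. g (int i - int j)) / n"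
    using sum_fejer_weight[of n g] unfolding g_def by (simp add: fejer_mean_def apply_bcontfun_sum mult.assoc)
  \<comment> \<open>Exchanging \<open>i\<close> and \<open>j\<close> turns the frequency
    \<open>l\<close> into \<open>- l\<close>; averaging the two sums produces the mode pairs that
    combine to a convolution kernel.\<close>
  also have "(\<Sum>i<n. \<Sum>j<n. g (int i - int j)) = (\<Sum>i<n. \<Sum>j<n. g (int i - int j) + g (- (int i - int j))) / 2"
    using sum.swap[of "\<lambda>i j. g (int i - int j)" "{..<n}" "{..<n}"] by (simp add: sum.distrib)
  also have "(\<Sum>i<n. \<Sum>j<n. g (int i - int j) + g (- (int i - int j))) =
     circle_int \<beta> (\<lambda>s. \<Sum>i<n. \<Sum>j<n. 2 / \<beta> * (cos (2 * pi * of_int (int i - int j) * (t - s) / \<beta>) * apply_bcontfun z s))"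
    unfolding g2 by (subst circle_int_sum, (use assms in \<open>auto intro!: continuous_intros\<close>)[1], subst circle_int_sum)
      (use assms in \<open>auto intro!: continuous_intros\<close>)
  also have "\<dots> = circle_int \<beta> (\<lambda>s. 2 / \<beta> * n * (fejer_kernel n (2 * pi * (t - s) / \<beta>) * apply_bcontfun z s))"
  proof (rule arg_cong[where f = "circle_int \<beta>"], rule ext)
    fix s
    have "(\<Sum>i<n. \<Sum>j<n. 2 / \<beta> * (cos (2 * pi * of_int (int i - int j) * (t - s) / \<beta>) * apply_bcontfun z s))
      = 2 / \<beta> * ((\<Sum>i<n. \<Sum>j<n. cos (2 * pi * of_int (int i - int j) * (t - s) / \<beta>)) * apply_bcontfun z s)"
      by (simp only: sum_distrib_left sum_distrib_right)
    also have "(\<Sum>i<n. \<Sum>j<n. cos (2 * pi * of_int (int i - int j) * (t - s) / \<beta>))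
      = n * fejer_kernel n (2 * pi * (t - s) / \<beta>)"
    proof -
      have arg: "2 * pi * of_int k * (t - s) / \<beta> = of_int k * (2 * pi * (t - s) / \<beta>)" for k by simp
      show ?thesis unfolding fejer_kernel_def arg by (cases "n = 0") (simp_all del: of_int_diff)
    qed
    finally show "(\<Sum>i<n. \<Sum>j<n. 2 / \<beta> * (cos (2 * pi * of_int (int i - int j) * (t - s) / \<beta>) * apply_bcontfun z s))
      = 2 / \<beta> * n * (fejer_kernel n (2 * pi * (t - s) / \<beta>) * apply_bcontfun z s)" by (simp only: mult_ac)
  qed
  finally show ?thesis unfolding circle_int_cmult using assms
    by (cases "n = 0") (simp_all add: fejer_kernel_def circle_int_const)
qed

lemma circle_int_fejer_kernel:
  assumes "\<beta> > 0" "n > 0"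
  shows "circle_int \<beta> (\<lambda>s. fejer_kernel n (2 * pi * (t - s) / \<beta>)) = \<beta>"
proof -
  have 1: "circle_int \<beta> (\<lambda>s. cos (of_int l * (2 * pi * (t - s) / \<beta>))) = (if l = 0 then \<beta> else 0)" for l
  proof -
    have "of_int l * (2 * pi * (t - s) / \<beta>) = 2 * pi * of_int l * t / \<beta> - 2 * pi * of_int l * s / \<beta>" for s
      using assms by (simp add: field_simps)
    then have "circle_int \<beta> (\<lambda>s. cos (of_int l * (2 * pi * (t - s) / \<beta>))) =
      circle_int \<beta> (\<lambda>s. cos (2 * pi * of_int l * t / \<beta>) * cos (2 * pi * of_int l * s / \<beta>)
         + sin (2 * pi * of_int l * t / \<beta>) * sin (2 * pi * of_int l * s / \<beta>))" by (simp add: cos_diff)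
    also have "\<dots> = cos (2 * pi * of_int l * t / \<beta>) * (if l = 0 then \<beta> else 0)"
      by (subst circle_int_add) (use assms in \<open>auto intro!: continuous_intros simp: circle_int_cmult circle_int_cos circle_int_sin\<close>)
    finally show ?thesis by auto
  qed
  have "circle_int \<beta> (\<lambda>s. fejer_kernel n (2 * pi * (t - s) / \<beta>)) =
     1 / n * circle_int \<beta> (\<lambda>s. (\<Sum>i<n. \<Sum>j<n. cos (of_int (int i - int j) * (2 * pi * (t - s) / \<beta>))))"
    unfolding circle_int_cmult[symmetric] fejer_kernel_def by simp
  also have "circle_int \<beta> (\<lambda>s. (\<Sum>i<n. \<Sum>j<n. cos (of_int (int i - int j) * (2 * pi * (t - s) / \<beta>)))) =
     (\<Sum>i<n. \<Sum>j<n. if i = j then \<beta> else 0)"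
    by (subst circle_int_sum, (use assms in \<open>auto intro!: continuous_intros\<close>)[1], subst circle_int_sum,
       (use assms in \<open>auto intro!: continuous_intros\<close>)[1], simp only: 1 right_minus_eq of_nat_eq_iff)
  also have "\<dots> = n * \<beta>" by simp
  finally show ?thesis using assms by simp
qed

text \<open>The modulus of continuity is traded for a bound in terms of \<open>1 - cos\<close>,
  exactly the quantity that the Fejer kernel controls. Convergence then needs no splitting of the
  integral into near and far parts.\<close>

lemma loop_modulus:
  assumes "\<beta> > 0" "z \<in> loops \<beta>" "e > 0"
  obtains C where "C \<ge> 0" "\<And>s t. \<bar>apply_bcontfun z s - apply_bcontfun z t\<bar> \<le> e + C * (1 - cos (2 * pi * (t - s) / \<beta>))"
proof -
  obtain d where d: "d > 0" "\<And>s t. \<bar>s - t\<bar> < d \<Longrightarrow> \<bar>apply_bcontfun z s - apply_bcontfun z t\<bar> < e"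
    using loop_uniformly_continuous[OF assms] by auto
  define d' where "d' = min d (\<beta> / 2)"
  define k where "k = 1 - cos (2 * pi * d' / \<beta>)"
  have d': "0 < d'" "d' \<le> \<beta> / 2" "d' \<le> d" using d assms by (auto simp: d'_def)
  then have kpi: "0 < 2 * pi * d' / \<beta>" "2 * pi * d' / \<beta> \<le> pi"
    using assms by (auto simp: field_simps)
  then have "cos (2 * pi * d' / \<beta>) < cos 0" by (intro cos_monotone_0_pi) auto
  then have k: "k > 0" by (simp add: k_def)
  have "\<bar>apply_bcontfun z s - apply_bcontfun z t\<bar> \<le> e + 2 * norm z / k * (1 - cos (2 * pi * (t - s) / \<beta>))" for s t
  proof -
    \<comment> \<open>The nearest number of periods: \<open>\<bar>u\<bar>\<close> is then at most
      half a period, where the cosine is decreasing.\<close>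
    define p where "p = round ((t - s) / \<beta>)"
    define u where "u = t - s - of_int p * \<beta>"
    have "\<bar>(t - s) / \<beta> - of_int p\<bar> \<le> 1 / 2" unfolding p_def
      using of_int_round_abs_le[of "(t-s)/\<beta>"] by (simp add: abs_minus_commute)
    then have "\<bar>(t - s) / \<beta> - of_int p\<bar> * \<beta> \<le> 1 / 2 * \<beta>" using assms by (intro mult_right_mono) auto
    moreover have "\<bar>(t - s) / \<beta> - of_int p\<bar> * \<beta> = \<bar>u\<bar>"
    proof -
      have "u = ((t - s) / \<beta> - of_int p) * \<beta>" using assms by (simp add: u_def field_simps)
      then show ?thesis using assms by (simp add: abs_mult)
    qed
    ultimately have u: "\<bar>u\<bar> \<le> \<beta> / 2" by simp
    have zt: "apply_bcontfun z t = apply_bcontfun z (s + u)"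
      using loop_add_int[OF assms(2), of "s + u" p] by (simp add: u_def)
    have "2 * pi * (t - s) / \<beta> = 2 * pi * u / \<beta> + 2 * pi * of_int p"
      using assms by (simp add: u_def field_simps)
    then have c: "cos (2 * pi * (t - s) / \<beta>) = cos (2 * pi * \<bar>u\<bar> / \<beta>)"
      by (simp add: cos_add sin_int_2pin cos_int_2pin abs_if)
    show ?thesis
    proof (cases "\<bar>u\<bar> < d'")
      case True
      then have "\<bar>apply_bcontfun z s - apply_bcontfun z t\<bar> < e" unfolding zt using d' by (intro d) auto
      moreover have "2 * norm z / k * (1 - cos (2 * pi * (t - s) / \<beta>)) \<ge> 0" using k by simp
      ultimately show ?thesis by linarith
    next
      \<comment> \<open>Far points: the difference is at most twice the norm, and
        \<open>1 - cos\<close> is at least \<open>k\<close> there, so the division by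
        \<open>k\<close> in the constant pays for it.\<close>
      case False
      have "2 * pi * \<bar>u\<bar> / \<beta> \<le> pi" using u assms by (auto simp: field_simps)
      moreover have "2 * pi * d' / \<beta> \<le> 2 * pi * \<bar>u\<bar> / \<beta>" using False assms by (intro divide_right_mono) auto
      ultimately have "cos (2 * pi * \<bar>u\<bar> / \<beta>) \<le> cos (2 * pi * d' / \<beta>)"
        using kpi by (intro cos_monotone_0_pi_le) auto
      then have "k \<le> 1 - cos (2 * pi * (t - s) / \<beta>)" by (simp add: k_def c)
      then have "2 * norm z / k * k \<le> 2 * norm z / k * (1 - cos (2 * pi * (t - s) / \<beta>))"
        using k by (intro mult_left_mono) auto
      then have "2 * norm z \<le> 2 * norm z / k * (1 - cos (2 * pi * (t - s) / \<beta>))" using k by simp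
      moreover have "\<bar>apply_bcontfun z s\<bar> \<le> norm z" "\<bar>apply_bcontfun z t\<bar> \<le> norm z"
        using norm_bounded[of z] by auto
      ultimately show ?thesis using assms(3) by linarith
    qed
  qed
  then show ?thesis using that[of "2 * norm z / k"] k by auto
qed

text \<open>The modulus inequality is integrated against the kernel: its constant part meets the
  total mass \<open>\<beta>\<close>, its \<open>1 - cos\<close> part the bound
  \<open>2 / n\<close>.\<close>

theorem fejer_mean_tendsto:
  assumes "\<beta> > 0" "z \<in> loops \<beta>"
  shows "(\<lambda>n. norm (z - fejer_mean \<beta> n z)) \<longlonglongrightarrow> 0"
proof (rule LIMSEQ_I)
  fix e :: real assume e: "e > 0"
  obtain C where C: "C \<ge> 0" "\<And>s t. \<bar>apply_bcontfun z s - apply_bcontfun z t\<bar> \<le> e / 2 + C * (1 - cos (2 * pi * (t - s) / \<beta>))"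
    using loop_modulus[OF assms, of "e/2"] e by auto
  \<comment> \<open>Chosen so that \<open>C * (2 / n) < e / 2\<close> for every
    \<open>n > m\<close>.\<close>
  obtain m :: nat where m: "real m > 4 * C / e" using reals_Archimedean2 by blast
  have "norm (z - fejer_mean \<beta> n z) < e" if n: "n \<ge> Suc m" for n
  proof -
    have n0: "n > 0" using n by simp
    have "\<bar>apply_bcontfun z t - apply_bcontfun (fejer_mean \<beta> n z) t\<bar> \<le> e / 2 + C * (2 / n)" for t
    proof -
      define K where "K = (\<lambda>s. fejer_kernel n (2 * pi * (t - s) / \<beta>))"
      have cK: "continuous_on A K" for A
        unfolding K_def fejer_kernel_def by (intro continuous_intros) (use n0 assms in auto)
      have "\<beta> * (apply_bcontfun z t - apply_bcontfun (fejer_mean \<beta> n z) t)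
         = circle_int \<beta> (\<lambda>s. apply_bcontfun z t * K s) - circle_int \<beta> (\<lambda>s. K s * apply_bcontfun z s)"
        using circle_int_fejer_kernel[OF assms(1) n0, of t] assms(1)
        by (simp add: K_def circle_int_cmult fejer_mean_eq right_diff_distrib)
      also have "\<dots> = circle_int \<beta> (\<lambda>s. apply_bcontfun z t * K s - K s * apply_bcontfun z s)"
        by (rule circle_int_diff[symmetric]; intro continuous_intros cK; simp)
      finally have "\<bar>\<beta> * (apply_bcontfun z t - apply_bcontfun (fejer_mean \<beta> n z) t)\<bar> =
         \<bar>circle_int \<beta> (\<lambda>s. apply_bcontfun z t * K s - K s * apply_bcontfun z s)\<bar>" by simp
      also have "\<dots> \<le> circle_int \<beta> (\<lambda>s. e / 2 * K s + C * (2 / n))"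
      proof (rule circle_int_abs_le)
        fix s
        have "\<bar>apply_bcontfun z t * K s - K s * apply_bcontfun z s\<bar> = K s * \<bar>apply_bcontfun z s - apply_bcontfun z t\<bar>"
        proof -
          have "apply_bcontfun z t * K s - K s * apply_bcontfun z s = K s * (apply_bcontfun z t - apply_bcontfun z s)"
            by (simp add: right_diff_distrib mult.commute)
          moreover have "K s \<ge> 0" by (simp add: K_def fejer_kernel_nonneg)
          ultimately show ?thesis by (simp add: abs_mult abs_minus_commute)
        qed
        also have "\<dots> \<le> K s * (e / 2 + C * (1 - cos (2 * pi * (t - s) / \<beta>)))"
          by (intro mult_left_mono C) (simp add: K_def fejer_kernel_nonneg)
        also have "\<dots> = e / 2 * K s + C * (K s * (1 - cos (2 * pi * (t - s) / \<beta>)))" by (simp add: algebra_simps)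
        also have "\<dots> \<le> e / 2 * K s + C * (2 / n)"
          unfolding K_def by (intro add_mono mult_left_mono fejer_kernel_bound C order_refl)
        finally show "\<bar>apply_bcontfun z t * K s - K s * apply_bcontfun z s\<bar> \<le> e / 2 * K s + C * (2 / n)" .
      qed (intro continuous_intros cK continuous_on_apply_bcontfun)+
      also have "\<dots> = \<beta> * (e / 2 + C * (2 / n))"
      proof -
        have "circle_int \<beta> K = \<beta>" unfolding K_def by (rule circle_int_fejer_kernel[OF assms(1) n0])
        moreover have "circle_int \<beta> (\<lambda>s. e / 2 * K s + C * (2 / n))
            = circle_int \<beta> (\<lambda>s. e / 2 * K s) + circle_int \<beta> (\<lambda>s. C * (2 / n))"
          by (intro circle_int_add continuous_intros cK)
        ultimately show ?thesis using circle_int_const[OF assms(1)] circle_int_cmult[of \<beta> "e/2" K]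
          by (simp only: distrib_left mult.commute)
      qed
      finally show ?thesis using assms(1) by (simp add: abs_mult)
    qed
    then have "norm (z - fejer_mean \<beta> n z) \<le> e / 2 + C * (2 / n)"
      by (intro norm_bound) simp
    also have "C * (2 / n) < e / 2"
    proof -
      have "4 * C / e < real n" using m n by linarith
      then show ?thesis using e n0 by (simp add: field_simps)
    qed
    finally show ?thesis by simp
  qed
  then show "\<exists>no. \<forall>n\<ge>no. norm (norm (z - fejer_mean \<beta> n z) - 0) < e" by auto
qed

section \<open>Gaussian coordinates\<close>

lemma measurable_loop_coeff:
  assumes "\<And>\<tau>. (\<lambda>\<omega>. apply_bcontfun (g \<omega>) \<tau>) \<in> borel_measurable M"
  shows "(\<lambda>\<omega>. loop_coeff \<beta> n (g \<omega>)) \<in> borel_measurable M"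
  unfolding loop_coeff_def loop_inner_def
proof (rule measurable_circle_int)
  have "(\<lambda>p. apply_bcontfun (g (fst p)) (snd p)) \<in> borel_measurable (M \<Otimes>\<^sub>M lborel)"
    by (rule measurable_eval_pair) (use assms in measurable)
  moreover have "(\<lambda>p. apply_bcontfun (phi \<beta> n) (snd p)) \<in> borel_measurable (M \<Otimes>\<^sub>M lborel)"
    by (rule measurable_compose[OF measurable_snd])
       (auto intro!: borel_measurable_continuous_onI)
  ultimately show "(\<lambda>(\<omega>, \<tau>). apply_bcontfun (phi \<beta> n) \<tau> * apply_bcontfun (g \<omega>) \<tau>) \<in> borel_measurable (M \<Otimes>\<^sub>M lborel)"
    unfolding case_prod_beta by (rule borel_measurable_times[rotated])
qed

text \<open>One dimension at a time: since \<open>1 + cos T\<close> and \<open>1 + sin T\<close> are nonnegative densities, the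
  complex measure with density \<open>exp (i T)\<close> is handled by the uniqueness theorem for probability
  measures on the line.\<close>

lemma law_eq_of_char_proportional:
  assumes "finite_measure M" and [measurable]: "X \<in> borel_measurable M"
    and N: "real_distribution N"
    and char: "\<And>s. (CLINT \<omega>|M. iexp (s * X \<omega>)) = measure M (space M) * char N s"
    and [measurable]: "B \<in> sets borel"
  shows "measure M {\<omega> \<in> space M. X \<omega> \<in> B} = measure M (space M) * measure N B"
proof (cases "measure M (space M) = 0")
  case True
  interpret finite_measure M by fact
  have "measure M {\<omega> \<in> space M. X \<omega> \<in> B} \<le> measure M (space M)" by (rule finite_measure_mono) auto
  then show ?thesis using True by (simp add: measure_le_0_iff)
next
  case False
  interpret finite_measure M by fact
  interpret N: real_distribution N by fact
  define c where "c = measure M (space M)"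
  have c: "c > 0" using False by (simp add: c_def zero_less_measure_iff)
  define P where "P = distr (density M (\<lambda>_. ennreal (1 / c))) borel X"
  have "emeasure (density M (\<lambda>_. ennreal (1 / c))) (space M) = 1"
    using c by (simp add: emeasure_density emeasure_eq_measure c_def[symmetric] ennreal_mult[symmetric])
  then have "prob_space (density M (\<lambda>_. ennreal (1 / c)))" by (intro prob_spaceI) simp
  then have P: "real_distribution P" unfolding P_def by (rule prob_space.real_distribution_distr) simp
  have "char P s = char N s" for s
  proof -
    have "char P s = (CLINT \<omega>|M. (1 / c) *\<^sub>R iexp (s * X \<omega>))"
      using c unfolding P_def char_def by (subst integral_distr) (simp_all add: integral_density)
    also have "\<dots> = char N s" using char[of s] c by (simp add: c_def[symmetric] scaleR_conv_of_real)
    finally show ?thesis .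
  qed
  then have "P = N" using P N by (intro Levy_uniqueness) auto
  moreover have "measure P B = measure M {\<omega> \<in> space M. X \<omega> \<in> B} / c"
  proof -
    have "emeasure P B = ennreal (1 / c) * emeasure M (X -` B \<inter> space M)"
      unfolding P_def by (simp add: emeasure_distr emeasure_density nn_integral_cmult_indicator)
    also have "X -` B \<inter> space M = {\<omega> \<in> space M. X \<omega> \<in> B}" by auto
    finally show ?thesis using c unfolding measure_def[of P] measure_def[of M] by (simp add: enn2real_mult)
  qed
  ultimately have "measure N B = measure M {\<omega> \<in> space M. X \<omega> \<in> B} / c" by (simp only:)
  moreover have "p = q / c \<Longrightarrow> q = c * p" for p q :: real using c by simp
  ultimately show ?thesis unfolding c_def by blast
qed

text \<open>Uniqueness in several dimensions by induction on the coordinates: \<open>M\<close> is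
  restricted to an event of coordinate \<open>j\<close>, and the restricted measure again has a
  product characteristic function, with \<open>c\<close> multiplied by the mass of
  \<open>B j\<close>. This is why \<open>M\<close> is an arbitrary finite measure and
  \<open>c\<close> is left free.\<close>

lemma independent_of_char_product:
  fixes X :: "'i \<Rightarrow> 'a \<Rightarrow> real" and N :: "'i \<Rightarrow> real measure"
  assumes "finite L" "finite_measure M" "\<And>i. i \<in> L \<Longrightarrow> X i \<in> borel_measurable M"
    and "\<And>i. i \<in> L \<Longrightarrow> real_distribution (N i)"
    and "\<And>t. (CLINT \<omega>|M. iexp (\<Sum>i\<in>L. t i * X i \<omega>)) = complex_of_real c * (\<Prod>i\<in>L. char (N i) (t i))"
    and "\<And>i. i \<in> L \<Longrightarrow> B i \<in> sets borel"
  shows "measure M {\<omega> \<in> space M. \<forall>i\<in>L. X i \<omega> \<in> B i} = c * (\<Prod>i\<in>L. measure (N i) (B i))"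
  using assms
proof (induction L arbitrary: M c rule: finite_induct)
  case empty
  interpret finite_measure M by fact
  have "complex_of_real (measure M (space M)) = complex_of_real c"
    using empty(4)[of "\<lambda>_. 0"] by (simp add: scaleR_conv_of_real)
  then have "measure M (space M) = c" by (simp only: of_real_eq_iff)
  then show ?case by simp
next
  case (insert j L)
  interpret finite_measure M by fact
  interpret Nj: real_distribution "N j" using insert by simp
  have [measurable]: "X j \<in> borel_measurable M" "\<And>i. i \<in> L \<Longrightarrow> X i \<in> borel_measurable M"
    and [measurable]: "B j \<in> sets borel" "\<And>i. i \<in> L \<Longrightarrow> B i \<in> sets borel" using insert by auto
  have char0: "char (N j) 0 = 1" by (simp add: char_def Nj.prob_space[unfolded Nj.space_eq_univ])
  define T where "T = (\<lambda>t \<omega>. \<Sum>i\<in>L. t i * X i \<omega>)"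
  have [measurable]: "T t \<in> borel_measurable M" for t unfolding T_def by measurable
  have T0: "T (\<lambda>i. 0) \<omega> = 0" for \<omega> by (simp add: T_def)
  define Q where "Q = (\<lambda>t. complex_of_real c * (\<Prod>i\<in>L. char (N i) (t i)))"
  have bnd: "integrable M (\<lambda>\<omega>. iexp (f \<omega>))" if [measurable]: "f \<in> borel_measurable M" for f :: "'a \<Rightarrow> real"
    by (rule integrable_const_bound[where B = 1]) auto
  have joint: "(CLINT \<omega>|M. iexp (s * X j \<omega> + T t \<omega>)) = char (N j) s * Q t" for s t
  proof -
    have "(\<Sum>i\<in>insert j L. (t(j := s)) i * X i \<omega>) = s * X j \<omega> + T t \<omega>" for \<omega>
      using insert(1,2) by (simp add: T_def) (rule sum.cong, auto)
    moreover have "(\<Prod>i\<in>insert j L. char (N i) ((t(j := s)) i)) = char (N j) s * (\<Prod>i\<in>L. char (N i) (t i))"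
      using insert(1,2) by (simp) (rule disjI2, rule prod.cong, auto)
    ultimately show ?thesis using insert.prems(4)[of "t(j := s)"] by (simp add: Q_def mult_ac)
  qed
  have lin: "(CLINT \<omega>|M. f \<omega> + (p * g \<omega> + q * h \<omega>) / 2) = (CLINT \<omega>|M. f \<omega>) + (p * (CLINT \<omega>|M. g \<omega>) + q * (CLINT \<omega>|M. h \<omega>)) / 2"
    if "integrable M f" "integrable M g" "integrable M h" for f g h and p q :: complex
    using that by simp
  have lin2: "(CLINT \<omega>|M. f \<omega> + \<i> * g \<omega>) = (CLINT \<omega>|M. f \<omega>) + \<i> * (CLINT \<omega>|M. g \<omega>)"
    if "integrable M f" "integrable M g" for f g
    using that by simp
  define D where "D = {\<omega> \<in> space M. X j \<omega> \<in> B j}"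
  have D [measurable]: "D \<in> sets M" unfolding D_def by measurable
  text \<open>Real parts: the weight \<open>1 + cos (T - u)\<close> covers both cosine and sine.\<close>
  have weight: "(LINT \<omega>|M. indicator D \<omega> * (1 + cos (T t \<omega> - u))) = measure (N j) (B j) * (LINT \<omega>|M. 1 + cos (T t \<omega> - u))" for t u
  proof -
    define g where "g = (\<lambda>\<omega>. 1 + cos (T t \<omega> - u))"
    have g: "g \<omega> \<ge> 0" "\<bar>g \<omega>\<bar> \<le> 2" for \<omega>
      using cos_ge_minus_one[of "T t \<omega> - u"] cos_le_one[of "T t \<omega> - u"] unfolding g_def abs_le_iff by linarith+
    have [measurable]: "g \<in> borel_measurable M" unfolding g_def by measurable
    have ig: "integrable M g" by (rule integrable_const_bound[where B = 2]) (use g in auto)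
    define M' where "M' = density M (\<lambda>\<omega>. ennreal (g \<omega>))"
    have [simp]: "space M' = space M" "sets M' = sets M" by (simp_all add: M'_def)
    have M'meas: "measure M' A = (LINT \<omega>|M. indicator A \<omega> * g \<omega>)" if [measurable]: "A \<in> sets M" for A
    proof -
      have "emeasure M' A = (\<integral>\<^sup>+\<omega>. ennreal (indicator A \<omega> * g \<omega>) \<partial>M)"
        unfolding M'_def by (subst emeasure_density) (auto intro!: nn_integral_cong simp: indicator_def)
      also have "\<dots> = ennreal (LINT \<omega>|M. indicator A \<omega> * g \<omega>)"
        using g by (intro nn_integral_eq_integral integrable_real_mult_indicator ig that) (auto simp: mult.commute intro!: ig integrable_real_mult_indicator)
      finally show ?thesis using g by (simp add: measure_def integral_nonneg_AE)
    qed
    have "emeasure M' (space M') \<noteq> \<infinity>"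
    proof -
      have "emeasure M' (space M') = (\<integral>\<^sup>+\<omega>. ennreal (g \<omega>) \<partial>M)"
        by (simp add: M'_def emeasure_density)
      also have "\<dots> = ennreal (LINT \<omega>|M. g \<omega>)" using g by (intro nn_integral_eq_integral ig) auto
      finally show ?thesis by simp
    qed
    then have fM': "finite_measure M'" by (rule finite_measureI)
    have m1: "measure M' (space M') = (LINT \<omega>|M. g \<omega>)"
      by (simp add: M'meas) (rule Bochner_Integration.integral_cong, auto)
    have main: "(CLINT \<omega>|M'. iexp (s * X j \<omega>)) = char (N j) s * (measure M (space M) + (cis (-u) * Q t + cis u * Q (\<lambda>i. - t i)) / 2)" for s
    proof -
      \<comment> \<open>The weight is a combination of characters of the remaining coordinates with
        parameters 0, \<open>t\<close> and \<open>- t\<close>, so its integrals against characters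
        of \<open>X j\<close> are given by \<open>joint\<close>.\<close>
      have gc: "complex_of_real (g \<omega>) = 1 + (cis (-u) * iexp (T t \<omega>) + cis u * iexp (T (\<lambda>i. - t i) \<omega>)) / 2" for \<omega>
      proof -
        have "T (\<lambda>i. - t i) \<omega> = - T t \<omega>" by (simp add: T_def sum_negf)
        then have "cis (-u) * iexp (T t \<omega>) + cis u * iexp (T (\<lambda>i. - t i) \<omega>) = cis (T t \<omega> - u) + cis (- (T t \<omega> - u))"
          by (simp add: cis_conv_exp exp_add[symmetric] algebra_simps)
        also have "\<dots> = 2 * cos (T t \<omega> - u)" by (simp add: complex_eq_iff cos_diff sin_diff mult.commute)
        finally show ?thesis by (simp add: g_def)
      qed
      have "(CLINT \<omega>|M'. iexp (s * X j \<omega>)) = (CLINT \<omega>|M. g \<omega> *\<^sub>R iexp (s * X j \<omega>))"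
        unfolding M'_def using g by (intro integral_density) auto
      also have "\<dots> = (CLINT \<omega>|M. iexp (s * X j \<omega> + T (\<lambda>i. 0) \<omega>)
          + (cis (-u) * iexp (s * X j \<omega> + T t \<omega>) + cis u * iexp (s * X j \<omega> + T (\<lambda>i. - t i) \<omega>)) / 2)"
        by (intro Bochner_Integration.integral_cong refl)
           (simp add: scaleR_conv_of_real gc exp_add distrib_left T0 ring_distribs add_divide_distrib mult_ac)
      also have "\<dots> = (CLINT \<omega>|M. iexp (s * X j \<omega> + T (\<lambda>i. 0) \<omega>))
          + (cis (-u) * (CLINT \<omega>|M. iexp (s * X j \<omega> + T t \<omega>)) + cis u * (CLINT \<omega>|M. iexp (s * X j \<omega> + T (\<lambda>i. - t i) \<omega>))) / 2"
        by (rule lin; rule bnd; measurable)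
      also have "\<dots> = char (N j) s * (Q (\<lambda>i. 0) + (cis (-u) * Q t + cis u * Q (\<lambda>i. - t i)) / 2)"
        unfolding joint by (simp add: algebra_simps add_divide_distrib)
      also have "Q (\<lambda>i. 0) = measure M (space M)"
        using joint[of 0 "\<lambda>i. 0"] by (simp add: T_def char0 scaleR_conv_of_real)
      finally show ?thesis .
    qed
    have "(CLINT \<omega>|M'. iexp (s * X j \<omega>)) = measure M' (space M') * char (N j) s" for s
      using main[of s] main[of 0] char0 by (simp add: scaleR_conv_of_real)
    then have "measure M' {\<omega> \<in> space M'. X j \<omega> \<in> B j} = measure M' (space M') * measure (N j) (B j)"
      by (intro law_eq_of_char_proportional fM') (use insert in \<open>auto simp: M'_def\<close>)
    then show ?thesis
      unfolding m1 using M'meas[OF D] by (simp add: D_def[symmetric] g_def mult.commute)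
  qed
  define M1 where "M1 = density M (indicator D)"
  have [simp]: "space M1 = space M" "sets M1 = sets M" by (simp_all add: M1_def)
  have "emeasure M1 (space M1) \<le> emeasure M (space M)"
    by (simp add: M1_def emeasure_density emeasure_mono D sets.sets_into_space)
  also have "\<dots> < \<infinity>" by (simp add: emeasure_eq_measure)
  finally have fM1: "finite_measure M1" by (intro finite_measureI) simp
  have cosint: "(LINT \<omega>|M. indicator D \<omega> * cos (T t \<omega> - u)) = measure (N j) (B j) * (LINT \<omega>|M. cos (T t \<omega> - u))" for t u
  proof -
    have ic: "integrable M (\<lambda>\<omega>. cos (T t \<omega> - u))" for t u by (rule integrable_const_bound[where B = 1]) auto
    have id: "integrable M (\<lambda>\<omega>. indicator D \<omega> * cos (T t \<omega> - u))" for t u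
      by (rule integrable_const_bound[where B = 1]) (auto simp: indicator_def)
    have iD: "integrable M (indicat_real D)" by (rule integrable_const_bound[where B = 1]) auto
    have w: "(LINT \<omega>|M. indicat_real D \<omega>) + (LINT \<omega>|M. indicator D \<omega> * cos (T t \<omega> - u))
       = measure (N j) (B j) * ((LINT \<omega>|M. 1) + (LINT \<omega>|M. cos (T t \<omega> - u)))" for t u
      using weight[of t u] by (simp add: distrib_left id ic iD Bochner_Integration.integral_add)
    \<comment> \<open>At \<open>t = 0\<close> and \<open>u = 0\<close> the cosine is 1, which
      isolates the constant part of the weight so that it can be subtracted.\<close>
    have "(LINT \<omega>|M. indicat_real D \<omega>) = measure (N j) (B j) * (LINT \<omega>|M. 1)"
      using w[of "\<lambda>_. 0" 0] by (simp add: T_def)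
    then show ?thesis using w[of t u] by (simp add: distrib_left)
  qed
  have "measure M1 {\<omega> \<in> space M1. \<forall>i\<in>L. X i \<omega> \<in> B i} = (c * measure (N j) (B j)) * (\<Prod>i\<in>L. measure (N i) (B i))"
  proof (rule insert.IH[OF fM1])
    fix t
    \<comment> \<open>The phases 0 and \<open>pi / 2\<close> recover real and imaginary part from
      shifted cosines.\<close>
    have split: "iexp (f \<omega>) = complex_of_real (cos (f \<omega> - 0)) + \<i> * complex_of_real (cos (f \<omega> - pi / 2))" for f :: "'a \<Rightarrow> real" and \<omega>
      by (simp add: cis_conv_exp[symmetric] complex_eq_iff cos_diff)
    have ic: "integrable M (\<lambda>\<omega>. cos (T t \<omega> - u))" for u by (rule integrable_const_bound[where B = 1]) auto
    have id: "integrable M (\<lambda>\<omega>. indicator D \<omega> * cos (T t \<omega> - u))" for u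
      by (rule integrable_const_bound[where B = 1]) (auto simp: indicator_def)
    have Qt: "Q t = complex_of_real (LINT \<omega>|M. cos (T t \<omega> - 0)) + \<i> * complex_of_real (LINT \<omega>|M. cos (T t \<omega> - pi / 2))"
    proof -
      have "Q t = (CLINT \<omega>|M. iexp (T t \<omega>))" using joint[of 0 t] by (simp add: char0)
      also have "\<dots> = (CLINT \<omega>|M. complex_of_real (cos (T t \<omega> - 0)) + \<i> * complex_of_real (cos (T t \<omega> - pi / 2)))"
        by (intro Bochner_Integration.integral_cong refl split)
      also have "\<dots> = (CLINT \<omega>|M. complex_of_real (cos (T t \<omega> - 0))) + \<i> * (CLINT \<omega>|M. complex_of_real (cos (T t \<omega> - pi / 2)))"
        by (intro lin2 integrable_of_real ic)
      finally show ?thesis by (simp only: integral_complex_of_real)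
    qed
    have "(CLINT \<omega>|M1. iexp (\<Sum>i\<in>L. t i * X i \<omega>)) = (CLINT \<omega>|M. indicat_real D \<omega> *\<^sub>R iexp (T t \<omega>))"
    proof -
      have "M1 = density M (\<lambda>\<omega>. ennreal (indicat_real D \<omega>))" by (simp add: M1_def ennreal_indicator)
      then show ?thesis unfolding T_def by (simp only:) (intro integral_density, auto)
    qed
    also have "\<dots> = (CLINT \<omega>|M. complex_of_real (indicator D \<omega> * cos (T t \<omega> - 0)) + \<i> * complex_of_real (indicator D \<omega> * cos (T t \<omega> - pi / 2)))"
      by (intro Bochner_Integration.integral_cong refl) (simp add: scaleR_conv_of_real split[of "T t"] ring_distribs)
    also have "\<dots> = (CLINT \<omega>|M. complex_of_real (indicator D \<omega> * cos (T t \<omega> - 0))) + \<i> * (CLINT \<omega>|M. complex_of_real (indicator D \<omega> * cos (T t \<omega> - pi / 2)))"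
      by (intro lin2 integrable_of_real id)
    also have "\<dots> = measure (N j) (B j) * Q t"
      unfolding Qt by (simp only: integral_complex_of_real cosint) (simp add: algebra_simps)
    finally show "(CLINT \<omega>|M1. iexp (\<Sum>i\<in>L. t i * X i \<omega>)) = complex_of_real (c * measure (N j) (B j)) * (\<Prod>i\<in>L. char (N i) (t i))"
      by (simp add: Q_def mult_ac)
  qed (use insert in \<open>auto simp: M1_def\<close>)
  moreover have "measure M1 {\<omega> \<in> space M1. \<forall>i\<in>L. X i \<omega> \<in> B i} = measure M {\<omega> \<in> space M. \<forall>i\<in>insert j L. X i \<omega> \<in> B i}"
  proof -
    have S: "{\<omega> \<in> space M. \<forall>i\<in>L. X i \<omega> \<in> B i} \<in> sets M"
      using insert(1) by measurable
    have "emeasure M1 {\<omega> \<in> space M. \<forall>i\<in>L. X i \<omega> \<in> B i} = emeasure M (D \<inter> {\<omega> \<in> space M. \<forall>i\<in>L. X i \<omega> \<in> B i})"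
      unfolding M1_def using S by (simp add: emeasure_density indicator_inter_arith[symmetric])
    also have "D \<inter> {\<omega> \<in> space M. \<forall>i\<in>L. X i \<omega> \<in> B i} = {\<omega> \<in> space M. \<forall>i\<in>insert j L. X i \<omega> \<in> B i}"
      by (auto simp: D_def)
    finally show ?thesis by (simp add: measure_def)
  qed
  ultimately show ?case using insert(1,2) by simp
qed

section \<open>Configurations in Fourier coordinates\<close>

lemma measurable_eval_compose [measurable (raw)]:
  fixes g :: "'a \<Rightarrow> 'd::finite config"
  shows "g \<in> measurable M (Omega_space \<beta>) \<Longrightarrow> (\<lambda>\<omega>. apply_bcontfun (g \<omega> k) \<tau>) \<in> borel_measurable M"
  by (rule measurable_compose[where N = "Omega_space \<beta>" and g = "\<lambda>\<omega>. apply_bcontfun (\<omega> k) \<tau>", OF _ measurable_eval_Omega])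

locale quantum_loops =
  fixes \<beta> m a :: real
  assumes beta_pos: "\<beta> > 0" and mass_pos: "m > 0" and rigidity_pos: "a\<^sup>2 > 0"
begin

abbreviation lam :: "int \<Rightarrow> real" where "lam n \<equiv> A_eigenvalue \<beta> m a n"

lemma lam_pos: "lam n > 0"
  unfolding A_eigenvalue_def using mass_pos rigidity_pos by (intro add_nonneg_pos) auto

abbreviation \<Omega> :: "'d::finite config measure" where "\<Omega> \<equiv> Omega_space \<beta>"

definition coord :: "'d::finite site \<times> int \<Rightarrow> 'd config \<Rightarrow> real" where
  "coord i \<omega> = loop_coeff \<beta> (snd i) (\<omega> (fst i))"

definition move :: "'d::finite site \<times> int \<Rightarrow> real \<Rightarrow> 'd config \<Rightarrow> 'd config" where
  "move i t = shift t (h_dir \<beta> (fst i) (snd i))"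

lemma move_apply: "move i t \<omega> k = \<omega> k + (if k = fst i then t *\<^sub>R phi \<beta> (snd i) else 0)"
  by (simp add: move_def shift_def h_dir_def)

lemma coord_move: "coord i (move j t \<omega>) = coord i \<omega> + (if i = j then t else 0)"
  by (auto simp: coord_def move_apply loop_coeff_add loop_coeff_scaleR loop_coeff_phi beta_pos prod_eq_iff)

lemma move_move [simp]: "move i s (move i t \<omega>) = move i (s + t) \<omega>"
  by (rule ext) (simp add: move_apply scaleR_add_left)

lemma move_0 [simp]: "move i 0 \<omega> = \<omega>"
  by (rule ext) (simp add: move_apply)

lemma move_in_Omega [simp]: "\<omega> \<in> Omega \<beta> \<Longrightarrow> move i t \<omega> \<in> Omega \<beta>"
  by (auto simp: Omega_def move_apply beta_pos)

lemma measurable_coord [measurable]: "coord i \<in> borel_measurable \<Omega>"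
  unfolding coord_def by (rule measurable_loop_coeff) (rule measurable_eval_Omega)

lemma measurable_move [measurable (raw)]:
  assumes f [measurable]: "f \<in> borel_measurable M" and g [measurable]: "g \<in> measurable M \<Omega>"
  shows "(\<lambda>\<omega>. move i (f \<omega>) (g \<omega>)) \<in> measurable M \<Omega>"
proof (rule measurable_OmegaI[OF beta_pos])
  show "move i (f \<omega>) (g \<omega>) \<in> Omega \<beta>" if "\<omega> \<in> space M" for \<omega>
    using measurable_space[OF g that] by simp
  show "(\<lambda>\<omega>. apply_bcontfun (move i (f \<omega>) (g \<omega>) k) \<tau>) \<in> borel_measurable M" for k \<tau>
    by (cases "k = fst i") (simp_all add: move_apply)
qed

definition rect :: "('d::finite site \<times> int) set \<Rightarrow> ('d site \<times> int \<Rightarrow> real set) \<Rightarrow> 'd config set" where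
  "rect I B = {\<omega> \<in> Omega \<beta>. \<forall>i\<in>I. coord i \<omega> \<in> B i}"

lemma sets_rect: "finite I \<Longrightarrow> (\<And>i. B i \<in> sets borel) \<Longrightarrow> rect I B \<in> sets \<Omega>"
proof -
  assume "finite I" and [measurable]: "\<And>i. B i \<in> sets borel"
  have "{\<omega> \<in> space \<Omega>. \<forall>i\<in>I. coord i \<omega> \<in> B i} \<in> sets \<Omega>" using \<open>finite I\<close> by measurable
  then show ?thesis by (simp add: rect_def)
qed

text \<open>Every evaluation is a pointwise limit of Fejer means, which are finite combinations of
  coordinates. Thus the Fourier coordinates generate the Borel sets, and statements about finitely
  many coordinates can determine a measure.\<close>

lemma sets_Omega_generated:
  "sets (\<Omega> :: 'd::finite config measure) =
    sigma_sets (Omega \<beta>) {rect I B | I B. finite I \<and> (\<forall>i. B i \<in> sets borel)}" (is "_ = sigma_sets _ ?E")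
proof
  have sub: "?E \<subseteq> sets \<Omega>" by (auto intro: sets_rect)
  then show "sigma_sets (Omega \<beta>) ?E \<subseteq> sets (\<Omega> :: 'd config measure)"
    using sets.sigma_sets_subset[of ?E \<Omega>] by simp
  have pow: "?E \<subseteq> Pow (Omega \<beta>)" by (auto simp: rect_def)
  define S where "S = sigma (Omega \<beta>) ?E"
  have S [simp]: "space S = Omega \<beta>" "sets S = sigma_sets (Omega \<beta>) ?E"
    using pow by (simp_all add: S_def)
  have coord [measurable]: "coord i \<in> borel_measurable S" for i
  proof (rule measurableI)
    fix A :: "real set" assume A: "A \<in> sets borel"
    have "coord i -` A \<inter> space S = rect {i} (\<lambda>_. A)" by (auto simp: rect_def)
    also have "\<dots> \<in> ?E" using A by blast
    finally show "coord i -` A \<inter> space S \<in> sets S" by auto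
  qed auto
  have "(\<lambda>\<omega>. \<omega>) \<in> measurable S \<Omega>"
  proof (rule measurable_OmegaI[OF beta_pos])
    fix k \<tau>
    have mean: "(\<lambda>\<omega>. apply_bcontfun (fejer_mean \<beta> n (\<omega> k)) \<tau>) \<in> borel_measurable S" for n
    proof -
      have "(\<lambda>\<omega>. \<Sum>l\<in>{- int n..int n}. fejer_weight n l * coord (k, l) \<omega> * apply_bcontfun (phi \<beta> l) \<tau>) \<in> borel_measurable S"
        by measurable
      then show ?thesis by (simp add: fejer_mean_def apply_bcontfun_sum coord_def)
    qed
    show "(\<lambda>\<omega>. apply_bcontfun (\<omega> k) \<tau>) \<in> borel_measurable S"
    proof (rule borel_measurable_LIMSEQ_metric[OF mean])
      fix \<omega> assume "\<omega> \<in> space S"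
      then have "(\<lambda>n. norm (\<omega> k - fejer_mean \<beta> n (\<omega> k))) \<longlonglongrightarrow> 0"
        by (intro fejer_mean_tendsto beta_pos OmegaD) simp
      then have "(\<lambda>n. apply_bcontfun (\<omega> k - fejer_mean \<beta> n (\<omega> k)) \<tau>) \<longlonglongrightarrow> 0"
        by (rule Lim_null_comparison[rotated])
           (use norm_bounded[of "\<omega> k - fejer_mean \<beta> n (\<omega> k)" \<tau> for n] in simp)
      then have "(\<lambda>n. apply_bcontfun (\<omega> k) \<tau> - apply_bcontfun (\<omega> k - fejer_mean \<beta> n (\<omega> k)) \<tau>) \<longlonglongrightarrow> apply_bcontfun (\<omega> k) \<tau> - 0"
        by (intro tendsto_intros)
      then show "(\<lambda>n. apply_bcontfun (fejer_mean \<beta> n (\<omega> k)) \<tau>) \<longlonglongrightarrow> apply_bcontfun (\<omega> k) \<tau>"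
        by simp
    qed
  qed simp
  then show "sets (\<Omega> :: 'd config measure) \<subseteq> sigma_sets (Omega \<beta>) ?E"
  proof (intro subsetI)
    fix A :: "'d config set" assume A: "A \<in> sets \<Omega>"
    then have "(\<lambda>\<omega>. \<omega>) -` A \<inter> space S \<in> sets S"
      using \<open>(\<lambda>\<omega>. \<omega>) \<in> measurable S \<Omega>\<close> by (rule measurable_sets[rotated])
    moreover have "(\<lambda>\<omega>. \<omega>) -` A \<inter> space S = A" using sets.sets_into_space[OF A] by auto
    ultimately show "A \<in> sigma_sets (Omega \<beta>) ?E" by simp
  qed
qed

text \<open>Cylinder events form an intersection-stable generator. The finiteness demanded here is
  what later makes it necessary to work on level sets of the energy.\<close>

lemma measure_eqI_rect:
  fixes \<mu> \<nu> :: "'d::finite config measure"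
  assumes "finite_measure \<mu>" "sets \<mu> = sets \<Omega>" "sets \<nu> = sets \<Omega>"
    and eq: "\<And>I B. finite I \<Longrightarrow> (\<And>i. B i \<in> sets borel) \<Longrightarrow> emeasure \<mu> (rect I B) = emeasure \<nu> (rect I B)"
  shows "\<mu> = \<nu>"
proof (rule measure_eqI_generator_eq[where \<Omega> = "Omega \<beta>" and A = "\<lambda>_. Omega \<beta>"])
  let ?E = "{rect I B | I B. finite I \<and> (\<forall>i. B i \<in> sets borel)} :: 'd config set set"
  show "Int_stable ?E"
  proof (rule Int_stableI, safe)
    fix I I' :: "('d site \<times> int) set" and B B' :: "'d site \<times> int \<Rightarrow> real set"
    assume fin: "finite I" "finite I'" and B: "\<forall>i. B i \<in> sets borel" "\<forall>i. B' i \<in> sets borel"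
    have "rect I B \<inter> rect I' B' = rect (I \<union> I') (\<lambda>i. (if i \<in> I then B i else UNIV) \<inter> (if i \<in> I' then B' i else UNIV))"
      by (auto simp: rect_def)
    then show "\<exists>J C. rect I B \<inter> rect I' B' = rect J C \<and> finite J \<and> (\<forall>i. C i \<in> sets borel)"
    proof (intro exI conjI)
      show "finite (I \<union> I')" using fin by simp
      show "\<forall>i. (if i \<in> I then B i else UNIV) \<inter> (if i \<in> I' then B' i else UNIV) \<in> sets borel"
        using B by auto
    qed
  qed
  show "?E \<subseteq> Pow (Omega \<beta>)" by (auto simp: rect_def)
  show "sets \<mu> = sigma_sets (Omega \<beta>) ?E" "sets \<nu> = sigma_sets (Omega \<beta>) ?E"
    using assms(2,3) sets_Omega_generated by auto
  show "emeasure \<mu> X = emeasure \<nu> X" if X: "X \<in> ?E" for X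
  proof -
    obtain I B where XE: "X = rect I B" and fin: "finite I" and B: "\<And>i. B i \<in> sets borel" using X by blast
    show ?thesis unfolding XE by (rule eq[OF fin B])
  qed
  have "rect {} (\<lambda>_. UNIV) \<in> ?E" by (intro CollectI exI[of _ "{}"] exI[of _ "\<lambda>_. UNIV"]) simp
  then show "range (\<lambda>_. Omega \<beta>) \<subseteq> ?E" by (auto simp: rect_def)
  show "emeasure \<mu> (Omega \<beta>) \<noteq> \<infinity>"
    using finite_measure.emeasure_finite[OF assms(1)] by simp
qed simp

section \<open>One coordinate: Gaussian law, tilt and resampling\<close>

definition law :: "int \<Rightarrow> real measure" where
  "law n = density lborel (\<lambda>y. ennreal (normal_density 0 (1 / sqrt (lam n)) y))"

lemma sets_law [simp, measurable_cong]: "sets (law n) = sets borel" and space_law [simp]: "space (law n) = UNIV"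
  by (simp_all add: law_def)

lemma prob_space_law: "prob_space (law n)"
  unfolding law_def by (rule prob_space_normal_density) (simp add: lam_pos)

lemma real_distribution_law: "real_distribution (law n)"
  by (simp add: real_distribution_def real_distribution_axioms_def prob_space_law)

lemma char_law: "char (law n) t = complex_of_real (exp (- t\<^sup>2 / (2 * lam n)))"
proof -
  interpret prob_space "law n" by (rule prob_space_law)
  define s where "s = 1 / sqrt (lam n)"
  have s: "s > 0" by (simp add: s_def lam_pos)
  have "distributed (law n) lborel (\<lambda>x. x) (normal_density 0 s)"
    unfolding distributed_def s_def by (auto simp: law_def distr_id2 intro!: distr_id2[symmetric])
  then have "distributed (law n) lborel (\<lambda>x. (x - 0) / s) std_normal_density"
    by (subst (asm) normal_standard_normal_convert[OF s])
  then have std: "std_normal_distribution = distr (law n) lborel (\<lambda>x. x / s)"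
    by (simp add: distributed_def)
  have "char (law n) t = (CLINT x|law n. iexp ((t * s) * (x / s)))"
    using s by (simp add: char_def)
  also have "\<dots> = (CLINT x|distr (law n) lborel (\<lambda>x. x / s). iexp ((t * s) * x))"
    by (subst integral_distr) auto
  also have "\<dots> = char std_normal_distribution (t * s)" unfolding std[symmetric] char_def ..
  also have "\<dots> = complex_of_real (exp (- t\<^sup>2 / (2 * lam n)))"
    using lam_pos[of n] by (simp add: char_std_normal_distribution s_def power_mult_distrib power_divide)
  finally show ?thesis .
qed

text \<open>The variances of the two independent terms add up to that of \<open>law n\<close>
  because \<open>r\<^sup>2 + c\<^sup>2 = 1\<close>. With one term the old value and the other fresh
  noise, this is stationarity of one Ornstein-Uhlenbeck step.\<close>

lemma law_rotate:
  fixes g :: "real \<Rightarrow> ennreal"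
  assumes [measurable]: "g \<in> borel_measurable borel" and rc: "r\<^sup>2 + c\<^sup>2 = 1"
  shows "(\<integral>\<^sup>+y. \<integral>\<^sup>+y'. g (r * y + c * y') \<partial>law n \<partial>law n) = (\<integral>\<^sup>+y. g y \<partial>law n)"
proof -
  interpret prob_space "law n" by (rule prob_space_law)
  interpret pair_prob_space "law n" "law n" ..
  define P where "P = distr (law n \<Otimes>\<^sub>M law n) borel (\<lambda>(y, y'). r * y + c * y')"
  have P: "real_distribution P" unfolding P_def by (rule real_distribution_distr) simp
  have "char P t = char (law n) t" for t
  proof -
    have "char P t = (CLINT p|law n \<Otimes>\<^sub>M law n. iexp (t * (r * fst p + c * snd p)))"
      unfolding P_def char_def by (subst integral_distr) (auto simp: case_prod_beta)
    also have "\<dots> = (CLINT y|law n. CLINT y'|law n. iexp (t * (r * y + c * y')))"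
      by (subst integral_fst'[symmetric])
        (auto intro!: P.integrable_const_bound[where B = 1])
    also have "\<dots> = (CLINT y|law n. iexp (t * r * y) * (CLINT y'|law n. iexp (t * c * y')))"
      by (subst integral_mult_right_zero[symmetric]) (simp add: exp_add distrib_left mult_ac)
    also have "\<dots> = char (law n) (t * r) * char (law n) (t * c)"
      by (simp add: char_def)
    also have "\<dots> = complex_of_real (exp (- (t * r)\<^sup>2 / (2 * lam n) + - (t * c)\<^sup>2 / (2 * lam n)))"
      by (simp only: char_law exp_add of_real_mult)
    also have "- (t * r)\<^sup>2 / (2 * lam n) + - (t * c)\<^sup>2 / (2 * lam n) = - (t\<^sup>2 * (r\<^sup>2 + c\<^sup>2)) / (2 * lam n)"
      by (simp add: power_mult_distrib add_divide_distrib distrib_left diff_divide_distrib)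
    finally show ?thesis unfolding rc by (simp add: char_law)
  qed
  then have "P = law n" by (intro Levy_uniqueness P real_distribution_law) auto
  then have "(\<integral>\<^sup>+y. g y \<partial>law n) = (\<integral>\<^sup>+y. g y \<partial>P)" by simp
  also have "\<dots> = (\<integral>\<^sup>+p. g (r * fst p + c * snd p) \<partial>(law n \<Otimes>\<^sub>M law n))"
    unfolding P_def by (subst nn_integral_distr) (simp_all add: case_prod_beta)
  also have "\<dots> = (\<integral>\<^sup>+y. \<integral>\<^sup>+y'. g (r * y + c * y') \<partial>law n \<partial>law n)"
    by (subst sigma_finite_measure.nn_integral_fst[OF prob_space_imp_sigma_finite[OF prob_space_law], symmetric]) simp_all
  finally show ?thesis by simp
qed

text \<open>Cameron-Martin density of the free measure: \<open>shift_density\<close> stripped of its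
  interaction terms, with \<open>A_op\<close> acting on \<open>phi\<close> as multiplication by the
  eigenvalue.\<close>

definition tilt :: "'d::finite site \<times> int \<Rightarrow> real \<Rightarrow> 'd config \<Rightarrow> real" where
  "tilt i \<theta> \<omega> = exp (- \<theta> * lam (snd i) * coord i \<omega> - \<theta>\<^sup>2 / 2 * lam (snd i))"

lemma measurable_tilt [measurable]: "tilt i \<theta> \<in> borel_measurable \<Omega>"
  unfolding tilt_def by measurable

lemma normal_density_shift:
  "normal_density 0 (1 / sqrt (lam n)) (y + \<theta>)
    = normal_density 0 (1 / sqrt (lam n)) y * exp (- \<theta> * lam n * y - \<theta>\<^sup>2 / 2 * lam n)"
proof -
  have 1: "- (z - 0)\<^sup>2 / (2 * (1 / sqrt (lam n))\<^sup>2) = - z\<^sup>2 * lam n / 2" for z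
    using lam_pos[of n] by (simp add: power_divide)
  have "- (y + \<theta>)\<^sup>2 * lam n / 2 = - y\<^sup>2 * lam n / 2 + (- \<theta> * lam n * y - \<theta>\<^sup>2 / 2 * lam n)"
    by (simp add: power2_eq_square field_simps)
  then show ?thesis unfolding normal_density_def 1 by (simp only: exp_add mult.assoc)
qed

text \<open>\<open>resamples \<sigma> i\<close>: under \<open>\<sigma>\<close>, the coordinate \<open>i\<close> has law \<open>law (snd i)\<close> and is independent of the
  other ones; \<open>\<sigma>\<close> may be infinite.\<close>

definition resamples :: "'d::finite config measure \<Rightarrow> 'd site \<times> int \<Rightarrow> bool" where
  "resamples \<sigma> i \<longleftrightarrow> (\<forall>f::_ \<Rightarrow> ennreal. f \<in> borel_measurable \<Omega> \<longrightarrow>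
    (\<integral>\<^sup>+\<omega>. f \<omega> \<partial>\<sigma>) = (\<integral>\<^sup>+\<omega>. \<integral>\<^sup>+y. f (move i (y - coord i \<omega>) \<omega>) \<partial>law (snd i) \<partial>\<sigma>))"

lemma resamplesD:
  "resamples \<sigma> i \<Longrightarrow> f \<in> borel_measurable \<Omega> \<Longrightarrow>
    (\<integral>\<^sup>+\<omega>. f \<omega> \<partial>\<sigma>) = (\<integral>\<^sup>+\<omega>. \<integral>\<^sup>+y. f (move i (y - coord i \<omega>) \<omega>) \<partial>law (snd i) \<partial>\<sigma>)"
  by (simp add: resamples_def)

lemma nn_integral_law:
  "f \<in> borel_measurable borel \<Longrightarrow>
    (\<integral>\<^sup>+y. f y \<partial>law n) = (\<integral>\<^sup>+y. ennreal (normal_density 0 (1 / sqrt (lam n)) y) * f y \<partial>lborel)"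
  unfolding law_def by (subst nn_integral_density) auto

lemma nn_integral_normal_density:
  "(\<integral>\<^sup>+\<theta>. ennreal (normal_density 0 (1 / sqrt (lam n)) (y + \<theta>)) \<partial>lborel) = 1"
proof -
  interpret prob_space "law n" by (rule prob_space_law)
  have "(\<integral>\<^sup>+\<theta>. ennreal (normal_density 0 (1 / sqrt (lam n)) (y + 1 * \<theta>)) \<partial>lborel)
     = (\<integral>\<^sup>+\<theta>. ennreal (normal_density 0 (1 / sqrt (lam n)) \<theta>) \<partial>lborel)"
    by (subst nn_integral_real_affine[of "\<lambda>\<theta>. ennreal (normal_density 0 (1 / sqrt (lam n)) \<theta>)" 1 y]) simp_all
  also have "\<dots> = emeasure (law n) (space (law n))"
    by (simp add: law_def emeasure_density)
  finally show ?thesis using emeasure_space_1 by simp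
qed

text \<open>The tilt identity is averaged over all shifts with a normal weight. On the shifted side
  the substitution \<open>y = coord i \<omega> - \<theta>\<close> yields a fresh Gaussian draw; on
  the other side density times tilt is the density at \<open>coord i \<omega> + \<theta>\<close>,
  whose integral over \<open>\<theta>\<close> is 1. Exchanging the integrals is where
  \<open>\<sigma>\<close>-finiteness enters.\<close>

lemma resamplesI:
  fixes \<sigma> :: "'d::finite config measure"
  assumes "sigma_finite_measure \<sigma>" and sets [measurable_cong]: "sets \<sigma> = sets \<Omega>"
    and tilt: "\<And>\<theta> f. f \<in> borel_measurable \<Omega> \<Longrightarrow>
      (\<integral>\<^sup>+\<omega>. f \<omega> * ennreal (tilt i \<theta> \<omega>) \<partial>\<sigma>) = (\<integral>\<^sup>+\<omega>. f (move i (- \<theta>) \<omega>) \<partial>\<sigma>)"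
  shows "resamples \<sigma> i"
  unfolding resamples_def
proof (intro allI impI)
  fix f :: "'d config \<Rightarrow> ennreal" assume f [measurable]: "f \<in> borel_measurable \<Omega>"
  interpret sigma_finite_measure \<sigma> by fact
  interpret pair_sigma_finite \<sigma> lborel ..
  define \<rho> where "\<rho> = (\<lambda>y. ennreal (normal_density 0 (1 / sqrt (lam (snd i))) y))"
  have \<rho> [measurable]: "\<rho> \<in> borel_measurable borel" unfolding \<rho>_def by measurable
  have "(\<integral>\<^sup>+\<omega>. \<integral>\<^sup>+y. f (move i (y - coord i \<omega>) \<omega>) \<partial>law (snd i) \<partial>\<sigma>)
     = (\<integral>\<^sup>+\<omega>. \<integral>\<^sup>+\<theta>. \<rho> (coord i \<omega> - \<theta>) * f (move i (- \<theta>) \<omega>) \<partial>lborel \<partial>\<sigma>)"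
  proof (rule nn_integral_cong)
    fix \<omega> assume "\<omega> \<in> space \<sigma>"
    then have [measurable]: "(\<lambda>_::real. \<omega>) \<in> measurable borel \<Omega>" using sets_eq_imp_space_eq[OF sets] by simp
    have "(\<integral>\<^sup>+y. f (move i (y - coord i \<omega>) \<omega>) \<partial>law (snd i))
       = (\<integral>\<^sup>+y. \<rho> y * f (move i (y - coord i \<omega>) \<omega>) \<partial>lborel)"
      unfolding \<rho>_def by (rule nn_integral_law) measurable
    also have "\<dots> = (\<integral>\<^sup>+\<theta>. \<rho> (coord i \<omega> + (-1) * \<theta>) * f (move i ((coord i \<omega> + (-1) * \<theta>) - coord i \<omega>) \<omega>) \<partial>lborel)"
      by (subst nn_integral_real_affine[where c = "-1" and t = "coord i \<omega>"]) simp_all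
    finally show "(\<integral>\<^sup>+y. f (move i (y - coord i \<omega>) \<omega>) \<partial>law (snd i))
       = (\<integral>\<^sup>+\<theta>. \<rho> (coord i \<omega> - \<theta>) * f (move i (- \<theta>) \<omega>) \<partial>lborel)" by simp
  qed
  also have "\<dots> = (\<integral>\<^sup>+\<theta>. \<integral>\<^sup>+\<omega>. \<rho> (coord i \<omega> - \<theta>) * f (move i (- \<theta>) \<omega>) \<partial>\<sigma> \<partial>lborel)"
    by (rule Fubini'[symmetric]) measurable
  also have "\<dots> = (\<integral>\<^sup>+\<theta>. \<integral>\<^sup>+\<omega>. (\<rho> (coord i \<omega>) * f \<omega>) * ennreal (tilt i \<theta> \<omega>) \<partial>\<sigma> \<partial>lborel)"
  proof (rule nn_integral_cong)
    fix \<theta>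
    show "(\<integral>\<^sup>+\<omega>. \<rho> (coord i \<omega> - \<theta>) * f (move i (- \<theta>) \<omega>) \<partial>\<sigma>) = (\<integral>\<^sup>+\<omega>. (\<rho> (coord i \<omega>) * f \<omega>) * ennreal (tilt i \<theta> \<omega>) \<partial>\<sigma>)"
      by (subst tilt) (auto simp: coord_move)
  qed
  also have "\<dots> = (\<integral>\<^sup>+\<theta>. \<integral>\<^sup>+\<omega>. f \<omega> * \<rho> (coord i \<omega> + \<theta>) \<partial>\<sigma> \<partial>lborel)"
    unfolding \<rho>_def normal_density_shift tilt_def by (simp add: ennreal_mult mult_ac)
  also have "\<dots> = (\<integral>\<^sup>+\<omega>. \<integral>\<^sup>+\<theta>. f \<omega> * \<rho> (coord i \<omega> + \<theta>) \<partial>lborel \<partial>\<sigma>)"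
    by (rule Fubini') measurable
  also have "\<dots> = (\<integral>\<^sup>+\<omega>. f \<omega> \<partial>\<sigma>)"
    by (intro nn_integral_cong, subst nn_integral_cmult) (auto simp: \<rho>_def nn_integral_normal_density)
  finally show "(\<integral>\<^sup>+\<omega>. f \<omega> \<partial>\<sigma>) = (\<integral>\<^sup>+\<omega>. \<integral>\<^sup>+y. f (move i (y - coord i \<omega>) \<omega>) \<partial>law (snd i) \<partial>\<sigma>)" ..
qed

text \<open>Converse of \<open>resamplesI\<close>: once the coordinate is an independent Gaussian
  variable, the Cameron-Martin formula reduces to a translation of Lebesgue measure on the
  line.\<close>

lemma resamples_tilt:
  fixes \<sigma> :: "'d::finite config measure"
  assumes res: "resamples \<sigma> i" and sets [measurable_cong]: "sets \<sigma> = sets \<Omega>"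
    and f [measurable]: "f \<in> borel_measurable \<Omega>"
  shows "(\<integral>\<^sup>+\<omega>. f \<omega> * ennreal (tilt i \<theta> \<omega>) \<partial>\<sigma>) = (\<integral>\<^sup>+\<omega>. f (move i (- \<theta>) \<omega>) \<partial>\<sigma>)"
proof -
  define \<rho> where "\<rho> = (\<lambda>y. ennreal (normal_density 0 (1 / sqrt (lam (snd i))) y))"
  have \<rho> [measurable]: "\<rho> \<in> borel_measurable borel" unfolding \<rho>_def by measurable
  have "(\<integral>\<^sup>+\<omega>. f \<omega> * ennreal (tilt i \<theta> \<omega>) \<partial>\<sigma>) =
    (\<integral>\<^sup>+\<omega>. \<integral>\<^sup>+y. f (move i (y - coord i \<omega>) \<omega>) * ennreal (tilt i \<theta> (move i (y - coord i \<omega>) \<omega>)) \<partial>law (snd i) \<partial>\<sigma>)"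
    by (rule resamplesD[OF res]) measurable
  also have "\<dots> = (\<integral>\<^sup>+\<omega>. \<integral>\<^sup>+y. f (move i (- \<theta>) (move i (y - coord i \<omega>) \<omega>)) \<partial>law (snd i) \<partial>\<sigma>)"
  proof (rule nn_integral_cong)
    fix \<omega> assume "\<omega> \<in> space \<sigma>"
    then have [measurable]: "(\<lambda>_::real. \<omega>) \<in> measurable borel \<Omega>" using sets_eq_imp_space_eq[OF sets] by simp
    have "(\<integral>\<^sup>+y. f (move i (- \<theta>) (move i (y - coord i \<omega>) \<omega>)) \<partial>law (snd i))
       = (\<integral>\<^sup>+y. \<rho> y * f (move i (y - \<theta> - coord i \<omega>) \<omega>) \<partial>lborel)"
      unfolding \<rho>_def by (subst nn_integral_law) (auto simp: algebra_simps)
    also have "\<dots> = (\<integral>\<^sup>+y. \<rho> (\<theta> + 1 * y) * f (move i ((\<theta> + 1 * y) - \<theta> - coord i \<omega>) \<omega>) \<partial>lborel)"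
      by (subst nn_integral_real_affine[where c = 1 and t = \<theta>]) simp_all
    also have "\<dots> = (\<integral>\<^sup>+y. \<rho> y * (f (move i (y - coord i \<omega>) \<omega>) * ennreal (tilt i \<theta> (move i (y - coord i \<omega>) \<omega>))) \<partial>lborel)"
      unfolding \<rho>_def tilt_def using normal_density_shift[of "snd i" _ \<theta>]
      by (intro nn_integral_cong) (simp add: add.commute[of \<theta>] ennreal_mult coord_move mult_ac)
    also have "\<dots> = (\<integral>\<^sup>+y. f (move i (y - coord i \<omega>) \<omega>) * ennreal (tilt i \<theta> (move i (y - coord i \<omega>) \<omega>)) \<partial>law (snd i))"
      unfolding \<rho>_def by (rule nn_integral_law[symmetric]) measurable
    finally show "(\<integral>\<^sup>+y. f (move i (y - coord i \<omega>) \<omega>) * ennreal (tilt i \<theta> (move i (y - coord i \<omega>) \<omega>)) \<partial>law (snd i))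
      = (\<integral>\<^sup>+y. f (move i (- \<theta>) (move i (y - coord i \<omega>) \<omega>)) \<partial>law (snd i))" ..
  qed
  also have "\<dots> = (\<integral>\<^sup>+\<omega>. f (move i (- \<theta>) \<omega>) \<partial>\<sigma>)"
    by (rule resamplesD[OF res, symmetric]) measurable
  finally show ?thesis .
qed

text \<open>The coordinate \<open>x\<close> is sent to \<open>r * x + c * y\<close> with independent
  noise \<open>y\<close>; hence the amount \<open>(r - 1) * x + c * y\<close> in the move.
  Resampling first makes \<open>x\<close> an independent Gaussian as well, and the one-dimensional
  rotation applies.\<close>

lemma resamples_mehler:
  fixes \<sigma> :: "'d::finite config measure"
  assumes res: "resamples \<sigma> i" and sets [measurable_cong]: "sets \<sigma> = sets \<Omega>"
    and f [measurable]: "f \<in> borel_measurable \<Omega>" and rc: "r\<^sup>2 + c\<^sup>2 = 1"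
  shows "(\<integral>\<^sup>+\<omega>. \<integral>\<^sup>+y. f (move i ((r - 1) * coord i \<omega> + c * y) \<omega>) \<partial>law (snd i) \<partial>\<sigma>) = (\<integral>\<^sup>+\<omega>. f \<omega> \<partial>\<sigma>)"
proof -
  interpret prob_space "law (snd i)" by (rule prob_space_law)
  define f' where "f' = (\<lambda>\<omega>. \<integral>\<^sup>+y. f (move i ((r - 1) * coord i \<omega> + c * y) \<omega>) \<partial>law (snd i))"
  have [measurable]: "f' \<in> borel_measurable \<Omega>" unfolding f'_def by measurable
  have "(\<integral>\<^sup>+\<omega>. f' \<omega> \<partial>\<sigma>) = (\<integral>\<^sup>+\<omega>. \<integral>\<^sup>+y. f' (move i (y - coord i \<omega>) \<omega>) \<partial>law (snd i) \<partial>\<sigma>)"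
    by (rule resamplesD[OF res]) measurable
  also have "\<dots> = (\<integral>\<^sup>+\<omega>. \<integral>\<^sup>+y. f (move i (y - coord i \<omega>) \<omega>) \<partial>law (snd i) \<partial>\<sigma>)"
  proof (rule nn_integral_cong)
    fix \<omega> assume "\<omega> \<in> space \<sigma>"
    then have [measurable]: "(\<lambda>_::real. \<omega>) \<in> measurable borel \<Omega>" using sets_eq_imp_space_eq[OF sets] by simp
    have "(\<integral>\<^sup>+y. f' (move i (y - coord i \<omega>) \<omega>) \<partial>law (snd i))
       = (\<integral>\<^sup>+y. \<integral>\<^sup>+y'. f (move i ((r * y + c * y') - coord i \<omega>) \<omega>) \<partial>law (snd i) \<partial>law (snd i))"
      unfolding f'_def by (simp add: coord_move algebra_simps)
    also have "\<dots> = (\<integral>\<^sup>+y. f (move i (y - coord i \<omega>) \<omega>) \<partial>law (snd i))"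
      by (rule law_rotate[OF _ rc]) measurable
    finally show "(\<integral>\<^sup>+y. f' (move i (y - coord i \<omega>) \<omega>) \<partial>law (snd i)) = (\<integral>\<^sup>+y. f (move i (y - coord i \<omega>) \<omega>) \<partial>law (snd i))" .
  qed
  also have "\<dots> = (\<integral>\<^sup>+\<omega>. f \<omega> \<partial>\<sigma>)" by (rule resamplesD[OF res, symmetric]) measurable
  finally show ?thesis unfolding f'_def .
qed

text \<open>Coordinates are split off one at a time; the invariance of \<open>U\<close> keeps it
  fixed while coordinate \<open>i\<close> is redrawn. In the application \<open>U\<close> carries
  everything that concerns the outside of \<open>\<Lambda>\<close>.\<close>

lemma resamples_rect:
  fixes \<sigma> :: "'d::finite config measure"
  assumes sets [measurable_cong]: "sets \<sigma> = sets \<Omega>"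
    and "finite I" "\<And>i. i \<in> I \<Longrightarrow> resamples \<sigma> i" and B: "\<And>i. B i \<in> sets borel"
    and U [measurable]: "U \<in> sets \<Omega>"
    and inv: "\<And>i t \<omega>. i \<in> I \<Longrightarrow> \<omega> \<in> Omega \<beta> \<Longrightarrow> move i t \<omega> \<in> U \<longleftrightarrow> \<omega> \<in> U"
  shows "emeasure \<sigma> (U \<inter> rect I B) = (\<Prod>i\<in>I. emeasure (law (snd i)) (B i)) * emeasure \<sigma> U"
  using assms(2,3) inv
proof (induction I rule: finite_induct)
  case empty
  have "U \<inter> rect {} B = U" using sets.sets_into_space[OF U] by (auto simp: rect_def)
  then show ?case by simp
next
  case (insert i I)
  have R [measurable]: "rect I B \<in> sets \<Omega>" "rect (insert i I) B \<in> sets \<Omega>"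
    using insert(1) B by (auto intro!: sets_rect)
  have [measurable]: "B i \<in> sets borel" by (rule B)
  have spc: "space \<sigma> = Omega \<beta>" using sets_eq_imp_space_eq[OF sets] by simp
  have "emeasure \<sigma> (U \<inter> rect (insert i I) B) = (\<integral>\<^sup>+\<omega>. indicator (U \<inter> rect (insert i I) B) \<omega> \<partial>\<sigma>)"
    by simp
  also have "\<dots> = (\<integral>\<^sup>+\<omega>. \<integral>\<^sup>+y. indicator (U \<inter> rect (insert i I) B) (move i (y - coord i \<omega>) \<omega>) \<partial>law (snd i) \<partial>\<sigma>)"
    by (rule resamplesD) (use insert.prems in auto)
  also have "\<dots> = (\<integral>\<^sup>+\<omega>. indicator (U \<inter> rect I B) \<omega> * emeasure (law (snd i)) (B i) \<partial>\<sigma>)"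
  proof (rule nn_integral_cong)
    fix \<omega> assume "\<omega> \<in> space \<sigma>"
    then have \<omega>: "\<omega> \<in> Omega \<beta>" by (simp add: spc)
    have "indicator (U \<inter> rect (insert i I) B) (move i (y - coord i \<omega>) \<omega>) = (indicator (U \<inter> rect I B) \<omega> * indicator (B i) y :: ennreal)" for y
    proof -
      have "move i (y - coord i \<omega>) \<omega> \<in> rect (insert i I) B \<longleftrightarrow> \<omega> \<in> rect I B \<and> y \<in> B i"
        using \<omega> insert(2) by (auto simp: rect_def coord_move)
      moreover have "move i (y - coord i \<omega>) \<omega> \<in> U \<longleftrightarrow> \<omega> \<in> U" using \<omega> by (intro insert.prems) auto
      ultimately show ?thesis by (simp add: indicator_def)
    qed
    then show "(\<integral>\<^sup>+y. indicator (U \<inter> rect (insert i I) B) (move i (y - coord i \<omega>) \<omega>) \<partial>law (snd i)) =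
       indicator (U \<inter> rect I B) \<omega> * emeasure (law (snd i)) (B i)"
      by (simp add: nn_integral_cmult)
  qed
  also have "\<dots> = emeasure (law (snd i)) (B i) * emeasure \<sigma> (U \<inter> rect I B)"
    by (subst nn_integral_multc) (auto simp: mult.commute)
  also have "emeasure \<sigma> (U \<inter> rect I B) = (\<Prod>i\<in>I. emeasure (law (snd i)) (B i)) * emeasure \<sigma> U"
    using insert.prems by (intro insert.IH) auto
  finally show ?case using insert(1,2) by (simp add: mult.assoc)
qed

section \<open>Partial Ornstein-Uhlenbeck moves in finitely many modes\<close>

definition mix :: "(int \<Rightarrow> real) \<Rightarrow> (int \<Rightarrow> real) \<Rightarrow> ('d::finite site \<times> int) set \<Rightarrow> 'd config \<Rightarrow> 'd config \<Rightarrow> 'd config" where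
  "mix r c I \<omega> z = (\<lambda>k. \<omega> k + (\<Sum>i\<in>I. if fst i = k
     then ((r (snd i) - 1) * coord i \<omega> + c (snd i) * coord i z) *\<^sub>R phi \<beta> (snd i) else 0))"

lemma mix_in_Omega: "\<omega> \<in> Omega \<beta> \<Longrightarrow> mix r c I \<omega> z \<in> Omega \<beta>"
  by (auto simp: Omega_def mix_def beta_pos intro!: loops_add loops_sum)

lemma coord_mix:
  assumes "finite I"
  shows "coord j (mix r c I \<omega> z) = coord j \<omega> + (if j \<in> I then (r (snd j) - 1) * coord j \<omega> + c (snd j) * coord j z else 0)"
proof -
  have *: "loop_coeff \<beta> (snd j) (if fst i = fst j then v *\<^sub>R phi \<beta> (snd i) else 0) = (if i = j then v else 0)" for i v
    by (auto simp: loop_coeff_scaleR loop_coeff_phi beta_pos prod_eq_iff)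
  have "coord j (mix r c I \<omega> z) = coord j \<omega> + (\<Sum>i\<in>I. loop_coeff \<beta> (snd j) (if fst i = fst j
     then ((r (snd i) - 1) * coord i \<omega> + c (snd i) * coord i z) *\<^sub>R phi \<beta> (snd i) else 0))"
    unfolding coord_def[of j] mix_def loop_coeff_add loop_coeff_sum ..
  then show ?thesis unfolding * using assms by simp
qed

text \<open>A further mode is one more Mehler move on top of the others. This works because
  \<open>mix\<close> adds a correction to \<open>\<omega>\<close> and leaves every mode outside
  \<open>I\<close> as it was, in particular coordinate \<open>i\<close> before its turn.\<close>

lemma mix_insert:
  assumes "finite I" "i \<notin> I"
  shows "mix r c (insert i I) \<omega> z = move i ((r (snd i) - 1) * coord i (mix r c I \<omega> z) + c (snd i) * coord i z) (mix r c I \<omega> z)"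
proof -
  have "coord i (mix r c I \<omega> z) = coord i \<omega>" using assms by (simp add: coord_mix)
  then show ?thesis using assms by (auto simp: mix_def move_apply fun_eq_iff)
qed

lemma mix_move: "i \<notin> I \<Longrightarrow> mix r c I \<omega> (move i t z) = mix r c I \<omega> z"
  unfolding mix_def by (intro ext arg_cong2[where f = "(+)"] refl sum.cong) (auto simp: coord_move)

lemma measurable_mix [measurable (raw)]:
  assumes f [measurable]: "f \<in> measurable M \<Omega>" and g [measurable]: "g \<in> measurable M \<Omega>"
  shows "(\<lambda>\<omega>. mix r c I (f \<omega>) (g \<omega>)) \<in> measurable M \<Omega>"
proof (rule measurable_OmegaI[OF beta_pos])
  show "mix r c I (f \<omega>) (g \<omega>) \<in> Omega \<beta>" if "\<omega> \<in> space M" for \<omega>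
    using measurable_space[OF f that] by (simp add: mix_in_Omega)
  fix k \<tau>
  have "(\<lambda>\<omega>. apply_bcontfun (f \<omega> k) \<tau> + (\<Sum>i\<in>I. if fst i = k
     then ((r (snd i) - 1) * coord i (f \<omega>) + c (snd i) * coord i (g \<omega>)) * apply_bcontfun (phi \<beta> (snd i)) \<tau> else 0)) \<in> borel_measurable M"
    by measurable
  moreover have "apply_bcontfun (mix r c I \<omega> z k) \<tau> = apply_bcontfun (\<omega> k) \<tau> + (\<Sum>i\<in>I. if fst i = k
     then ((r (snd i) - 1) * coord i \<omega> + c (snd i) * coord i z) * apply_bcontfun (phi \<beta> (snd i)) \<tau> else 0)" for \<omega> z
    unfolding mix_def by (simp add: apply_bcontfun_sum) (intro sum.cong refl, auto)
  ultimately show "(\<lambda>\<omega>. apply_bcontfun (mix r c I (f \<omega>) (g \<omega>) k) \<tau>) \<in> borel_measurable M"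
    by simp
qed

text \<open>Induction over the modes: since \<open>\<nu>\<close> resamples coordinate
  \<open>i\<close> and the other moves ignore it, that coordinate of \<open>z\<close> acts as
  independent noise, and the new mode contributes one Mehler step.\<close>

lemma mix_invariant:
  fixes \<sigma> \<nu> :: "'d::finite config measure" and f :: "'d config \<Rightarrow> ennreal"
  assumes s\<sigma> [measurable_cong]: "sets \<sigma> = sets \<Omega>" and s\<nu> [measurable_cong]: "sets \<nu> = sets \<Omega>" and "prob_space \<nu>"
    and "finite I" "\<And>i. i \<in> I \<Longrightarrow> resamples \<sigma> i" "\<And>i. i \<in> I \<Longrightarrow> resamples \<nu> i"
    and rc: "\<And>n. (r n)\<^sup>2 + (c n)\<^sup>2 = 1" and "f \<in> borel_measurable \<Omega>"
  shows "(\<integral>\<^sup>+\<omega>. \<integral>\<^sup>+z. f (mix r c I \<omega> z) \<partial>\<nu> \<partial>\<sigma>) = (\<integral>\<^sup>+\<omega>. f \<omega> \<partial>\<sigma>)"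
  using assms(4,5,6,8)
proof (induction I arbitrary: f rule: finite_induct)
  case empty
  interpret prob_space \<nu> by fact
  show ?case by (simp add: mix_def emeasure_space_1)
next
  case (insert i I)
  interpret prob_space \<nu> by fact
  interpret law: prob_space "law (snd i)" by (rule prob_space_law)
  note [measurable] = \<open>f \<in> borel_measurable \<Omega>\<close>
  define f' where "f' = (\<lambda>\<omega>. \<integral>\<^sup>+y. f (move i ((r (snd i) - 1) * coord i \<omega> + c (snd i) * y) \<omega>) \<partial>law (snd i))"
  have f' [measurable]: "f' \<in> borel_measurable \<Omega>" unfolding f'_def by measurable
  have "(\<integral>\<^sup>+z. f (mix r c (insert i I) \<omega> z) \<partial>\<nu>) = (\<integral>\<^sup>+z. f' (mix r c I \<omega> z) \<partial>\<nu>)" if "\<omega> \<in> space \<sigma>" for \<omega>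
  proof -
    have [measurable]: "(\<lambda>_::'d config. \<omega>) \<in> measurable \<Omega> \<Omega>" using that sets_eq_imp_space_eq[OF s\<sigma>] by simp
    have "(\<integral>\<^sup>+z. f (mix r c (insert i I) \<omega> z) \<partial>\<nu>)
       = (\<integral>\<^sup>+z. \<integral>\<^sup>+y. f (mix r c (insert i I) \<omega> (move i (y - coord i z) z)) \<partial>law (snd i) \<partial>\<nu>)"
      by (rule resamplesD) (use insert.prems in auto)
    also have "\<dots> = (\<integral>\<^sup>+z. f' (mix r c I \<omega> z) \<partial>\<nu>)"
      unfolding f'_def using insert(1,2) by (simp add: mix_insert mix_move coord_move)
    finally show ?thesis .
  qed
  then have "(\<integral>\<^sup>+\<omega>. \<integral>\<^sup>+z. f (mix r c (insert i I) \<omega> z) \<partial>\<nu> \<partial>\<sigma>) = (\<integral>\<^sup>+\<omega>. \<integral>\<^sup>+z. f' (mix r c I \<omega> z) \<partial>\<nu> \<partial>\<sigma>)"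
    by (rule nn_integral_cong)
  also have "\<dots> = (\<integral>\<^sup>+\<omega>. f' \<omega> \<partial>\<sigma>)" using insert.prems by (intro insert.IH f') auto
  also have "\<dots> = (\<integral>\<^sup>+\<omega>. f \<omega> \<partial>\<sigma>)"
    unfolding f'_def by (rule resamples_mehler) (use insert.prems rc s\<sigma> in auto)
  finally show ?case .
qed

definition noise :: "(int \<Rightarrow> real) \<Rightarrow> ('d::finite site \<times> int) set \<Rightarrow> 'd config \<Rightarrow> 'd config" where
  "noise c I z = (\<lambda>k. \<Sum>i\<in>I. if fst i = k then (c (snd i) * coord i z) *\<^sub>R phi \<beta> (snd i) else 0)"

text \<open>Reversing the sign of \<open>c\<close> flips the noise and keeps the damped part, so the
  difference no longer involves \<open>\<omega>\<close>.\<close>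

lemma noise_eq_mix: "noise c I z k = (1 / 2) *\<^sub>R (mix r c I \<omega> z k - mix r (\<lambda>n. - c n) I \<omega> z k)"
proof -
  have "mix r c I \<omega> z k - mix r (\<lambda>n. - c n) I \<omega> z k = (\<Sum>i\<in>I. (if fst i = k
     then ((r (snd i) - 1) * coord i \<omega> + c (snd i) * coord i z) *\<^sub>R phi \<beta> (snd i) else 0) - (if fst i = k
     then ((r (snd i) - 1) * coord i \<omega> + - c (snd i) * coord i z) *\<^sub>R phi \<beta> (snd i) else 0))"
    by (simp add: mix_def sum_subtractf)
  also have "\<dots> = (\<Sum>i\<in>I. 2 *\<^sub>R (if fst i = k then (c (snd i) * coord i z) *\<^sub>R phi \<beta> (snd i) else 0))"
    by (intro sum.cong refl) (auto simp: scaleR_diff_left[symmetric])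
  finally show ?thesis by (simp add: noise_def scaleR_right.sum[symmetric])
qed

lemma measurable_norm_eval [measurable (raw)]:
  assumes [measurable]: "g \<in> measurable M (\<Omega> :: 'd::finite config measure)"
  shows "(\<lambda>\<omega>. norm (g \<omega> k)) \<in> borel_measurable M"
proof -
  have "(\<lambda>\<omega>. dist (g \<omega> k) 0) \<in> borel_measurable M" by (rule measurable_dist_loop) measurable
  then show ?thesis by simp
qed

lemma measurable_noise [measurable]: "noise c (I :: ('d::finite site \<times> int) set) \<in> measurable \<Omega> \<Omega>"
proof (rule measurable_OmegaI[OF beta_pos])
  show "noise c I z \<in> Omega \<beta>" for z :: "'d config"
    by (auto simp: Omega_def noise_def beta_pos intro!: loops_sum)
  fix k \<tau>
  have "(\<lambda>z. \<Sum>i\<in>I. if fst i = k then c (snd i) * coord i z * apply_bcontfun (phi \<beta> (snd i)) \<tau> else 0) \<in> borel_measurable \<Omega>"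
    by measurable
  moreover have "apply_bcontfun (noise c I z k) \<tau> = (\<Sum>i\<in>I. if fst i = k then c (snd i) * coord i z * apply_bcontfun (phi \<beta> (snd i)) \<tau> else 0)" for z
    unfolding noise_def by (simp add: apply_bcontfun_sum) (intro sum.cong refl, auto)
  ultimately show "(\<lambda>z. apply_bcontfun (noise c I z k) \<tau>) \<in> borel_measurable \<Omega>" by simp
qed

text \<open>The noise is half the difference of two loops that each have law \<open>\<nu>\<close>, so no estimate on the
  size of Gaussian Fourier series is needed.\<close>

lemma noise_bound:
  fixes \<nu> :: "'d::finite config measure"
  assumes s\<nu> [measurable_cong]: "sets \<nu> = sets \<Omega>" and "prob_space \<nu>" and "finite (I :: ('d site \<times> int) set)"
    and res: "\<And>i. i \<in> I \<Longrightarrow> resamples \<nu> i" and c: "\<And>n. \<bar>c n\<bar> \<le> 1" and \<Lambda>: "finite \<Lambda>"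
  shows "emeasure \<nu> {z \<in> Omega \<beta>. \<exists>k\<in>\<Lambda>. s < norm (noise c I z k)} \<le> 2 * emeasure \<nu> {z \<in> Omega \<beta>. \<exists>k\<in>\<Lambda>. s < norm (z k)}"
proof -
  interpret prob_space \<nu> by fact
  \<comment> \<open>\<open>r\<close> completes both \<open>c\<close> and \<open>- c\<close> to a
    point of the unit circle, hence both mixtures keep the law \<open>\<nu>\<close>.\<close>
  define r where "r = (\<lambda>n. sqrt (1 - (c n)\<^sup>2))"
  have rc: "(r n)\<^sup>2 + (c n)\<^sup>2 = 1" "(r n)\<^sup>2 + (- c n)\<^sup>2 = 1" for n
    using c[of n] by (simp_all add: r_def abs_square_le_1)
  have spc [simp]: "space \<nu> = Omega \<beta>" using sets_eq_imp_space_eq[OF s\<nu>] by simp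
  define U where "U = {z \<in> Omega \<beta> :: 'd config set. \<exists>k\<in>\<Lambda>. s < norm (z k)}"
  have "{z \<in> space \<Omega> :: 'd config set. \<exists>k\<in>\<Lambda>. s < norm (z k)} \<in> sets \<Omega>" using \<Lambda> by measurable
  then have U [measurable]: "U \<in> sets \<Omega>" by (simp add: U_def)
  have "{z \<in> space \<Omega> :: 'd config set. \<exists>k\<in>\<Lambda>. s < norm (noise c I z k)} \<in> sets \<Omega>" using \<Lambda> by measurable
  then have N [measurable]: "{z \<in> Omega \<beta>. \<exists>k\<in>\<Lambda>. s < norm (noise c I z k)} \<in> sets (\<Omega> :: 'd config measure)" by simp
  \<comment> \<open>A second, independent configuration \<open>\<omega>\<close> is brought in by a
    trivial integration, so that the noise can be written as a difference of two mixtures.\<close>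
  have "emeasure \<nu> {z \<in> Omega \<beta>. \<exists>k\<in>\<Lambda>. s < norm (noise c I z k)}
     = (\<integral>\<^sup>+\<omega>. \<integral>\<^sup>+z. indicator {z \<in> Omega \<beta>. \<exists>k\<in>\<Lambda>. s < norm (noise c I z k)} z \<partial>\<nu> \<partial>\<nu>)"
    using emeasure_space_1 s\<nu> by simp
  also have "\<dots> \<le> (\<integral>\<^sup>+\<omega>. \<integral>\<^sup>+z. indicator U (mix r c I \<omega> z) + indicator U (mix r (\<lambda>n. - c n) I \<omega> z) \<partial>\<nu> \<partial>\<nu>)"
  proof (intro nn_integral_mono)
    fix \<omega> z assume "\<omega> \<in> space \<nu>" "z \<in> space \<nu>"
    have "mix r c I \<omega> z \<in> U \<or> mix r (\<lambda>n. - c n) I \<omega> z \<in> U" if "k \<in> \<Lambda>" "s < norm (noise c I z k)" for k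
    proof -
      have "norm (noise c I z k) \<le> 1 / 2 * (norm (mix r c I \<omega> z k) + norm (mix r (\<lambda>n. - c n) I \<omega> z k))"
        unfolding noise_eq_mix[of c I z k r \<omega>] norm_scaleR by (intro mult_mono norm_triangle_ineq4) auto
      then have "s < norm (mix r c I \<omega> z k) \<or> s < norm (mix r (\<lambda>n. - c n) I \<omega> z k)"
        using that(2) by (cases "s < norm (mix r c I \<omega> z k)") auto
      then show ?thesis using that \<open>\<omega> \<in> space \<nu>\<close> by (auto simp: U_def mix_in_Omega)
    qed
    then show "indicator {z \<in> Omega \<beta>. \<exists>k\<in>\<Lambda>. s < norm (noise c I z k)} z
       \<le> (indicator U (mix r c I \<omega> z) + indicator U (mix r (\<lambda>n. - c n) I \<omega> z) :: ennreal)"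
      by (auto simp: indicator_def)
  qed
  also have "\<dots> = (\<integral>\<^sup>+\<omega>. \<integral>\<^sup>+z. indicator U (mix r c I \<omega> z) \<partial>\<nu> \<partial>\<nu>) + (\<integral>\<^sup>+\<omega>. \<integral>\<^sup>+z. indicator U (mix r (\<lambda>n. - c n) I \<omega> z) \<partial>\<nu> \<partial>\<nu>)"
  proof -
    have "(\<integral>\<^sup>+z. indicator U (mix r c I \<omega> z) + indicator U (mix r (\<lambda>n. - c n) I \<omega> z) \<partial>\<nu>)
      = (\<integral>\<^sup>+z. indicator U (mix r c I \<omega> z) \<partial>\<nu>) + (\<integral>\<^sup>+z. indicator U (mix r (\<lambda>n. - c n) I \<omega> z) \<partial>\<nu>)" if "\<omega> \<in> space \<nu>" for \<omega>
    proof -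
      have "mix r c I \<omega> \<in> measurable \<nu> \<Omega>" for c
        unfolding measurable_cong_sets[OF s\<nu> refl]
        by (rule measurable_mix[OF measurable_const measurable_ident_sets[OF refl]]) (use that in simp)
      then have "(\<lambda>z. indicator U (mix r c I \<omega> z) :: ennreal) \<in> borel_measurable \<nu>" for c
        by (rule measurable_compose) (rule borel_measurable_indicator[OF U])
      then show ?thesis by (intro nn_integral_add)
    qed
    then have "(\<integral>\<^sup>+\<omega>. \<integral>\<^sup>+z. indicator U (mix r c I \<omega> z) + indicator U (mix r (\<lambda>n. - c n) I \<omega> z) \<partial>\<nu> \<partial>\<nu>)
      = (\<integral>\<^sup>+\<omega>. (\<integral>\<^sup>+z. indicator U (mix r c I \<omega> z) \<partial>\<nu>) + (\<integral>\<^sup>+z. indicator U (mix r (\<lambda>n. - c n) I \<omega> z) \<partial>\<nu>) \<partial>\<nu>)"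
      by (rule nn_integral_cong)
    also have "\<dots> = (\<integral>\<^sup>+\<omega>. \<integral>\<^sup>+z. indicator U (mix r c I \<omega> z) \<partial>\<nu> \<partial>\<nu>) + (\<integral>\<^sup>+\<omega>. \<integral>\<^sup>+z. indicator U (mix r (\<lambda>n. - c n) I \<omega> z) \<partial>\<nu> \<partial>\<nu>)"
      by (rule nn_integral_add) measurable
    finally show ?thesis .
  qed
  also have "(\<integral>\<^sup>+\<omega>. \<integral>\<^sup>+z. indicator U (mix r c I \<omega> z) \<partial>\<nu> \<partial>\<nu>) = (\<integral>\<^sup>+\<omega>. indicator U \<omega> \<partial>\<nu>)"
    by (rule mix_invariant) (use assms rc in auto)
  also have "(\<integral>\<^sup>+\<omega>. \<integral>\<^sup>+z. indicator U (mix r (\<lambda>n. - c n) I \<omega> z) \<partial>\<nu> \<partial>\<nu>) = (\<integral>\<^sup>+\<omega>. indicator U \<omega> \<partial>\<nu>)"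
    by (rule mix_invariant) (use assms rc in auto)
  finally show ?thesis using s\<nu> by (simp add: U_def[symmetric] mult_2)
qed

end

section \<open>The free measure in a finite volume\<close>

locale gaussian_loops = quantum_loops \<beta> m a for \<beta> m a :: real +
  fixes \<gamma> :: "loop measure"
  assumes gaussian: "loop_gaussian \<beta> m a \<gamma>"
begin

lemma prob_space_gamma: "prob_space \<gamma>" and sets_gamma [measurable_cong]: "sets \<gamma> = sets (loop_space \<beta>)"
  using gaussian by (auto simp: loop_gaussian_def)

lemma space_gamma: "space \<gamma> = loops \<beta>"
  using sets_eq_imp_space_eq[OF sets_gamma] by (simp add: space_restrict_space)

text \<open>The defining Fourier transform is evaluated at a trigonometric polynomial, for which the
  spectral sum in \<open>A_inv_form\<close> has only the terms of \<open>L\<close> and its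
  exponential factorises.\<close>

lemma gamma_char:
  assumes "finite L"
  shows "(CLINT z|\<gamma>. iexp (\<Sum>l\<in>L. t l * loop_coeff \<beta> l z)) = (\<Prod>l\<in>L. char (law l) (t l))"
proof -
  define F where "F = (\<Sum>l\<in>L. t l *\<^sub>R phi \<beta> l)"
  have sym: "loop_inner \<beta> f g = loop_inner \<beta> g f" for f g
    by (simp add: loop_inner_def mult.commute)
  have coeff: "loop_inner \<beta> (apply_bcontfun (phi \<beta> n)) (apply_bcontfun F) = (if n \<in> L then t n else 0)" for n
    using assms by (simp add: F_def loop_coeff_def[symmetric] loop_coeff_sum loop_coeff_scaleR loop_coeff_phi beta_pos
        if_distrib[where f = "\<lambda>x. _ * x"] sum.delta' cong: if_cong)
  have inner: "loop_inner \<beta> (apply_bcontfun F) (apply_bcontfun z) = (\<Sum>l\<in>L. t l * loop_coeff \<beta> l z)" for z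
  proof -
    have "loop_inner \<beta> (apply_bcontfun F) (apply_bcontfun z) = circle_int \<beta> (\<lambda>\<tau>. \<Sum>l\<in>L. t l * (apply_bcontfun (phi \<beta> l) \<tau> * apply_bcontfun z \<tau>))"
      by (simp add: loop_inner_def F_def apply_bcontfun_sum sum_distrib_right mult.assoc)
    also have "\<dots> = (\<Sum>l\<in>L. t l * loop_coeff \<beta> l z)"
      by (subst circle_int_sum) (auto intro!: continuous_intros simp: circle_int_cmult loop_coeff_def loop_inner_def)
    finally show ?thesis .
  qed
  have "apply_bcontfun F \<in> loop_L2 \<beta>"
  proof -
    have [measurable]: "apply_bcontfun F \<in> borel_measurable borel" by (rule borel_measurable_continuous_onI) simp
    have "set_borel_measurable lborel {0..<\<beta>} (apply_bcontfun F)"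
      unfolding set_borel_measurable_def by measurable
    then show ?thesis unfolding loop_L2_def by (auto intro!: set_integrable_circle continuous_intros)
  qed
  then have "(CLINT z|\<gamma>. iexp (\<Sum>l\<in>L. t l * loop_coeff \<beta> l z)) = of_real (exp (- A_inv_form \<beta> m a (apply_bcontfun F) (apply_bcontfun F) / 2))"
    using gaussian unfolding loop_gaussian_def inner[symmetric] by blast
  also have "A_inv_form \<beta> m a (apply_bcontfun F) (apply_bcontfun F) = (\<Sum>l\<in>L. t l * t l / lam l)"
  proof -
    have "A_inv_form \<beta> m a (apply_bcontfun F) (apply_bcontfun F) = (\<Sum>\<^sub>\<infinity>n\<in>UNIV. (if n \<in> L then t n else 0) * (if n \<in> L then t n else 0) / lam n)"
      unfolding A_inv_form_def sym[of "apply_bcontfun F"] coeff ..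
    also have "\<dots> = (\<Sum>\<^sub>\<infinity>n\<in>L. t n * t n / lam n)" by (rule infsum_cong_neutral) auto
    finally show ?thesis using assms by simp
  qed
  also have "- (\<Sum>l\<in>L. t l * t l / lam l) / 2 = (\<Sum>l\<in>L. - (t l)\<^sup>2 / (2 * lam l))"
    by (simp add: sum_negf[symmetric] sum_divide_distrib power2_eq_square mult.commute)
  finally show ?thesis using assms by (simp add: exp_sum char_law)
qed

lemma gamma_rect:
  assumes "finite L" "\<And>l. l \<in> L \<Longrightarrow> B l \<in> sets borel"
  shows "emeasure \<gamma> {z \<in> loops \<beta>. \<forall>l\<in>L. loop_coeff \<beta> l z \<in> B l} = (\<Prod>l\<in>L. emeasure (law l) (B l))"
proof -
  interpret prob_space \<gamma> by (rule prob_space_gamma)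
  have meas: "loop_coeff \<beta> l \<in> borel_measurable \<gamma>" for l
    unfolding measurable_cong_sets[OF sets_gamma refl] by (rule measurable_loop_coeff) (rule measurable_eval_loop)
  have "measure \<gamma> {z \<in> space \<gamma>. \<forall>l\<in>L. loop_coeff \<beta> l z \<in> B l} = 1 * (\<Prod>l\<in>L. measure (law l) (B l))"
  proof (intro independent_of_char_product finite_measure_axioms real_distribution_law meas assms)
    show "(CLINT z|\<gamma>. iexp (\<Sum>l\<in>L. t l * loop_coeff \<beta> l z)) = complex_of_real 1 * (\<Prod>l\<in>L. char (law l) (t l))" for t
      by (simp only: gamma_char[OF assms(1)] of_real_1 mult_1)
  qed
  then have "emeasure \<gamma> {z \<in> loops \<beta>. \<forall>l\<in>L. loop_coeff \<beta> l z \<in> B l} = ennreal (\<Prod>l\<in>L. measure (law l) (B l))"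
    by (simp add: space_gamma emeasure_eq_measure)
  also have "\<dots> = (\<Prod>l\<in>L. emeasure (law l) (B l))"
    by (simp add: prod_ennreal[symmetric] finite_measure.emeasure_eq_measure[OF prob_space.finite_measure[OF prob_space_law]])
  finally show ?thesis .
qed

lemma measurable_override [measurable (raw)]:
  assumes f [measurable]: "f \<in> measurable M (\<Omega> :: 'd::finite config measure)" and g [measurable]: "g \<in> measurable M \<Omega>"
  shows "(\<lambda>\<omega>. override_on (f \<omega>) (g \<omega>) \<Lambda>) \<in> measurable M \<Omega>"
proof (rule measurable_OmegaI[OF beta_pos])
  show "override_on (f \<omega>) (g \<omega>) \<Lambda> \<in> Omega \<beta>" if "\<omega> \<in> space M" for \<omega>
    using measurable_space[OF f that] measurable_space[OF g that] by (auto simp: Omega_def override_on_def)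
  show "(\<lambda>\<omega>. apply_bcontfun (override_on (f \<omega>) (g \<omega>) \<Lambda> k) \<tau>) \<in> borel_measurable M" for k \<tau>
    by (cases "k \<in> \<Lambda>") simp_all
qed

lemma measurable_override_zero:
  "(\<lambda>z. override_on (\<lambda>_. 0) z \<Lambda>) \<in> measurable (\<Pi>\<^sub>M k\<in>\<Lambda>. \<gamma>) (\<Omega> :: 'd::finite config measure)"
proof (rule measurable_OmegaI[OF beta_pos])
  show "override_on (\<lambda>_. 0) z \<Lambda> \<in> Omega \<beta>" if "z \<in> space (\<Pi>\<^sub>M k\<in>\<Lambda>. \<gamma>)" for z :: "'d config"
    using that by (auto simp: Omega_def override_on_def space_PiM space_gamma)
  show "(\<lambda>z. apply_bcontfun (override_on (\<lambda>_. 0) z \<Lambda> k) \<tau>) \<in> borel_measurable (\<Pi>\<^sub>M k\<in>\<Lambda>. \<gamma>)" for k :: "'d site" and \<tau>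
  proof (cases "k \<in> \<Lambda>")
    case True
    have "(\<lambda>z. apply_bcontfun z \<tau>) \<in> borel_measurable \<gamma>"
      unfolding measurable_cong_sets[OF sets_gamma refl] by (rule measurable_eval_loop)
    from measurable_compose[OF measurable_component_singleton[OF True] this] show ?thesis using True by simp
  qed simp
qed

text \<open>Loops outside \<open>\<Lambda>\<close> are padded by zero so that
  \<open>free \<Lambda>\<close> lives on the common space of configurations and shares coordinates
  and moves with the other measures.\<close>

definition free :: "'d::finite site set \<Rightarrow> 'd config measure" where
  "free \<Lambda> = distr (\<Pi>\<^sub>M k\<in>\<Lambda>. \<gamma>) \<Omega> (\<lambda>z. override_on (\<lambda>_. 0) z \<Lambda>)"

lemma sets_free [simp, measurable_cong]: "sets (free \<Lambda>) = sets \<Omega>"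
  and space_free [simp]: "space (free \<Lambda>) = Omega \<beta>"
  by (simp_all add: free_def)

lemma prob_space_free: "prob_space (free \<Lambda>)"
  unfolding free_def
  by (intro prob_space.prob_space_distr prob_space_PiM prob_space_gamma measurable_override_zero)

text \<open>The Boolean factor is due to the padding: outside \<open>\<Lambda>\<close> all
  coordinates are zero. Inside, distinct sites are independent by the product and distinct modes of
  one site by \<open>gamma_rect\<close>.\<close>

lemma free_rect:
  fixes I :: "('d::finite site \<times> int) set"
  assumes "finite \<Lambda>" "finite I" "\<And>i. B i \<in> sets borel"
  shows "emeasure (free \<Lambda>) (rect I B) =
    (\<Prod>i\<in>{i \<in> I. fst i \<in> \<Lambda>}. emeasure (law (snd i)) (B i)) * of_bool (\<forall>i\<in>I. fst i \<notin> \<Lambda> \<longrightarrow> 0 \<in> B i)"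
proof -
  interpret prob_space \<gamma> by (rule prob_space_gamma)
  interpret product_sigma_finite "\<lambda>_. \<gamma>" by (simp add: product_sigma_finite_def sigma_finite_measure_axioms)
  define L where "L = (\<lambda>k. snd ` {i \<in> I. fst i = k})"
  define E where "E = (\<lambda>k. {z \<in> loops \<beta>. \<forall>l\<in>L k. loop_coeff \<beta> l z \<in> B (k, l)})"
  have fL: "finite (L k)" for k using assms by (simp add: L_def)
  have meas: "loop_coeff \<beta> l \<in> borel_measurable \<gamma>" for l
    unfolding measurable_cong_sets[OF sets_gamma refl] by (rule measurable_loop_coeff) (rule measurable_eval_loop)
  have E: "E k \<in> sets \<gamma>" for k
  proof -
    have "{z \<in> space \<gamma>. \<forall>l\<in>L k. loop_coeff \<beta> l z \<in> B (k, l)} \<in> sets \<gamma>"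
      using meas assms(3) fL[of k] by measurable
    then show ?thesis by (simp add: E_def space_gamma)
  qed
  have rect: "rect I B \<in> sets (\<Omega> :: 'd config measure)" using assms by (intro sets_rect) auto
  have "emeasure (free \<Lambda>) (rect I B) = emeasure (\<Pi>\<^sub>M k\<in>\<Lambda>. \<gamma>) ((\<lambda>z. override_on (\<lambda>_. 0) z \<Lambda>) -` rect I B \<inter> space (\<Pi>\<^sub>M k\<in>\<Lambda>. \<gamma>))"
    unfolding free_def using rect measurable_override_zero by (intro emeasure_distr)
  also have "(\<lambda>z. override_on (\<lambda>_. 0) z \<Lambda>) -` rect I B \<inter> space (\<Pi>\<^sub>M k\<in>\<Lambda>. \<gamma>)
     = (if \<forall>i\<in>I. fst i \<notin> \<Lambda> \<longrightarrow> 0 \<in> B i then Pi\<^sub>E \<Lambda> E else {})"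
  proof -
    have "override_on (\<lambda>_. 0) z \<Lambda> \<in> rect I B \<longleftrightarrow> (\<forall>i\<in>I. fst i \<notin> \<Lambda> \<longrightarrow> 0 \<in> B i) \<and> z \<in> Pi\<^sub>E \<Lambda> E"
      if z: "z \<in> space (\<Pi>\<^sub>M k\<in>\<Lambda>. \<gamma>)" for z :: "'d config"
    proof -
      have zE: "z \<in> Pi\<^sub>E \<Lambda> (\<lambda>_. loops \<beta>)" using z by (simp add: space_PiM space_gamma)
      have "override_on (\<lambda>_. 0) z \<Lambda> \<in> Omega \<beta>" using measurable_space[OF measurable_override_zero z] by simp
      then have "override_on (\<lambda>_. 0) z \<Lambda> \<in> rect I B \<longleftrightarrow> (\<forall>i\<in>I. (if fst i \<in> \<Lambda> then loop_coeff \<beta> (snd i) (z (fst i)) else 0) \<in> B i)"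
        by (auto simp: rect_def coord_def override_on_def)
      also have "\<dots> \<longleftrightarrow> (\<forall>i\<in>I. fst i \<notin> \<Lambda> \<longrightarrow> 0 \<in> B i) \<and> (\<forall>i\<in>I. fst i \<in> \<Lambda> \<longrightarrow> loop_coeff \<beta> (snd i) (z (fst i)) \<in> B i)"
        by auto
      also have "(\<forall>i\<in>I. fst i \<in> \<Lambda> \<longrightarrow> loop_coeff \<beta> (snd i) (z (fst i)) \<in> B i) \<longleftrightarrow> z \<in> Pi\<^sub>E \<Lambda> E"
      proof
        assume *: "\<forall>i\<in>I. fst i \<in> \<Lambda> \<longrightarrow> loop_coeff \<beta> (snd i) (z (fst i)) \<in> B i"
        have "z k \<in> E k" if "k \<in> \<Lambda>" for k
          unfolding E_def L_def using zE * that by (auto simp: PiE_iff)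
        then show "z \<in> Pi\<^sub>E \<Lambda> E" using zE by (simp add: PiE_iff)
      next
        assume *: "z \<in> Pi\<^sub>E \<Lambda> E"
        show "\<forall>i\<in>I. fst i \<in> \<Lambda> \<longrightarrow> loop_coeff \<beta> (snd i) (z (fst i)) \<in> B i"
        proof (intro ballI impI)
          fix i assume i: "i \<in> I" "fst i \<in> \<Lambda>"
          then have "z (fst i) \<in> E (fst i)" "snd i \<in> L (fst i)" using * by (auto simp: PiE_iff L_def)
          then show "loop_coeff \<beta> (snd i) (z (fst i)) \<in> B i" by (auto simp: E_def)
        qed
      qed
      finally show ?thesis .
    qed
    moreover have "Pi\<^sub>E \<Lambda> E \<subseteq> space (\<Pi>\<^sub>M k\<in>\<Lambda>. \<gamma>)"
      by (auto simp: space_PiM space_gamma E_def PiE_iff)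
    ultimately show ?thesis by auto
  qed
  also have "emeasure (\<Pi>\<^sub>M k\<in>\<Lambda>. \<gamma>) \<dots> = emeasure (\<Pi>\<^sub>M k\<in>\<Lambda>. \<gamma>) (Pi\<^sub>E \<Lambda> E) * of_bool (\<forall>i\<in>I. fst i \<notin> \<Lambda> \<longrightarrow> 0 \<in> B i)"
    by simp
  also have "emeasure (\<Pi>\<^sub>M k\<in>\<Lambda>. \<gamma>) (Pi\<^sub>E \<Lambda> E) = (\<Prod>k\<in>\<Lambda>. emeasure \<gamma> (E k))"
    using assms E by (intro emeasure_PiM)
  also have "\<dots> = (\<Prod>k\<in>\<Lambda>. \<Prod>l\<in>L k. emeasure (law l) (B (k, l)))"
    unfolding E_def using fL assms by (intro prod.cong refl gamma_rect)
  also have "\<dots> = (\<Prod>(k, l)\<in>Sigma \<Lambda> L. emeasure (law l) (B (k, l)))"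
    using assms fL by (intro prod.Sigma) auto
  also have "\<dots> = (\<Prod>i\<in>{i \<in> I. fst i \<in> \<Lambda>}. emeasure (law (snd i)) (B i))"
    by (rule prod.cong) (auto simp: L_def image_iff)
  finally show ?thesis .
qed

text \<open>The resampled measure is realised as the image of a product with
  \<open>law (snd i)\<close>, where a rectangle splits into its condition on \<open>i\<close> and
  the conditions on the other coordinates.\<close>

lemma resamples_free:
  fixes i :: "'d::finite site \<times> int"
  assumes "finite \<Lambda>" "fst i \<in> \<Lambda>"
  shows "resamples (free \<Lambda>) i"
  unfolding resamples_def
proof (intro allI impI)
  fix f :: "'d config \<Rightarrow> ennreal" assume [measurable]: "f \<in> borel_measurable \<Omega>"
  interpret F: prob_space "free \<Lambda>" by (rule prob_space_free)
  interpret N: prob_space "law (snd i)" by (rule prob_space_law)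
  define \<nu> where "\<nu> = distr (free \<Lambda> \<Otimes>\<^sub>M law (snd i)) \<Omega> (\<lambda>p. move i (snd p - coord i (fst p)) (fst p))"
  have "free \<Lambda> = \<nu>"
  proof (rule measure_eqI_rect[OF F.finite_measure_axioms])
    fix I :: "('d site \<times> int) set" and B :: "'d site \<times> int \<Rightarrow> real set"
    assume I: "finite I" and B: "\<And>i. B i \<in> sets borel"
    define B' where "B' = (if i \<in> I then B i else UNIV)"
    have B' [measurable]: "B' \<in> sets borel" using B by (simp add: B'_def)
    have R [measurable]: "rect I B \<in> sets \<Omega>" "rect (I - {i}) B \<in> sets \<Omega>" using I B by (auto intro!: sets_rect)
    have "emeasure \<nu> (rect I B) = emeasure (free \<Lambda> \<Otimes>\<^sub>M law (snd i)) ((\<lambda>p. move i (snd p - coord i (fst p)) (fst p)) -` rect I B \<inter> space (free \<Lambda> \<Otimes>\<^sub>M law (snd i)))"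
      unfolding \<nu>_def by (rule emeasure_distr) measurable
    also have "(\<lambda>p. move i (snd p - coord i (fst p)) (fst p)) -` rect I B \<inter> space (free \<Lambda> \<Otimes>\<^sub>M law (snd i)) = rect (I - {i}) B \<times> B'"
      by (auto simp: rect_def coord_move space_pair_measure B'_def split: if_splits)
    also have "emeasure (free \<Lambda> \<Otimes>\<^sub>M law (snd i)) \<dots> = emeasure (free \<Lambda>) (rect (I - {i}) B) * emeasure (law (snd i)) B'"
      by (intro N.emeasure_pair_measure_Times) simp_all
    also have "\<dots> = emeasure (free \<Lambda>) (rect I B)"
    proof (cases "i \<in> I")
      case False
      then show ?thesis using N.emeasure_space_1 by (simp add: B'_def)
    next
      case True
      have "{j \<in> I. fst j \<in> \<Lambda>} = insert i {j \<in> I - {i}. fst j \<in> \<Lambda>}" using True assms by auto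
      moreover have "(\<forall>j\<in>I. fst j \<notin> \<Lambda> \<longrightarrow> 0 \<in> B j) \<longleftrightarrow> (\<forall>j\<in>I - {i}. fst j \<notin> \<Lambda> \<longrightarrow> 0 \<in> B j)" using assms by auto
      ultimately show ?thesis using I B assms True by (simp add: free_rect B'_def mult_ac)
    qed
    finally show "emeasure (free \<Lambda>) (rect I B) = emeasure \<nu> (rect I B)" ..
  qed (simp_all add: \<nu>_def)
  then have "(\<integral>\<^sup>+\<omega>. f \<omega> \<partial>free \<Lambda>) = (\<integral>\<^sup>+\<omega>. f \<omega> \<partial>\<nu>)" by simp
  also have "\<dots> = (\<integral>\<^sup>+p. f (move i (snd p - coord i (fst p)) (fst p)) \<partial>(free \<Lambda> \<Otimes>\<^sub>M law (snd i)))"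
    unfolding \<nu>_def by (subst nn_integral_distr) simp_all
  also have "\<dots> = (\<integral>\<^sup>+\<omega>. \<integral>\<^sup>+y. f (move i (y - coord i \<omega>) \<omega>) \<partial>law (snd i) \<partial>free \<Lambda>)"
    by (subst N.nn_integral_fst[symmetric]) simp_all
  finally show "(\<integral>\<^sup>+\<omega>. f \<omega> \<partial>free \<Lambda>) = (\<integral>\<^sup>+\<omega>. \<integral>\<^sup>+y. f (move i (y - coord i \<omega>) \<omega>) \<partial>law (snd i) \<partial>free \<Lambda>)" .
qed

end

section \<open>Energies of tempered configurations\<close>

text \<open>Both sides agree for divergent series too: summability of reals is absolute, and
  otherwise both operators return 0. Integrals give access to domination and measurability.\<close>

lemma infsum_eq_integral_count_space:
  fixes f :: "'a \<Rightarrow> real"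
  shows "infsum f A = (LINT x|count_space A. f x)"
proof (cases "Infinite_Set_Sum.abs_summable_on f A")
  case True
  then show ?thesis by (simp add: infsetsum_infsum[symmetric] infsetsum_def)
next
  case False
  then have "\<not> f summable_on A"
    using abs_summable_equivalent[of f A] summable_on_iff_abs_summable_on_real[of f A] by simp
  then show ?thesis using False
    by (simp add: infsum_not_exists not_integrable_integral_eq Infinite_Set_Sum.abs_summable_on_def)
qed

text \<open>\<open>infsum\<close> is the supremum over finite subsets; countability provides an
  increasing sequence of them to which monotone convergence applies.\<close>

lemma infsum_eq_nn_integral_count_space:
  fixes f :: "'a \<Rightarrow> ennreal"
  assumes "countable A"
  shows "infsum f A = (\<integral>\<^sup>+x. f x \<partial>count_space A)"
proof (rule antisym)
  have eq: "infsum f A = (SUP F\<in>{F. finite F \<and> F \<subseteq> A}. sum f F)"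
    by (rule nonneg_infsum_complete) simp
  have fin: "sum f F = (\<integral>\<^sup>+x. f x * indicator F x \<partial>count_space A)" if "finite F" "F \<subseteq> A" for F
    using that by (subst nn_integral_count_space'[of F]) (auto simp: indicator_def)
  show "infsum f A \<le> (\<integral>\<^sup>+x. f x \<partial>count_space A)"
    unfolding eq by (rule SUP_least) (auto simp: fin indicator_def intro!: nn_integral_mono)
  show "(\<integral>\<^sup>+x. f x \<partial>count_space A) \<le> infsum f A"
  proof (cases "A = {}")
    case False
    define F where "F = (\<lambda>n. from_nat_into A ` {..<n})"
    have F: "finite (F n)" "F n \<subseteq> A" for n
      using from_nat_into[OF False] by (auto simp: F_def)
    have "f x = (SUP n. f x * indicator (F n) x)" if x: "x \<in> A" for x
    proof (rule antisym)
      obtain j where "from_nat_into A j = x" using from_nat_into_surj[OF assms x] by auto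
      then have "x \<in> F (Suc j)" by (auto simp: F_def)
      then show "f x \<le> (SUP n. f x * indicator (F n) x)" by (intro SUP_upper2[of "Suc j"]) auto
      show "(SUP n. f x * indicator (F n) x) \<le> f x" by (intro SUP_least) (simp add: indicator_def)
    qed
    then have "(\<integral>\<^sup>+x. f x \<partial>count_space A) = (\<integral>\<^sup>+x. (SUP n. f x * indicator (F n) x) \<partial>count_space A)"
      by (intro nn_integral_cong) simp
    also have "\<dots> = (SUP n. \<integral>\<^sup>+x. f x * indicator (F n) x \<partial>count_space A)"
    proof (rule nn_integral_monotone_convergence_SUP)
      have "F n \<subseteq> F k" if "n \<le> k" for n k using that by (auto simp: F_def)
      then show "incseq (\<lambda>n x. f x * indicator (F n) x)"
        by (fastforce simp: incseq_def le_fun_def indicator_def)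
    qed simp
    also have "\<dots> \<le> infsum f A"
    proof (rule SUP_least)
      fix n
      have "sum f (F n) \<le> infsum f A" unfolding eq using F[of n] by (intro SUP_upper) simp
      then show "(\<integral>\<^sup>+x. f x * indicator (F n) x \<partial>count_space A) \<le> infsum f A" using fin[OF F] by simp
    qed
    finally show ?thesis .
  qed (simp add: nn_integral_empty)
qed

lemma countable_point_sets: "countable {S \<in> point_sets M :: 'd::finite site set set. P S}"
  by (rule countable_subset[OF _ countable_Collect_finite]) (auto simp: point_sets_def)

lemma integral_count_space_dominated:
  fixes f :: "'a \<Rightarrow> real"
  assumes "\<And>x. x \<in> A \<Longrightarrow> ennreal \<bar>f x\<bar> \<le> g x" "(\<integral>\<^sup>+x. g x \<partial>count_space A) < \<infinity>"
  shows "integrable (count_space A) f" "ennreal \<bar>LINT x|count_space A. f x\<bar> \<le> (\<integral>\<^sup>+x. g x \<partial>count_space A)"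
proof -
  have le: "(\<integral>\<^sup>+x. ennreal (norm (f x)) \<partial>count_space A) \<le> (\<integral>\<^sup>+x. g x \<partial>count_space A)"
    using assms(1) by (intro nn_integral_mono) simp
  then show int: "integrable (count_space A) f"
    using assms(2) by (intro integrableI_bounded) auto
  have "ennreal \<bar>LINT x|count_space A. f x\<bar> \<le> (\<integral>\<^sup>+x. ennreal (norm (f x)) \<partial>count_space A)"
    using integral_norm_bound_ennreal[OF int] by simp
  with le show "ennreal \<bar>LINT x|count_space A. f x\<bar> \<le> (\<integral>\<^sup>+x. g x \<partial>count_space A)" by simp
qed

section \<open>Geometry of clusters and tempered configurations\<close>

lemma site_norm_ge_1:
  assumes "k \<noteq> l"
  shows "1 \<le> site_norm (k - l)"
proof -
  obtain i where "k $ i \<noteq> l $ i" using assms by (auto simp: vec_eq_iff)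
  then have "1 \<le> \<bar>real_of_int ((k - l) $ i)\<bar>" by simp
  also have "\<dots> \<le> site_norm (k - l)"
    unfolding site_norm_def using component_le_norm_cart[of "\<chi> i. real_of_int ((k - l) $ i)" i] by simp
  finally show ?thesis .
qed

lemma site_norm_nonneg: "0 \<le> site_norm k"
  by (simp add: site_norm_def)

lemma site_norm_triangle: "site_norm l \<le> site_norm k + site_norm (k - l)"
proof -
  have "(\<chi> i. real_of_int (l $ i)) = (\<chi> i. real_of_int (k $ i)) - (\<chi> i. real_of_int ((k - l) $ i))"
    by (simp add: vec_eq_iff)
  then show ?thesis unfolding site_norm_def by (metis norm_triangle_ineq4)
qed

text \<open>Distinct sites are at distance at least 1, so the size of a cluster costs at most one
  power of its spread. This accounts for the exponent \<open>q + 1\<close> in the energy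
  bounds.\<close>

lemma card_le_spread:
  assumes "finite S" "k \<in> S"
  shows "real (card S) \<le> 1 + (\<Sum>l\<in>S. site_norm (k - l))"
proof -
  have "real (card (S - {k})) = (\<Sum>l\<in>S - {k}. 1)" by simp
  also have "\<dots> \<le> (\<Sum>l\<in>S - {k}. site_norm (k - l))" by (intro sum_mono site_norm_ge_1) auto
  also have "\<dots> \<le> (\<Sum>l\<in>S. site_norm (k - l))"
    using assms by (intro sum_mono2) (auto simp: site_norm_nonneg)
  finally show ?thesis using assms by (simp add: card_Diff_singleton card_gt_0_iff)
qed

lemma powr_sum_le:
  fixes q :: "'a \<Rightarrow> real"
  assumes "finite S" "r > 0"
  shows "(1 + (\<Sum>j\<in>S. \<bar>q j\<bar>)) powr r \<le> (1 + real (card S)) powr r * (1 + (\<Sum>j\<in>S. \<bar>q j\<bar> powr r))"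
proof -
  \<comment> \<open>\<open>T\<close> is the l^r-norm of \<open>q\<close> with an extra entry 1, so
    it dominates 1 and every \<open>\<bar>q j\<bar>\<close>.\<close>
  define T where "T = (1 + (\<Sum>j\<in>S. \<bar>q j\<bar> powr r)) powr (1 / r)"
  have nn: "0 \<le> (\<Sum>j\<in>S. \<bar>q j\<bar> powr r)" by (intro sum_nonneg) simp
  have T1: "1 \<le> T" unfolding T_def using nn assms by (intro ge_one_powr_ge_zero) auto
  have "\<bar>q j\<bar> \<le> T" if "j \<in> S" for j
  proof -
    have "\<bar>q j\<bar> powr r \<le> 1 + (\<Sum>j\<in>S. \<bar>q j\<bar> powr r)"
      using member_le_sum[of j S "\<lambda>j. \<bar>q j\<bar> powr r"] that assms by simp
    then have "(\<bar>q j\<bar> powr r) powr (1 / r) \<le> T" unfolding T_def using assms by (intro powr_mono2) auto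
    then show ?thesis using assms by (simp add: powr_powr)
  qed
  then have "(\<Sum>j\<in>S. \<bar>q j\<bar>) \<le> real (card S) * T" using sum_bounded_above[of S "\<lambda>j. \<bar>q j\<bar>" T] by simp
  then have "1 + (\<Sum>j\<in>S. \<bar>q j\<bar>) \<le> (1 + real (card S)) * T" using T1 by (simp add: distrib_right)
  then have "(1 + (\<Sum>j\<in>S. \<bar>q j\<bar>)) powr r \<le> ((1 + real (card S)) * T) powr r"
    using assms by (intro powr_mono2 add_nonneg_nonneg sum_nonneg) auto
  also have "\<dots> = (1 + real (card S)) powr r * (1 + (\<Sum>j\<in>S. \<bar>q j\<bar> powr r))"
    using T1 nn assms by (subst powr_mult) (auto simp: T_def powr_powr)
  finally show ?thesis .
qed

lemma continuous_powr_abs: "continuous_on A (\<lambda>\<tau>. \<bar>apply_bcontfun (z :: loop) \<tau>\<bar> powr R)" if "R > 0"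
  by (rule continuous_on_powr') (use that in \<open>auto intro!: continuous_intros\<close>)

lemma Omega_t_change:
  fixes \<omega> \<omega>' :: "'d::finite config"
  assumes \<omega>: "\<omega> \<in> Omega_t \<beta> R" and \<omega>': "\<omega>' \<in> Omega \<beta>" and fin: "finite {k. \<omega> k \<noteq> \<omega>' k}"
  shows "\<omega>' \<in> Omega_t \<beta> R"
proof -
  obtain p where p: "real CARD('d) < p" "\<omega> \<in> Omega_p \<beta> R p" using \<omega> by (auto simp: Omega_t_def)
  define g where "g = (\<lambda>(\<omega>::'d config) k. ennreal ((1 + site_norm k) powr (- p) * (Lr_norm \<beta> R (apply_bcontfun (\<omega> k)))\<^sup>2))"
  have eq: "temp_norm_sq \<beta> R p \<omega> = (\<integral>\<^sup>+k. g \<omega> k \<partial>count_space UNIV)" for \<omega>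
    unfolding temp_norm_sq_def g_def by (rule infsum_eq_nn_integral_count_space) simp
  define F where "F = {k. \<omega> k \<noteq> \<omega>' k}"
  have "temp_norm_sq \<beta> R p \<omega>' \<le> (\<integral>\<^sup>+k. g \<omega> k + g \<omega>' k * indicator F k \<partial>count_space UNIV)"
    unfolding eq by (rule nn_integral_mono) (auto simp: F_def g_def indicator_def)
  also have "\<dots> = temp_norm_sq \<beta> R p \<omega> + (\<integral>\<^sup>+k. g \<omega>' k * indicator F k \<partial>count_space UNIV)"
    unfolding eq by (rule nn_integral_add) auto
  also have "(\<integral>\<^sup>+k. g \<omega>' k * indicator F k \<partial>count_space UNIV) = (\<Sum>k\<in>F. g \<omega>' k)"
    using fin by (subst nn_integral_count_space'[of F]) (auto simp: F_def[symmetric] indicator_def)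
  also have "temp_norm_sq \<beta> R p \<omega> + (\<Sum>k\<in>F. g \<omega>' k) < \<infinity>"
    using p(2) by (auto simp: Omega_p_def g_def)
  finally show ?thesis using p(1) \<omega>' by (auto simp: Omega_t_def Omega_p_def)
qed

lemma Omega_t_subset: "Omega_t \<beta> R \<subseteq> Omega \<beta>"
  by (auto simp: Omega_t_def Omega_p_def)

lemma measurable_integral_count_space:
  fixes f :: "'a \<Rightarrow> 'b \<Rightarrow> real"
  assumes "countable A" "\<And>x. x \<in> A \<Longrightarrow> f x \<in> borel_measurable M"
  shows "(\<lambda>\<omega>. LINT x|count_space A. f x \<omega>) \<in> borel_measurable M"
proof -
  interpret sigma_finite_measure "count_space A" by (rule sigma_finite_measure_count_space_countable) fact
  have "(\<lambda>(x, \<omega>). f x \<omega>) \<in> borel_measurable (count_space A \<Otimes>\<^sub>M M)"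
    by (rule measurable_pair_measure_countable1) (use assms in auto)
  then have "(\<lambda>(\<omega>, x). f x \<omega>) \<in> borel_measurable (M \<Otimes>\<^sub>M count_space A)"
    by (subst measurable_pair_swap_iff) (simp add: case_prod_beta)
  then show ?thesis by (rule borel_measurable_lebesgue_integral)
qed

lemma measurable_nn_integral_count_space:
  fixes f :: "'a \<Rightarrow> 'b \<Rightarrow> ennreal"
  assumes "countable A" "\<And>x. x \<in> A \<Longrightarrow> f x \<in> borel_measurable M"
  shows "(\<lambda>\<omega>. \<integral>\<^sup>+x. f x \<omega> \<partial>count_space A) \<in> borel_measurable M"
proof -
  interpret sigma_finite_measure "count_space A" by (rule sigma_finite_measure_count_space_countable) fact
  have "(\<lambda>(x, \<omega>). f x \<omega>) \<in> borel_measurable (count_space A \<Otimes>\<^sub>M M)"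
    by (rule measurable_pair_measure_countable1) (use assms in auto)
  then have "(\<lambda>(\<omega>, x). f x \<omega>) \<in> borel_measurable (M \<Otimes>\<^sub>M count_space A)"
    by (subst measurable_pair_swap_iff) (simp add: case_prod_beta)
  then show ?thesis by (rule borel_measurable_nn_integral)
qed

section \<open>Absolute convergence of the interaction energy\<close>

locale lattice_model = gaussian_loops \<beta> m a \<gamma> for \<beta> m a :: real and \<gamma> :: "loop measure" +
  fixes R :: real and N :: enat
    and W :: "'d::finite site set \<Rightarrow> ('d site \<Rightarrow> real) \<Rightarrow> real" and J :: "'d site set \<Rightarrow> real"
    and V :: "'d site \<Rightarrow> real \<Rightarrow> real"
  assumes R2: "R \<ge> 2" and cond_W: "cond_W R N W J" and cond_J: "cond_J R N J"
    and continuous_V: "\<And>k. continuous_on UNIV (V k)"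
begin

abbreviation clusters :: "'d site set \<Rightarrow> nat \<Rightarrow> 'd site set set" where
  "clusters \<Lambda> M \<equiv> {S \<in> point_sets M. S \<inter> \<Lambda> \<noteq> {}}"

lemma R_pos: "R > 0" using R2 by simp

text \<open>The growth bound of (W) integrated over the circle. Unlike the energy it is monotone in
  the moduli of the loops, which allows comparison with constant loops.\<close>

definition bnd :: "'d site set \<Rightarrow> 'd config \<Rightarrow> real" where
  "bnd S \<omega> = J S * circle_int \<beta> (\<lambda>\<tau>. (1 + (\<Sum>j\<in>S. \<bar>apply_bcontfun (\<omega> j) \<tau>\<bar>)) powr R)"

text \<open>Values in \<open>ennreal\<close> make this meaningful and measurable for all
  configurations; temperedness is used to show that it is finite.\<close>

definition Eabs :: "'d site set \<Rightarrow> 'd config \<Rightarrow> ennreal" where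
  "Eabs \<Lambda> \<omega> = (\<integral>\<^sup>+M. \<integral>\<^sup>+S. ennreal (bnd S \<omega>) \<partial>count_space (clusters \<Lambda> M) \<partial>count_space (orders N))"

definition energy :: "'d site set \<Rightarrow> 'd config \<Rightarrow> real" where
  "energy S \<omega> = circle_int \<beta> (\<lambda>\<tau>. W S (\<lambda>l. apply_bcontfun (\<omega> l) \<tau>))"

lemma W_energy_eq:
  "W_energy \<beta> N W \<Lambda> \<omega> \<omega> = (LINT M|count_space (orders N). LINT S|count_space (clusters \<Lambda> M). energy S \<omega>)"
  unfolding W_energy_def energy_def by (simp add: infsum_eq_integral_count_space)

context
  fixes S :: "'d site set" and M :: nat
  assumes M: "M \<in> orders N" and S: "S \<in> point_sets M"
begin

lemma J_nonneg: "0 \<le> J S"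
  and W_bound: "\<bar>W S q\<bar> \<le> J S * (1 + (\<Sum>j\<in>S. \<bar>q j\<bar>)) powr R"
  and continuous_W: "continuous_on UNIV (W S)"
  using cond_W M S by (auto simp: cond_W_def C2_in_def)

lemma finite_S: "finite S" and card_S: "card S = M"
  using S by (auto simp: point_sets_def)

lemma continuous_W_loop: "continuous_on A (\<lambda>\<tau>. W S (\<lambda>l. apply_bcontfun (\<omega> l) \<tau>))"
  by (rule continuous_on_compose2[OF continuous_W]) (auto intro!: continuous_on_coordinatewise_then_product)

lemma continuous_bnd: "continuous_on A (\<lambda>\<tau>. (1 + (\<Sum>j\<in>S. \<bar>apply_bcontfun (\<omega> j :: loop) \<tau>\<bar>)) powr R)"
proof -
  have "0 < 1 + (\<Sum>j\<in>S. \<bar>apply_bcontfun (\<omega> j) \<tau>\<bar>)" for \<tau>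
    by (intro add_pos_nonneg sum_nonneg) auto
  then show ?thesis by (intro continuous_intros) (auto simp: less_imp_neq[symmetric])
qed

lemma energy_le_bnd: "\<bar>energy S \<omega>\<bar> \<le> bnd S \<omega>"
  unfolding energy_def bnd_def circle_int_cmult[symmetric]
  by (rule circle_int_abs_le) (intro continuous_W_loop continuous_intros continuous_bnd W_bound)+

lemma bnd_mono:
  assumes "\<And>j \<tau>. j \<in> S \<Longrightarrow> \<bar>apply_bcontfun (\<omega> j) \<tau>\<bar> \<le> \<bar>apply_bcontfun (\<omega>' j) \<tau>\<bar>"
  shows "bnd S \<omega> \<le> bnd S \<omega>'"
  unfolding bnd_def using R_pos assms
  by (intro mult_left_mono circle_int_mono continuous_bnd J_nonneg powr_mono2 add_left_mono sum_mono add_nonneg_nonneg sum_nonneg) auto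

lemma measurable_energy: "energy S \<in> borel_measurable \<Omega>"
  unfolding energy_def
proof (rule measurable_circle_int)
  have "(\<lambda>p. \<lambda>l. apply_bcontfun ((fst p :: 'd config) l) (snd p)) \<in> borel_measurable (\<Omega> \<Otimes>\<^sub>M lborel)"
    by (rule measurable_coordinatewise_then_product, rule measurable_eval_pair) measurable
  then have "(\<lambda>p. W S (\<lambda>l. apply_bcontfun ((fst p :: 'd config) l) (snd p))) \<in> borel_measurable (\<Omega> \<Otimes>\<^sub>M lborel)"
    by (rule measurable_compose) (rule borel_measurable_continuous_onI[OF continuous_W])
  then show "(\<lambda>(\<omega>, \<tau>). W S (\<lambda>l. apply_bcontfun (\<omega> l) \<tau>)) \<in> borel_measurable (\<Omega> \<Otimes>\<^sub>M lborel)"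
    by (simp add: case_prod_beta)
qed

lemma measurable_bnd: "bnd S \<in> borel_measurable \<Omega>"
  unfolding bnd_def
proof (intro borel_measurable_times borel_measurable_const measurable_circle_int)
  have [measurable]: "(\<lambda>p. apply_bcontfun ((fst p :: 'd config) l) (snd p)) \<in> borel_measurable (\<Omega> \<Otimes>\<^sub>M lborel)" for l
    by (rule measurable_eval_pair) measurable
  show "(\<lambda>(\<omega>, \<tau>). (1 + (\<Sum>j\<in>S. \<bar>apply_bcontfun ((\<omega> :: 'd config) j) \<tau>\<bar>)) powr R) \<in> borel_measurable (\<Omega> \<Otimes>\<^sub>M lborel)"
    unfolding case_prod_beta by measurable
qed

end

text \<open>Temperedness bounds the loop at a site polynomially in the distance to the origin. Seen
  from a site \<open>k\<close> of the cluster this becomes a power of the spread, which a norm of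
  \<open>J\<close> with a sufficiently large exponent absorbs.\<close>

lemma bnd_tempered:
  assumes \<omega>: "\<omega> \<in> Omega_t \<beta> R"
  obtains C q where "q \<ge> 0" "C \<ge> 0" "\<And>M S. M \<in> orders N \<Longrightarrow> S \<in> point_sets M \<Longrightarrow> k \<in> S \<Longrightarrow>
    bnd S \<omega> \<le> C * (real M powr R * (J S * (1 + (\<Sum>l\<in>S. site_norm (k - l))) powr (q + 1)))"
proof -
  obtain p where p: "real CARD('d) < p" "\<omega> \<in> Omega_p \<beta> R p" using \<omega> by (auto simp: Omega_t_def)
  define n where "n = (\<lambda>j. circle_int \<beta> (\<lambda>\<tau>. \<bar>apply_bcontfun (\<omega> j) \<tau>\<bar> powr R))"
  have n0: "0 \<le> n j" for j
    unfolding n_def circle_int_def set_lebesgue_integral_def by (rule integral_nonneg_AE) (auto simp: indicator_def)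
  \<comment> \<open>The tempered norm weighs \<open>n j powr (2 / R)\<close> by the power
    \<open>- p\<close>; raising to \<open>R / 2\<close> gives this growth exponent.\<close>
  define q where "q = p * R / 2"
  have q: "q \<ge> 0" using p(1) R_pos by (simp add: q_def)
  obtain K where K: "K \<ge> 0" "temp_norm_sq \<beta> R p \<omega> = ennreal K"
    using p(2) by (cases "temp_norm_sq \<beta> R p \<omega>") (auto simp: Omega_p_def)
  have n_le: "n j \<le> K powr (R / 2) * (1 + site_norm j) powr q" for j
  proof -
    have pos: "0 < 1 + site_norm j" using site_norm_nonneg[of j] by simp
    have "ennreal ((1 + site_norm j) powr (- p) * (Lr_norm \<beta> R (apply_bcontfun (\<omega> j)))\<^sup>2) \<le> temp_norm_sq \<beta> R p \<omega>"
    proof -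
      have "temp_norm_sq \<beta> R p \<omega> = (\<integral>\<^sup>+k. ennreal ((1 + site_norm k) powr (- p) * (Lr_norm \<beta> R (apply_bcontfun (\<omega> k)))\<^sup>2) \<partial>count_space UNIV)"
        unfolding temp_norm_sq_def by (rule infsum_eq_nn_integral_count_space) simp
      then show ?thesis using nn_integral_ge_point[of j UNIV "\<lambda>k. ennreal ((1 + site_norm k) powr (- p) * (Lr_norm \<beta> R (apply_bcontfun (\<omega> k)))\<^sup>2)"]
        by simp
    qed
    then have "(1 + site_norm j) powr (- p) * (Lr_norm \<beta> R (apply_bcontfun (\<omega> j)))\<^sup>2 \<le> K"
      unfolding K(2) by (simp add: ennreal_le_iff K(1))
    moreover have "(Lr_norm \<beta> R (apply_bcontfun (\<omega> j)))\<^sup>2 = n j powr (2 / R)"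
      by (simp add: Lr_norm_def n_def power2_eq_square powr_add[symmetric])
    ultimately have "n j powr (2 / R) \<le> K * (1 + site_norm j) powr p"
      using pos by (simp add: powr_minus field_simps)
    then have "(n j powr (2 / R)) powr (R / 2) \<le> (K * (1 + site_norm j) powr p) powr (R / 2)"
      using R_pos by (intro powr_mono2) auto
    then show ?thesis using R_pos n0[of j] K(1) by (simp add: powr_powr powr_mult q_def)
  qed
  \<comment> \<open>\<open>2 powr R\<close> comes from \<open>1 + M \<le> 2 * M\<close>,
    \<open>\<beta>\<close> from the summand 1 in the growth bound, \<open>K powr (R / 2)\<close>
    from the tempered norm, and the last factor from moving the origin to \<open>k\<close>.\<close>
  define C where "C = 2 powr R * (\<beta> + K powr (R / 2)) * (1 + site_norm k) powr q"
  have C: "C \<ge> 0" using beta_pos by (simp add: C_def)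
  have "bnd S \<omega> \<le> C * (real M powr R * (J S * (1 + (\<Sum>l\<in>S. site_norm (k - l))) powr (q + 1)))"
    if M: "M \<in> orders N" and S: "S \<in> point_sets M" and k: "k \<in> S" for M S
  proof -
    note fS = finite_S[OF M S] and cS = card_S[OF M S]
    define D where "D = 1 + (\<Sum>l\<in>S. site_norm (k - l))"
    have D1: "1 \<le> D" unfolding D_def by (simp add: sum_nonneg site_norm_nonneg)
    have MD: "real M \<le> D" using card_le_spread[OF fS k] cS by (simp add: D_def)
    have M1: "1 \<le> real M" using M by (simp add: orders_def)
    have k1: "1 \<le> 1 + site_norm k" using site_norm_nonneg[of k] by simp
    have nj: "n j \<le> K powr (R / 2) * ((1 + site_norm k) powr q * D powr q)" if "j \<in> S" for j
    proof -
      have "site_norm (k - j) \<le> (\<Sum>l\<in>S. site_norm (k - l))"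
        using member_le_sum[of j S "\<lambda>l. site_norm (k - l)"] that fS site_norm_nonneg by auto
      then have "1 + site_norm j \<le> site_norm k + D" using site_norm_triangle[of j k] by (simp add: D_def)
      also have "\<dots> \<le> (1 + site_norm k) * D"
        using mult_left_mono[OF D1 site_norm_nonneg[of k]] by (simp add: algebra_simps)
      finally have "(1 + site_norm j) powr q \<le> ((1 + site_norm k) * D) powr q"
        using q site_norm_nonneg[of j] by (intro powr_mono2) auto
      also have "\<dots> = (1 + site_norm k) powr q * D powr q" by (rule powr_mult)
      finally show ?thesis using n_le[of j] by (meson mult_left_mono order_trans powr_ge_zero)
    qed
    have "circle_int \<beta> (\<lambda>\<tau>. (1 + (\<Sum>j\<in>S. \<bar>apply_bcontfun (\<omega> j) \<tau>\<bar>)) powr R)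
       \<le> circle_int \<beta> (\<lambda>\<tau>. (1 + real M) powr R * (1 + (\<Sum>j\<in>S. \<bar>apply_bcontfun (\<omega> j) \<tau>\<bar> powr R)))"
      using powr_sum_le[OF fS R_pos] unfolding cS
      by (intro circle_int_mono continuous_bnd[OF M S] continuous_intros continuous_powr_abs[OF R_pos])
    also have "\<dots> = (1 + real M) powr R * (\<beta> + (\<Sum>j\<in>S. n j))"
    proof -
      have "circle_int \<beta> (\<lambda>\<tau>. 1 + (\<Sum>j\<in>S. \<bar>apply_bcontfun (\<omega> j) \<tau>\<bar> powr R)) = \<beta> * 1 + (\<Sum>j\<in>S. n j)"
      proof -
        have "circle_int \<beta> (\<lambda>\<tau>. 1 + (\<Sum>j\<in>S. \<bar>apply_bcontfun (\<omega> j) \<tau>\<bar> powr R))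
           = circle_int \<beta> (\<lambda>\<tau>. 1) + circle_int \<beta> (\<lambda>\<tau>. \<Sum>j\<in>S. \<bar>apply_bcontfun (\<omega> j) \<tau>\<bar> powr R)"
          by (intro circle_int_add continuous_on_const continuous_on_sum continuous_powr_abs[OF R_pos])
        also have "circle_int \<beta> (\<lambda>\<tau>. \<Sum>j\<in>S. \<bar>apply_bcontfun (\<omega> j) \<tau>\<bar> powr R) = (\<Sum>j\<in>S. n j)"
          unfolding n_def by (intro circle_int_sum continuous_powr_abs[OF R_pos])
        finally show ?thesis by (simp only: circle_int_const[OF beta_pos])
      qed
      then show ?thesis by (simp add: circle_int_cmult)
    qed
    also have "\<dots> \<le> (2 powr R * real M powr R) * ((\<beta> + K powr (R / 2)) * ((1 + site_norm k) powr q * D powr (q + 1)))"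
    proof (rule mult_mono)
      have "(1 + real M) powr R \<le> (2 * real M) powr R" using M1 R_pos by (intro powr_mono2) auto
      then show "(1 + real M) powr R \<le> 2 powr R * real M powr R" by (simp add: powr_mult)
      define X where "X = (1 + site_norm k) powr q * D powr q"
      have X1: "1 \<le> X"
        unfolding X_def using k1 D1 q mult_mono[of 1 "(1 + site_norm k) powr q" 1 "D powr q"] by (simp add: ge_one_powr_ge_zero)
      have "(\<Sum>j\<in>S. n j) \<le> real M * (K powr (R / 2) * X)"
        using sum_bounded_above[of S n "K powr (R / 2) * X"] nj cS by (simp add: X_def)
      also have "\<dots> \<le> D * (K powr (R / 2) * X)" using MD X1 by (intro mult_right_mono) auto
      finally have "(\<Sum>j\<in>S. n j) \<le> K powr (R / 2) * (X * D)" by (simp add: mult_ac)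
      moreover have "\<beta> * 1 \<le> \<beta> * (X * D)"
        using mult_mono[of 1 X 1 D] X1 D1 beta_pos by (intro mult_left_mono) auto
      ultimately have "\<beta> + (\<Sum>j\<in>S. n j) \<le> (\<beta> + K powr (R / 2)) * (X * D)" by (simp add: distrib_right)
      also have "X * D = (1 + site_norm k) powr q * D powr (q + 1)" using D1 by (simp add: X_def powr_add)
      finally show "\<beta> + (\<Sum>j\<in>S. n j) \<le> (\<beta> + K powr (R / 2)) * ((1 + site_norm k) powr q * D powr (q + 1))" .
      show "0 \<le> \<beta> + (\<Sum>j\<in>S. n j)" using beta_pos n0 by (intro add_nonneg_nonneg sum_nonneg) auto
    qed simp
    also have "\<dots> = C * (real M powr R * D powr (q + 1))" by (simp add: C_def mult_ac)
    finally have "bnd S \<omega> \<le> J S * (C * (real M powr R * D powr (q + 1)))"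
      unfolding bnd_def by (rule mult_left_mono) (rule J_nonneg[OF M S])
    then show ?thesis by (simp add: D_def mult_ac)
  qed
  with q C that show ?thesis by blast
qed

text \<open>A cluster that meets \<open>\<Lambda>\<close> contains one of finitely many sites, and
  the clusters through one site are summed by the norm of \<open>J\<close>, whose factor
  \<open>M powr R\<close> matches the one from the growth bound.\<close>

lemma Eabs_finite:
  assumes \<omega>: "\<omega> \<in> Omega_t \<beta> R" and \<Lambda>: "finite \<Lambda>"
  shows "Eabs \<Lambda> \<omega> < \<infinity>"
proof -
  have one: "(\<integral>\<^sup>+M. \<integral>\<^sup>+S. ennreal (bnd S \<omega>) \<partial>count_space {S \<in> point_sets M. k \<in> S} \<partial>count_space (orders N)) < \<infinity>" for k
  proof -
    obtain C q where q: "q \<ge> 0" and C: "C \<ge> 0" and le: "\<And>M S. M \<in> orders N \<Longrightarrow> S \<in> point_sets M \<Longrightarrow> k \<in> S \<Longrightarrow>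
      bnd S \<omega> \<le> C * (real M powr R * (J S * (1 + (\<Sum>l\<in>S. site_norm (k - l))) powr (q + 1)))"
      by (rule bnd_tempered[OF \<omega>, of k]) (rule that)
    define Q where "Q = (\<lambda>k S. ennreal (J S * (1 + (\<Sum>l\<in>S. site_norm (k - l))) powr (q + 1)))"
    have Jn: "J_norm R N J (q + 1) = (\<integral>\<^sup>+M. ennreal (real M powr R) * (SUP k. \<integral>\<^sup>+S. Q k S \<partial>count_space {S \<in> point_sets M. k \<in> S}) \<partial>count_space (orders N))"
      unfolding J_norm_def Q_def by (simp add: infsum_eq_nn_integral_count_space countable_point_sets)
    have "(\<integral>\<^sup>+M. \<integral>\<^sup>+S. ennreal (bnd S \<omega>) \<partial>count_space {S \<in> point_sets M. k \<in> S} \<partial>count_space (orders N))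
       \<le> (\<integral>\<^sup>+M. \<integral>\<^sup>+S. (ennreal C * ennreal (real M powr R)) * Q k S \<partial>count_space {S \<in> point_sets M. k \<in> S} \<partial>count_space (orders N))"
    proof (intro nn_integral_mono)
      fix M S assume "M \<in> space (count_space (orders N))" "S \<in> space (count_space {S \<in> point_sets M. k \<in> S})"
      then have "bnd S \<omega> \<le> C * real M powr R * (J S * (1 + (\<Sum>l\<in>S. site_norm (k - l))) powr (q + 1))" "0 \<le> J S"
        using le[of M S] J_nonneg[of M S] by (auto simp: mult.assoc)
      then show "ennreal (bnd S \<omega>) \<le> (ennreal C * ennreal (real M powr R)) * Q k S"
        using C unfolding Q_def by (simp add: ennreal_mult[symmetric] ennreal_leI)
    qed
    also have "\<dots> = (\<integral>\<^sup>+M. ennreal C * (ennreal (real M powr R) * (\<integral>\<^sup>+S. Q k S \<partial>count_space {S \<in> point_sets M. k \<in> S})) \<partial>count_space (orders N))"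
      by (simp add: nn_integral_cmult mult.assoc)
    also have "\<dots> \<le> (\<integral>\<^sup>+M. ennreal C * (ennreal (real M powr R) * (SUP k. \<integral>\<^sup>+S. Q k S \<partial>count_space {S \<in> point_sets M. k \<in> S})) \<partial>count_space (orders N))"
      by (intro nn_integral_mono mult_left_mono SUP_upper) auto
    also have "\<dots> = ennreal C * J_norm R N J (q + 1)" unfolding Jn by (subst nn_integral_cmult) auto
    also have "\<dots> < \<infinity>"
      using cond_J q unfolding cond_J_def by (auto simp: ennreal_mult_less_top)
    finally show ?thesis .
  qed
  have "Eabs \<Lambda> \<omega> \<le> (\<integral>\<^sup>+M. (\<Sum>k\<in>\<Lambda>. \<integral>\<^sup>+S. ennreal (bnd S \<omega>) \<partial>count_space {S \<in> point_sets M. k \<in> S}) \<partial>count_space (orders N))"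
    unfolding Eabs_def
  proof (intro nn_integral_mono)
    fix M
    have "(\<integral>\<^sup>+S. ennreal (bnd S \<omega>) \<partial>count_space (clusters \<Lambda> M)) = (\<integral>\<^sup>+S. ennreal (bnd S \<omega>) * indicator (clusters \<Lambda> M) S \<partial>count_space UNIV)"
      by (rule nn_integral_count_space_indicator) simp
    also have "\<dots> \<le> (\<integral>\<^sup>+S. (\<Sum>k\<in>\<Lambda>. ennreal (bnd S \<omega>) * indicator {S \<in> point_sets M. k \<in> S} S) \<partial>count_space UNIV)"
    proof (rule nn_integral_mono)
      fix S :: "'d site set"
      show "ennreal (bnd S \<omega>) * indicator (clusters \<Lambda> M) S \<le> (\<Sum>k\<in>\<Lambda>. ennreal (bnd S \<omega>) * indicator {S \<in> point_sets M. k \<in> S} S)"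
      proof (cases "S \<in> clusters \<Lambda> M")
        case True
        then obtain k where k: "k \<in> \<Lambda>" "k \<in> S" "S \<in> point_sets M" by auto
        have "ennreal (bnd S \<omega>) * indicator {S \<in> point_sets M. k \<in> S} S \<le> (\<Sum>k\<in>\<Lambda>. ennreal (bnd S \<omega>) * indicator {S \<in> point_sets M. k \<in> S} S)"
          by (rule member_le_sum) (use k \<Lambda> in auto)
        then show ?thesis using k True by simp
      qed simp
    qed
    also have "\<dots> = (\<Sum>k\<in>\<Lambda>. \<integral>\<^sup>+S. ennreal (bnd S \<omega>) * indicator {S \<in> point_sets M. k \<in> S} S \<partial>count_space UNIV)"
      by (rule nn_integral_sum) simp
    also have "\<dots> = (\<Sum>k\<in>\<Lambda>. \<integral>\<^sup>+S. ennreal (bnd S \<omega>) \<partial>count_space {S \<in> point_sets M. k \<in> S})"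
      by (intro sum.cong refl nn_integral_count_space_indicator[symmetric]) simp
    finally show "(\<integral>\<^sup>+S. ennreal (bnd S \<omega>) \<partial>count_space (clusters \<Lambda> M)) \<le> (\<Sum>k\<in>\<Lambda>. \<integral>\<^sup>+S. ennreal (bnd S \<omega>) \<partial>count_space {S \<in> point_sets M. k \<in> S})" .
  qed
  also have "\<dots> = (\<Sum>k\<in>\<Lambda>. \<integral>\<^sup>+M. \<integral>\<^sup>+S. ennreal (bnd S \<omega>) \<partial>count_space {S \<in> point_sets M. k \<in> S} \<partial>count_space (orders N))"
    by (rule nn_integral_sum) simp
  also have "\<dots> < \<infinity>" using \<Lambda> one by (induction \<Lambda> rule: finite_induct) auto
  finally show ?thesis .
qed

text \<open>\<open>infsum\<close> yields 0 for divergent series. These facts exclude that default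
  when \<open>Eabs\<close> is finite, so energies may be subtracted term by term.\<close>

lemma energy_integrable:
  assumes "Eabs \<Lambda> \<omega> < \<infinity>"
  shows "M \<in> orders N \<Longrightarrow> integrable (count_space (clusters \<Lambda> M)) (\<lambda>S. energy S \<omega>)"
    and "integrable (count_space (orders N)) (\<lambda>M. LINT S|count_space (clusters \<Lambda> M). energy S \<omega>)"
    and "ennreal \<bar>W_energy \<beta> N W \<Lambda> \<omega> \<omega>\<bar> \<le> Eabs \<Lambda> \<omega>"
proof -
  define g where "g = (\<lambda>M. \<integral>\<^sup>+S. ennreal (bnd S \<omega>) \<partial>count_space (clusters \<Lambda> M))"
  have E: "Eabs \<Lambda> \<omega> = (\<integral>\<^sup>+M. g M \<partial>count_space (orders N))" by (simp add: Eabs_def g_def)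
  have g: "g M < \<infinity>" if "M \<in> orders N" for M
  proof -
    have "g M \<le> Eabs \<Lambda> \<omega>" unfolding E using that by (rule nn_integral_ge_point)
    then show ?thesis using assms by (rule le_less_trans)
  qed
  have dom: "ennreal \<bar>energy S \<omega>\<bar> \<le> ennreal (bnd S \<omega>)" if "M \<in> orders N" "S \<in> clusters \<Lambda> M" for S M
    using energy_le_bnd[of M S \<omega>] that by (auto intro!: ennreal_leI)
  show "integrable (count_space (clusters \<Lambda> M)) (\<lambda>S. energy S \<omega>)" if M: "M \<in> orders N" for M
    by (rule integral_count_space_dominated(1)[OF dom[OF M]]) (use g[OF M] in \<open>auto simp: g_def\<close>)
  have dom2: "ennreal \<bar>LINT S|count_space (clusters \<Lambda> M). energy S \<omega>\<bar> \<le> g M" if M: "M \<in> orders N" for M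
    unfolding g_def
    by (rule integral_count_space_dominated(2)[OF dom[OF M]]) (use g[OF M] in \<open>auto simp: g_def\<close>)
  show "integrable (count_space (orders N)) (\<lambda>M. LINT S|count_space (clusters \<Lambda> M). energy S \<omega>)"
    by (rule integral_count_space_dominated(1)[OF dom2]) (use assms E in auto)
  show "ennreal \<bar>W_energy \<beta> N W \<Lambda> \<omega> \<omega>\<bar> \<le> Eabs \<Lambda> \<omega>"
    unfolding W_energy_eq E by (rule integral_count_space_dominated(2)[OF dom2]) (use assms E in auto)
qed

lemma move_tempered: "\<omega> \<in> Omega_t \<beta> R \<Longrightarrow> move i t \<omega> \<in> Omega_t \<beta> R"
proof (rule Omega_t_change)
  assume "\<omega> \<in> Omega_t \<beta> R"
  then show "move i t \<omega> \<in> Omega \<beta>" using Omega_t_subset by (intro move_in_Omega) blast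
  show "finite {k. \<omega> k \<noteq> move i t \<omega> k}"
    by (rule finite_subset[of _ "{fst i}"]) (auto simp: move_apply)
qed

text \<open>Clusters that meet \<open>\<Lambda>\<close> but avoid \<open>k\<close> do not see the
  shift and cancel; absolute convergence permits the subtraction. Hence one density serves every
  volume containing \<open>k\<close>.\<close>

lemma W_relative_energy_eq:
  assumes \<omega>: "\<omega> \<in> Omega_t \<beta> R" and \<Lambda>: "finite \<Lambda>" "k \<in> \<Lambda>"
  shows "W_relative_energy \<beta> N W \<omega> \<theta> k n
    = W_energy \<beta> N W \<Lambda> (move (k, n) \<theta> \<omega>) (move (k, n) \<theta> \<omega>) - W_energy \<beta> N W \<Lambda> \<omega> \<omega>"
proof -
  let ?\<omega>' = "move (k, n) \<theta> \<omega>"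
  have fin: "Eabs \<Lambda> \<omega> < \<infinity>" "Eabs \<Lambda> ?\<omega>' < \<infinity>"
    by (rule Eabs_finite[OF \<omega> \<Lambda>(1)], rule Eabs_finite[OF move_tempered[OF \<omega>] \<Lambda>(1)])
  have "W_relative_energy \<beta> N W \<omega> \<theta> k n = (\<Sum>\<^sub>\<infinity>M\<in>orders N. \<Sum>\<^sub>\<infinity>S\<in>{S \<in> point_sets M. k \<in> S}. energy S ?\<omega>' - energy S \<omega>)"
    unfolding W_relative_energy_def
  proof (intro infsum_cong)
    fix M S assume "M \<in> orders N" "S \<in> {S \<in> point_sets M. k \<in> S}"
    then show "circle_int \<beta> (\<lambda>\<tau>. W S (\<lambda>l. apply_bcontfun (shift \<theta> (h_dir \<beta> k n) \<omega> l) \<tau>) - W S (\<lambda>l. apply_bcontfun (\<omega> l) \<tau>))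
       = energy S ?\<omega>' - energy S \<omega>"
      unfolding energy_def move_def fst_conv snd_conv by (intro circle_int_diff continuous_W_loop) auto
  qed
  also have "\<dots> = (\<Sum>\<^sub>\<infinity>M\<in>orders N. \<Sum>\<^sub>\<infinity>S\<in>clusters \<Lambda> M. energy S ?\<omega>' - energy S \<omega>)"
  proof (intro infsum_cong infsum_cong_neutral)
    fix M S assume M: "M \<in> orders N" and S: "S \<in> clusters \<Lambda> M - {S \<in> point_sets M. k \<in> S}"
    have "W S (\<lambda>l. apply_bcontfun (?\<omega>' l) \<tau>) = W S (\<lambda>l. apply_bcontfun (\<omega> l) \<tau>)" for \<tau>
    proof -
      have S': "S \<in> point_sets M" "k \<notin> S" using S by blast+
      then have "C2_in S (W S)" using cond_W M unfolding cond_W_def by blast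
      then have "(\<forall>j\<in>S. q j = q' j) \<Longrightarrow> W S q = W S q'" for q q' unfolding C2_in_def by blast
      moreover have "apply_bcontfun (?\<omega>' l) \<tau> = apply_bcontfun (\<omega> l) \<tau>" if "l \<in> S" for l
      proof -
        have "l \<noteq> k" using S'(2) that by blast
        then show ?thesis by (simp only: move_apply fst_conv if_False add_0_right)
      qed
      ultimately show ?thesis by simp
    qed
    then show "energy S ?\<omega>' - energy S \<omega> = 0" by (simp add: energy_def)
  qed (use \<Lambda> in auto)
  also have "\<dots> = (LINT M|count_space (orders N). (LINT S|count_space (clusters \<Lambda> M). energy S ?\<omega>') - (LINT S|count_space (clusters \<Lambda> M). energy S \<omega>))"
    unfolding infsum_eq_integral_count_space
    using energy_integrable(1)[OF fin(1)] energy_integrable(1)[OF fin(2)]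
    by (intro Bochner_Integration.integral_cong refl Bochner_Integration.integral_diff) auto
  also have "\<dots> = W_energy \<beta> N W \<Lambda> ?\<omega>' ?\<omega>' - W_energy \<beta> N W \<Lambda> \<omega> \<omega>"
    unfolding W_energy_eq using energy_integrable(2)[OF fin(1)] energy_integrable(2)[OF fin(2)]
    by (rule Bochner_Integration.integral_diff[rotated])
  finally show ?thesis .
qed

section \<open>The Gibbs weight and its lower bound\<close>

definition weight :: "'d site set \<Rightarrow> 'd config \<Rightarrow> real" where
  "weight \<Lambda> \<omega> = gibbs_weight \<beta> N W V \<Lambda> \<omega> \<omega>"

text \<open>Boundary condition and inner loops are merged into one configuration, so the kernel
  becomes an average of a function on \<open>\<Omega>\<close> over what \<open>override_on\<close>
  inserts.\<close>

lemma gibbs_weight_eq: "gibbs_weight \<beta> N W V \<Lambda> \<xi> z = weight \<Lambda> (override_on \<xi> z \<Lambda>)"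
proof -
  have "(\<lambda>l. if l \<in> \<Lambda> then apply_bcontfun (z l) \<tau> else apply_bcontfun (\<xi> l) \<tau>) = (\<lambda>l. apply_bcontfun (override_on \<xi> z \<Lambda> l) \<tau>)" for \<tau>
    by (auto simp: override_on_def)
  then show ?thesis unfolding weight_def gibbs_weight_def W_energy_def by simp
qed

lemma weight_pos: "0 < weight \<Lambda> \<omega>"
  unfolding weight_def gibbs_weight_def by (intro mult_pos_pos prod_pos) auto

lemma measurable_weight [measurable]: "weight \<Lambda> \<in> borel_measurable \<Omega>"
proof -
  have [measurable]: "(\<lambda>\<omega>. W_energy \<beta> N W \<Lambda> \<omega> \<omega>) \<in> borel_measurable \<Omega>"
    unfolding W_energy_eq
    by (intro measurable_integral_count_space countable_point_sets) (auto intro: measurable_energy)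
  have [measurable]: "(\<lambda>\<omega>. circle_int \<beta> (\<lambda>\<tau>. V k (apply_bcontfun ((\<omega> :: 'd config) k) \<tau>))) \<in> borel_measurable \<Omega>" for k
  proof (rule measurable_circle_int)
    have "(\<lambda>p. apply_bcontfun ((fst p :: 'd config) k) (snd p)) \<in> borel_measurable (\<Omega> \<Otimes>\<^sub>M lborel)"
      by (rule measurable_eval_pair) measurable
    then show "(\<lambda>(\<omega>, \<tau>). V k (apply_bcontfun ((\<omega> :: 'd config) k) \<tau>)) \<in> borel_measurable (\<Omega> \<Otimes>\<^sub>M lborel)"
      unfolding case_prod_beta by (rule measurable_compose) (rule borel_measurable_continuous_onI[OF continuous_V])
  qed
  show ?thesis unfolding weight_def gibbs_weight_def by measurable
qed

lemma measurable_Eabs [measurable]: "Eabs \<Lambda> \<in> borel_measurable \<Omega>"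
  unfolding Eabs_def
  by (intro measurable_nn_integral_count_space countable_point_sets)
     (auto intro!: measurable_compose[OF measurable_bnd])

lemma continuous_V_loop: "continuous_on A (\<lambda>\<tau>. V k (apply_bcontfun (z :: loop) \<tau>))"
  by (rule continuous_on_compose2[OF continuous_V]) auto

text \<open>All interaction terms of the density are increments, from \<open>\<omega>\<close> to the
  shifted configuration, of the exponent of the weight. They turn one weight into the other and
  leave the Gaussian factor.\<close>

lemma shift_density_weight:
  assumes \<omega>: "\<omega> \<in> Omega_t \<beta> R" and \<Lambda>: "finite \<Lambda>" "k \<in> \<Lambda>"
  shows "shift_density \<beta> m a N W V \<theta> k n \<omega> * weight \<Lambda> \<omega> = tilt (k, n) \<theta> \<omega> * weight \<Lambda> (move (k, n) \<theta> \<omega>)"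
proof -
  let ?\<omega>' = "move (k, n) \<theta> \<omega>"
  have A: "loop_inner \<beta> (A_op m a (apply_bcontfun (phi \<beta> n))) (apply_bcontfun z) = lam n * loop_coeff \<beta> n z" for z :: loop
    unfolding loop_inner_def loop_coeff_def A_op_phi mult.assoc circle_int_cmult ..
  define v where "v = (\<lambda>(\<omega>::'d config) l. circle_int \<beta> (\<lambda>\<tau>. V l (apply_bcontfun (\<omega> l) \<tau>)))"
  have vk: "circle_int \<beta> (\<lambda>\<tau>. V k (apply_bcontfun (\<omega> k) \<tau> + \<theta> * apply_bcontfun (phi \<beta> n) \<tau>) - V k (apply_bcontfun (\<omega> k) \<tau>))
     = v ?\<omega>' k - v \<omega> k"
  proof -
    have "(\<lambda>\<tau>. V k (apply_bcontfun (\<omega> k) \<tau> + \<theta> * apply_bcontfun (phi \<beta> n) \<tau>)) = (\<lambda>\<tau>. V k (apply_bcontfun (?\<omega>' k) \<tau>))"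
      by (simp add: move_apply)
    then show ?thesis unfolding v_def
      using circle_int_diff[OF continuous_V_loop[of _ k "?\<omega>' k"] continuous_V_loop[of _ k "\<omega> k"]] by metis
  qed
  have wt: "weight \<Lambda> \<eta> = exp (- W_energy \<beta> N W \<Lambda> \<eta> \<eta> - v \<eta> k - (\<Sum>l\<in>\<Lambda> - {k}. v \<eta> l))" for \<eta>
  proof -
    have "weight \<Lambda> \<eta> = exp (- W_energy \<beta> N W \<Lambda> \<eta> \<eta>) * exp (\<Sum>l\<in>\<Lambda>. - v \<eta> l)"
      unfolding weight_def gibbs_weight_def v_def using \<Lambda> by (simp add: exp_sum)
    also have "(\<Sum>l\<in>\<Lambda>. - v \<eta> l) = - v \<eta> k - (\<Sum>l\<in>\<Lambda> - {k}. v \<eta> l)"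
      using \<Lambda> by (simp add: sum.remove sum_negf)
    finally show ?thesis by (simp add: exp_add[symmetric])
  qed
  have rest: "(\<Sum>l\<in>\<Lambda> - {k}. v ?\<omega>' l) = (\<Sum>l\<in>\<Lambda> - {k}. v \<omega> l)"
    by (intro sum.cong refl) (auto simp: v_def move_apply)
  have "shift_density \<beta> m a N W V \<theta> k n \<omega> = exp (- \<theta> * lam n * coord (k, n) \<omega> - \<theta>\<^sup>2 / 2 * lam n - (v ?\<omega>' k - v \<omega> k)
      - (W_energy \<beta> N W \<Lambda> ?\<omega>' ?\<omega>' - W_energy \<beta> N W \<Lambda> \<omega> \<omega>))"
    unfolding shift_density_def vk A W_relative_energy_eq[OF assms]
    by (simp add: coord_def loop_coeff_phi beta_pos mult.assoc)
  then show ?thesis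
    unfolding wt rest tilt_def by (simp add: exp_add[symmetric])
qed

text \<open>The constant loop of height \<open>s\<close> dominates every loop of norm at most
  \<open>s\<close>, so \<open>Eabs\<close> at the overridden configuration controls the energies of
  all of them at once. That quantity depends only on the loops outside \<open>\<Lambda>\<close>;
  hence the bound is uniform inside.\<close>

lemma weight_lower_bound:
  assumes "finite \<Lambda>" "s \<ge> 0"
  obtains c where "\<And>r. 0 \<le> r \<Longrightarrow> c r > 0"
    "\<And>r \<omega>. 0 \<le> r \<Longrightarrow> (\<forall>k\<in>\<Lambda>. norm (\<omega> k) \<le> s) \<Longrightarrow> Eabs \<Lambda> (override_on \<omega> (\<lambda>_. const_bcontfun s) \<Lambda>) \<le> ennreal r \<Longrightarrow>
       c r \<le> weight \<Lambda> \<omega>"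
proof -
  have "\<exists>B. \<forall>q\<in>{-s..s}. \<bar>V k q\<bar> \<le> B" for k
  proof -
    have "compact (V k ` {-s..s})"
      by (intro compact_continuous_image continuous_on_subset[OF continuous_V]) auto
    then show ?thesis using compact_imp_bounded bounded_iff by (metis imageI real_norm_def)
  qed
  then obtain B where B: "\<And>k q. q \<in> {-s..s} \<Longrightarrow> \<bar>V k q\<bar> \<le> B k" by metis
  define c where "c = (\<lambda>r. exp (- r) * (\<Prod>k\<in>\<Lambda>. exp (- (\<beta> * B k))))"
  have pos: "c r > 0" for r unfolding c_def by (intro mult_pos_pos prod_pos) auto
  have "c r \<le> weight \<Lambda> \<omega>" if r: "0 \<le> r" and s: "\<forall>k\<in>\<Lambda>. norm (\<omega> k) \<le> s"
    and E: "Eabs \<Lambda> (override_on \<omega> (\<lambda>_. const_bcontfun s) \<Lambda>) \<le> ennreal r" for r \<omega>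
  proof -
    have z: "\<bar>apply_bcontfun (\<omega> k) \<tau>\<bar> \<le> s" if "k \<in> \<Lambda>" for k \<tau>
      using norm_bounded[of "\<omega> k" \<tau>] s that by fastforce
    have "Eabs \<Lambda> \<omega> \<le> Eabs \<Lambda> (override_on \<omega> (\<lambda>_. const_bcontfun s) \<Lambda>)"
      unfolding Eabs_def
    proof (intro nn_integral_mono ennreal_leI)
      fix M S assume "M \<in> space (count_space (orders N))" "S \<in> space (count_space (clusters \<Lambda> M))"
      then show "bnd S \<omega> \<le> bnd S (override_on \<omega> (\<lambda>_. const_bcontfun s) \<Lambda>)"
        using z assms(2) by (intro bnd_mono[of M S]) (auto simp: override_on_def const_bcontfun.rep_eq)
    qed
    then have E': "Eabs \<Lambda> \<omega> \<le> ennreal r" using E by simp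
    then have "Eabs \<Lambda> \<omega> < \<infinity>" by (rule le_less_trans) simp
    then have "ennreal \<bar>W_energy \<beta> N W \<Lambda> \<omega> \<omega>\<bar> \<le> ennreal r"
      using energy_integrable(3) E' order_trans by blast
    then have w: "\<bar>W_energy \<beta> N W \<Lambda> \<omega> \<omega>\<bar> \<le> r" using r by simp
    have v: "\<bar>circle_int \<beta> (\<lambda>\<tau>. V k (apply_bcontfun (\<omega> k) \<tau>))\<bar> \<le> \<beta> * B k" if "k \<in> \<Lambda>" for k
    proof -
      have "\<bar>circle_int \<beta> (\<lambda>\<tau>. V k (apply_bcontfun (\<omega> k) \<tau>))\<bar> \<le> circle_int \<beta> (\<lambda>\<tau>. B k)"
        using z[OF that] by (intro circle_int_abs_le continuous_V_loop continuous_intros B) (auto simp: abs_le_iff minus_le_iff)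
      then show ?thesis by (simp add: circle_int_const beta_pos)
    qed
    show ?thesis
      unfolding c_def weight_def gibbs_weight_def
    proof (intro mult_mono prod_mono conjI)
      show "exp (- (\<beta> * B k)) \<le> exp (- circle_int \<beta> (\<lambda>\<tau>. V k (apply_bcontfun (\<omega> k) \<tau>)))" if "k \<in> \<Lambda>" for k
        using v[OF that] by simp
    qed (use w in \<open>auto intro!: prod_nonneg\<close>)
  qed
  with pos that show ?thesis by blast
qed

section \<open>Gibbs measures and quasi-invariance\<close>

definition avg :: "'d site set \<Rightarrow> ('d config \<Rightarrow> ennreal) \<Rightarrow> 'd config \<Rightarrow> ennreal" where
  "avg \<Lambda> f \<xi> = (\<integral>\<^sup>+z. f (override_on \<xi> z \<Lambda>) \<partial>free \<Lambda>)"

lemma measurable_avg: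
  assumes [measurable]: "f \<in> borel_measurable \<Omega>"
  shows "avg \<Lambda> f \<in> borel_measurable \<Omega>"
proof -
  interpret prob_space "free \<Lambda>" by (rule prob_space_free)
  show ?thesis unfolding avg_def by measurable
qed

lemma measurable_avg_compose [measurable (raw)]:
  "f \<in> borel_measurable \<Omega> \<Longrightarrow> g \<in> measurable M \<Omega> \<Longrightarrow> (\<lambda>x. avg \<Lambda> f (g x)) \<in> borel_measurable M"
  by (rule measurable_compose[OF _ measurable_avg])

lemma measurable_override_right:
  "\<xi> \<in> Omega \<beta> \<Longrightarrow> (\<lambda>z. override_on \<xi> z \<Lambda>) \<in> measurable \<Omega> (\<Omega> :: 'd config measure)"
  by (rule measurable_override) auto

lemma nn_integral_PiM_eq_avg:
  assumes [measurable]: "f \<in> borel_measurable \<Omega>" and \<xi>: "\<xi> \<in> Omega \<beta>"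
  shows "(\<integral>\<^sup>+z. f (override_on \<xi> z \<Lambda>) \<partial>(\<Pi>\<^sub>M k\<in>\<Lambda>. \<gamma>)) = avg \<Lambda> f \<xi>"
proof -
  have [measurable]: "(\<lambda>z. f (override_on \<xi> z \<Lambda>)) \<in> borel_measurable \<Omega>"
    by (rule measurable_compose[OF measurable_override_right[OF \<xi>]]) measurable
  have "avg \<Lambda> f \<xi> = (\<integral>\<^sup>+z. f (override_on \<xi> (override_on (\<lambda>_. 0) z \<Lambda>) \<Lambda>) \<partial>(\<Pi>\<^sub>M k\<in>\<Lambda>. \<gamma>))"
    unfolding avg_def free_def by (subst nn_integral_distr[OF measurable_override_zero]) measurable
  also have "(\<lambda>z. override_on \<xi> (override_on (\<lambda>_. 0) z \<Lambda>) \<Lambda>) = (\<lambda>z. override_on \<xi> z \<Lambda>)"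
    by (auto simp: override_on_def fun_eq_iff)
  then have "\<And>z. override_on \<xi> (override_on (\<lambda>_. 0) z \<Lambda>) \<Lambda> = override_on \<xi> z \<Lambda>" by (rule fun_cong)
  ultimately show ?thesis by simp
qed

lemma gibbs_kernel_eq:
  assumes \<xi>: "\<xi> \<in> Omega_t \<beta> R" and \<Delta> [measurable]: "\<Delta> \<in> sets \<Omega>"
  shows "gibbs_kernel \<beta> R N W V \<gamma> \<Lambda> \<xi> \<Delta> =
    avg \<Lambda> (\<lambda>\<omega>. ennreal (weight \<Lambda> \<omega>) * indicator \<Delta> \<omega>) \<xi> / avg \<Lambda> (\<lambda>\<omega>. ennreal (weight \<Lambda> \<omega>)) \<xi>"
proof -
  have \<xi>': "\<xi> \<in> Omega \<beta>" using \<xi> Omega_t_subset by blast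
  show ?thesis using \<xi> unfolding gibbs_kernel_def partition_fn_def gibbs_weight_eq
    by (simp add: nn_integral_PiM_eq_avg[OF _ \<xi>', of "\<lambda>\<omega>. ennreal (weight \<Lambda> \<omega>) * indicator \<Delta> \<omega>"]
        nn_integral_PiM_eq_avg[OF _ \<xi>', of "\<lambda>\<omega>. ennreal (weight \<Lambda> \<omega>)"])
qed

text \<open>Strict positivity of the weight rules out a zero partition function for every boundary
  condition; only the value infinity remains a concern in divisions.\<close>

lemma avg_weight_pos:
  assumes "\<xi> \<in> Omega \<beta>"
  shows "avg \<Lambda> (\<lambda>\<omega>. ennreal (weight \<Lambda> \<omega>)) \<xi> \<noteq> 0"
proof
  interpret prob_space "free \<Lambda>" by (rule prob_space_free)
  have m: "(\<lambda>z. ennreal (weight \<Lambda> (override_on \<xi> z \<Lambda>))) \<in> borel_measurable (free \<Lambda>)"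
    unfolding measurable_cong_sets[OF sets_free refl]
    by (rule measurable_compose[OF measurable_override_right[OF assms]]) measurable
  assume "avg \<Lambda> (\<lambda>\<omega>. ennreal (weight \<Lambda> \<omega>)) \<xi> = 0"
  then have "AE z in free \<Lambda>. ennreal (weight \<Lambda> (override_on \<xi> z \<Lambda>)) = 0"
    unfolding avg_def using nn_integral_0_iff_AE[OF m] by simp
  then have "AE z in free \<Lambda>. False"
    by eventually_elim (use weight_pos in \<open>simp add: ennreal_eq_0_iff not_le[symmetric]\<close>)
  then show False by simp
qed

lemma tempered_AE:
  assumes "prob_space \<mu>" "emeasure \<mu> (Omega_p \<beta> R p) = 1" "real CARD('d) < p"
  shows "AE \<omega> in (\<mu> :: 'd config measure). \<omega> \<in> Omega_t \<beta> R"
proof -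
  interpret prob_space \<mu> by fact
  have "Omega_p \<beta> R p \<in> sets \<mu>" using assms(2) by (intro emeasure_neq_0_sets) simp
  moreover have "prob (Omega_p \<beta> R p) = 1" using assms(2) by (simp add: measure_def)
  ultimately have "AE \<omega> in \<mu>. \<omega> \<in> Omega_p \<beta> R p" by (simp add: AE_in_set_eq_1)
  then show ?thesis by eventually_elim (use assms(3) in \<open>auto simp: Omega_t_def\<close>)
qed

text \<open>A ratio built from measurable ingredients on the whole of \<open>\<Omega>\<close>,
  standing in for \<open>shift_density\<close>, with which it coincides on tempered
  configurations.\<close>

definition cocycle :: "'d site set \<Rightarrow> 'd site \<times> int \<Rightarrow> real \<Rightarrow> 'd config \<Rightarrow> real" where
  "cocycle \<Lambda> i \<theta> \<omega> = tilt i \<theta> \<omega> * weight \<Lambda> (move i \<theta> \<omega>) / weight \<Lambda> \<omega>"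

lemma measurable_cocycle [measurable]: "cocycle \<Lambda> i \<theta> \<in> borel_measurable \<Omega>"
  unfolding cocycle_def by measurable

lemma tilt_pos: "0 < tilt i \<theta> \<omega>"
  by (simp add: tilt_def)

lemma cocycle_eq:
  assumes "\<omega> \<in> Omega_t \<beta> R" "finite \<Lambda>" "fst i \<in> \<Lambda>"
  shows "shift_density \<beta> m a N W V \<theta> (fst i) (snd i) \<omega> = cocycle \<Lambda> i \<theta> \<omega>"
  using shift_density_weight[OF assms, of \<theta> "snd i"] weight_pos[of \<Lambda> \<omega>]
  by (simp add: cocycle_def field_simps)

lemma weight_cocycle:
  "ennreal (weight \<Lambda> \<omega>) * ennreal (cocycle \<Lambda> i \<theta> \<omega>) = ennreal (tilt i \<theta> \<omega>) * ennreal (weight \<Lambda> (move i \<theta> \<omega>))"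
proof -
  have "weight \<Lambda> \<omega> * cocycle \<Lambda> i \<theta> \<omega> = tilt i \<theta> \<omega> * weight \<Lambda> (move i \<theta> \<omega>)"
    using weight_pos[of \<Lambda> \<omega>] by (simp add: cocycle_def)
  moreover have "0 \<le> cocycle \<Lambda> i \<theta> \<omega>"
    unfolding cocycle_def
    by (intro divide_nonneg_pos mult_nonneg_nonneg less_imp_le[OF weight_pos] less_imp_le[OF tilt_pos] weight_pos)
  ultimately show ?thesis
    by (simp add: ennreal_mult[symmetric] less_imp_le[OF weight_pos] less_imp_le[OF tilt_pos])
qed

section \<open>From Gibbs measures to quasi-invariance\<close>

lemma shift_image:
  assumes "\<Delta> \<in> sets \<Omega>"
  shows "shift \<theta> (h_dir \<beta> k n) ` \<Delta> = {\<omega> \<in> Omega \<beta>. move (k, n) (- \<theta>) \<omega> \<in> \<Delta>}"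
proof -
  have sub: "\<Delta> \<subseteq> Omega \<beta>" using sets.sets_into_space[OF assms] by simp
  have "move (k, n) \<theta> ` \<Delta> = {\<omega> \<in> Omega \<beta>. move (k, n) (- \<theta>) \<omega> \<in> \<Delta>}"
  proof (intro set_eqI iffI)
    fix \<omega> assume "\<omega> \<in> {\<omega> \<in> Omega \<beta>. move (k, n) (- \<theta>) \<omega> \<in> \<Delta>}"
    then show "\<omega> \<in> move (k, n) \<theta> ` \<Delta>" by (intro image_eqI[of _ _ "move (k, n) (- \<theta>) \<omega>"]) auto
  qed (use sub in auto)
  then show ?thesis by (simp add: move_def)
qed

lemma override_move:
  "fst i \<in> \<Lambda> \<Longrightarrow> override_on \<xi> (move i t z) \<Lambda> = move i t (override_on \<xi> z \<Lambda>)"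
  by (auto simp: override_on_def move_apply fun_eq_iff)

lemma coord_override: "coord i (override_on \<xi> z \<Lambda>) = (if fst i \<in> \<Lambda> then coord i z else coord i \<xi>)"
  by (simp add: coord_def override_on_def)

text \<open>The tilt depends only on a coordinate inside \<open>\<Lambda>\<close>, so with the
  boundary condition frozen this is the Cameron-Martin formula of the free measure.\<close>

lemma avg_tilt:
  assumes f [measurable]: "f \<in> borel_measurable \<Omega>" and \<xi>: "\<xi> \<in> Omega \<beta>" and "finite \<Lambda>" "fst i \<in> \<Lambda>"
  shows "avg \<Lambda> (\<lambda>\<omega>. f \<omega> * ennreal (tilt i \<theta> \<omega>)) \<xi> = avg \<Lambda> (\<lambda>\<omega>. f (move i (- \<theta>) \<omega>)) \<xi>"
proof -
  have [measurable]: "(\<lambda>z. f (override_on \<xi> z \<Lambda>)) \<in> borel_measurable \<Omega>"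
    by (rule measurable_compose[OF measurable_override_right[OF \<xi>]]) measurable
  have "tilt i \<theta> (override_on \<xi> z \<Lambda>) = tilt i \<theta> z" for z
    using assms by (simp add: tilt_def coord_override)
  then have "avg \<Lambda> (\<lambda>\<omega>. f \<omega> * ennreal (tilt i \<theta> \<omega>)) \<xi> = (\<integral>\<^sup>+z. f (override_on \<xi> z \<Lambda>) * ennreal (tilt i \<theta> z) \<partial>free \<Lambda>)"
    by (simp add: avg_def)
  also have "\<dots> = (\<integral>\<^sup>+z. f (override_on \<xi> (move i (- \<theta>) z) \<Lambda>) \<partial>free \<Lambda>)"
    using assms by (intro resamples_tilt resamples_free) auto
  finally show ?thesis using assms by (simp add: avg_def override_move)
qed

text \<open>A volume consisting of the shifted site suffices: the shift acts inside the average of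
  the kernel, while the normalisation is a function of the boundary condition and stays as it
  is.\<close>

lemma gibbs_quasi_invariant:
  fixes \<mu> :: "'d config measure"
  assumes \<mu>: "\<mu> \<in> tempered_gibbs_measures \<beta> R N W V \<gamma>" and \<Delta> [measurable]: "\<Delta> \<in> sets \<Omega>"
  shows "emeasure \<mu> (shift \<theta> (h_dir \<beta> k n) ` \<Delta>) = (\<integral>\<^sup>+\<omega>\<in>\<Delta>. ennreal (shift_density \<beta> m a N W V \<theta> k n \<omega>) \<partial>\<mu>)"
proof -
  define \<Lambda> where "\<Lambda> = {k}"
  define i where "i = (k, n)"
  have \<Lambda>: "finite \<Lambda>" "\<Lambda> \<noteq> {}" "fst i \<in> \<Lambda>" by (simp_all add: \<Lambda>_def i_def)
  have pr: "prob_space \<mu>" and sets [measurable_cong]: "sets \<mu> = sets \<Omega>"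
    and gibbs: "\<And>\<Delta>. \<Delta> \<in> sets \<Omega> \<Longrightarrow> (\<integral>\<^sup>+\<omega>. gibbs_kernel \<beta> R N W V \<gamma> \<Lambda> \<omega> \<Delta> \<partial>\<mu>) = emeasure \<mu> \<Delta>"
    using \<mu> \<Lambda> by (auto simp: tempered_gibbs_measures_def gibbs_measures_def)
  obtain p where "real CARD('d) < p" "emeasure \<mu> (Omega_p \<beta> R p) = 1"
    using \<mu> by (auto simp: tempered_gibbs_measures_def)
  then have AE: "AE \<omega> in \<mu>. \<omega> \<in> Omega_t \<beta> R" using tempered_AE[OF pr] by blast
  interpret \<mu>: prob_space \<mu> by (rule pr)
  interpret F: prob_space "free \<Lambda>" by (rule prob_space_free)
  have spc [simp]: "space \<mu> = Omega \<beta>" using sets_eq_imp_space_eq[OF sets] by simp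
  define w where "w = (\<lambda>\<omega>. ennreal (weight \<Lambda> \<omega>))"
  have w [measurable]: "w \<in> borel_measurable \<Omega>" unfolding w_def by measurable
  \<comment> \<open>The kernel averaged over \<open>\<mu>\<close>, realised as one measure so that
    the equilibrium equation passes from events to nonnegative functions at once. An infinite
    partition function gives density 0 here and value 0 in \<open>gibbs_kernel\<close>.\<close>
  define \<nu> where "\<nu> = distr (density (\<mu> \<Otimes>\<^sub>M free \<Lambda>) (\<lambda>p. w (override_on (fst p) (snd p) \<Lambda>) * inverse (avg \<Lambda> w (fst p)))) \<Omega>
    (\<lambda>p. override_on (fst p) (snd p) \<Lambda>)"
  have \<nu>: "(\<integral>\<^sup>+\<omega>. f \<omega> \<partial>\<nu>) = (\<integral>\<^sup>+\<xi>. avg \<Lambda> (\<lambda>\<omega>. w \<omega> * f \<omega>) \<xi> / avg \<Lambda> w \<xi> \<partial>\<mu>)"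
    if f [measurable]: "f \<in> borel_measurable \<Omega>" for f
  proof -
    have "(\<integral>\<^sup>+\<omega>. f \<omega> \<partial>\<nu>) = (\<integral>\<^sup>+p. w (override_on (fst p) (snd p) \<Lambda>) * inverse (avg \<Lambda> w (fst p)) * f (override_on (fst p) (snd p) \<Lambda>) \<partial>(\<mu> \<Otimes>\<^sub>M free \<Lambda>))"
    proof -
      have [measurable]: "(\<lambda>p. override_on (fst p) (snd p) \<Lambda>) \<in> measurable (\<mu> \<Otimes>\<^sub>M free \<Lambda>) \<Omega>"
        and [measurable]: "(\<lambda>p. avg \<Lambda> w (fst p)) \<in> borel_measurable (\<mu> \<Otimes>\<^sub>M free \<Lambda>)" by measurable
      show ?thesis unfolding \<nu>_def by (simp add: nn_integral_distr nn_integral_density)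
    qed
    also have "\<dots> = (\<integral>\<^sup>+\<xi>. \<integral>\<^sup>+z. w (override_on \<xi> z \<Lambda>) * inverse (avg \<Lambda> w \<xi>) * f (override_on \<xi> z \<Lambda>) \<partial>free \<Lambda> \<partial>\<mu>)"
      by (subst F.nn_integral_fst[symmetric]) simp_all
    also have "\<dots> = (\<integral>\<^sup>+\<xi>. avg \<Lambda> (\<lambda>\<omega>. w \<omega> * f \<omega>) \<xi> / avg \<Lambda> w \<xi> \<partial>\<mu>)"
    proof (rule nn_integral_cong)
      fix \<xi> assume "\<xi> \<in> space \<mu>"
      then have "(\<lambda>z. w (override_on \<xi> z \<Lambda>) * f (override_on \<xi> z \<Lambda>)) \<in> borel_measurable (free \<Lambda>)"
        unfolding measurable_cong_sets[OF sets_free refl]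
        by (intro borel_measurable_times_ennreal measurable_compose[OF measurable_override_right] w f) auto
      then show "(\<integral>\<^sup>+z. w (override_on \<xi> z \<Lambda>) * inverse (avg \<Lambda> w \<xi>) * f (override_on \<xi> z \<Lambda>) \<partial>free \<Lambda>)
        = avg \<Lambda> (\<lambda>\<omega>. w \<omega> * f \<omega>) \<xi> / avg \<Lambda> w \<xi>"
        unfolding divide_ennreal_def avg_def[of _ "\<lambda>\<omega>. w \<omega> * f \<omega>"]
        by (subst nn_integral_multc[symmetric]) (auto simp: mult_ac)
    qed
    finally show ?thesis .
  qed
  have "\<mu> = \<nu>"
  proof (rule measure_eqI)
    show "sets \<mu> = sets \<nu>" by (simp add: sets \<nu>_def)
    fix A assume "A \<in> sets \<mu>"
    then have A [measurable]: "A \<in> sets \<Omega>" by (simp add: sets)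
    have "emeasure \<mu> A = (\<integral>\<^sup>+\<xi>. gibbs_kernel \<beta> R N W V \<gamma> \<Lambda> \<xi> A \<partial>\<mu>)" using gibbs[OF A] ..
    also have "\<dots> = (\<integral>\<^sup>+\<xi>. avg \<Lambda> (\<lambda>\<omega>. w \<omega> * indicator A \<omega>) \<xi> / avg \<Lambda> w \<xi> \<partial>\<mu>)"
      by (rule nn_integral_cong_AE) (use AE in \<open>eventually_elim, simp add: gibbs_kernel_eq A w_def\<close>)
    also have "\<dots> = (\<integral>\<^sup>+\<omega>. indicator A \<omega> \<partial>\<nu>)" by (rule \<nu>[symmetric]) measurable
    also have "\<dots> = emeasure \<nu> A" using A by (intro nn_integral_indicator) (simp add: \<nu>_def)
    finally show "emeasure \<mu> A = emeasure \<nu> A" .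
  qed
  then have dlr: "(\<integral>\<^sup>+\<omega>. f \<omega> \<partial>\<mu>) = (\<integral>\<^sup>+\<xi>. avg \<Lambda> (\<lambda>\<omega>. w \<omega> * f \<omega>) \<xi> / avg \<Lambda> w \<xi> \<partial>\<mu>)"
    if "f \<in> borel_measurable \<Omega>" for f using \<nu>[OF that] by simp
  have "(\<integral>\<^sup>+\<omega>\<in>\<Delta>. ennreal (shift_density \<beta> m a N W V \<theta> k n \<omega>) \<partial>\<mu>) = (\<integral>\<^sup>+\<omega>. ennreal (cocycle \<Lambda> i \<theta> \<omega>) * indicator \<Delta> \<omega> \<partial>\<mu>)"
    by (rule nn_integral_cong_AE)
       (use AE in \<open>eventually_elim, use cocycle_eq[OF _ \<Lambda>(1,3), of _ \<theta>] in \<open>simp add: i_def\<close>\<close>)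
  also have "\<dots> = (\<integral>\<^sup>+\<xi>. avg \<Lambda> (\<lambda>\<omega>. w \<omega> * (ennreal (cocycle \<Lambda> i \<theta> \<omega>) * indicator \<Delta> \<omega>)) \<xi> / avg \<Lambda> w \<xi> \<partial>\<mu>)"
    by (rule dlr) measurable
  also have "\<dots> = (\<integral>\<^sup>+\<xi>. avg \<Lambda> (\<lambda>\<omega>. w \<omega> * indicator \<Delta> (move i (- \<theta>) \<omega>)) \<xi> / avg \<Lambda> w \<xi> \<partial>\<mu>)"
  proof (rule nn_integral_cong)
    fix \<xi> assume "\<xi> \<in> space \<mu>"
    then have \<xi>: "\<xi> \<in> Omega \<beta>" by simp
    \<comment> \<open>\<open>weight_cocycle\<close> exchanges the weight for its shifted version and
      a tilt, the shape that \<open>avg_tilt\<close> expects; shifting back then restores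
      \<open>w\<close>.\<close>
    have "(\<lambda>\<omega>. w \<omega> * (ennreal (cocycle \<Lambda> i \<theta> \<omega>) * indicator \<Delta> \<omega>)) = (\<lambda>\<omega>. (w (move i \<theta> \<omega>) * indicator \<Delta> \<omega>) * ennreal (tilt i \<theta> \<omega>))"
      using weight_cocycle[of \<Lambda> _ i \<theta>] by (simp add: w_def fun_eq_iff mult_ac)
    then have "avg \<Lambda> (\<lambda>\<omega>. w \<omega> * (ennreal (cocycle \<Lambda> i \<theta> \<omega>) * indicator \<Delta> \<omega>)) \<xi>
       = avg \<Lambda> (\<lambda>\<omega>. (w (move i \<theta> \<omega>) * indicator \<Delta> \<omega>) * ennreal (tilt i \<theta> \<omega>)) \<xi>" by simp
    also have "\<dots> = avg \<Lambda> (\<lambda>\<omega>. w (move i \<theta> (move i (- \<theta>) \<omega>)) * indicator \<Delta> (move i (- \<theta>) \<omega>)) \<xi>"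
      by (rule avg_tilt[OF _ \<xi> \<Lambda>(1,3)]) measurable
    finally show "avg \<Lambda> (\<lambda>\<omega>. w \<omega> * (ennreal (cocycle \<Lambda> i \<theta> \<omega>) * indicator \<Delta> \<omega>)) \<xi> / avg \<Lambda> w \<xi>
      = avg \<Lambda> (\<lambda>\<omega>. w \<omega> * indicator \<Delta> (move i (- \<theta>) \<omega>)) \<xi> / avg \<Lambda> w \<xi>" by simp
  qed
  also have "\<dots> = (\<integral>\<^sup>+\<omega>. indicator \<Delta> (move i (- \<theta>) \<omega>) \<partial>\<mu>)"
    by (rule dlr[symmetric]) measurable
  also have "\<dots> = (\<integral>\<^sup>+\<omega>. indicator {\<omega> \<in> Omega \<beta>. move i (- \<theta>) \<omega> \<in> \<Delta>} \<omega> \<partial>\<mu>)"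
    by (rule nn_integral_cong) (auto simp: indicator_def)
  also have "\<dots> = emeasure \<mu> {\<omega> \<in> Omega \<beta>. move i (- \<theta>) \<omega> \<in> \<Delta>}"
  proof (rule nn_integral_indicator)
    have "{\<omega> \<in> space \<Omega>. move i (- \<theta>) \<omega> \<in> \<Delta>} \<in> sets \<Omega>" by measurable
    then show "{\<omega> \<in> Omega \<beta>. move i (- \<theta>) \<omega> \<in> \<Delta>} \<in> sets \<mu>" by (simp add: sets)
  qed
  finally show ?thesis unfolding shift_image[OF \<Delta>] i_def ..
qed

section \<open>From quasi-invariance to the Gibbs property\<close>

lemma mix_eq_noise:
  assumes "finite \<Lambda>" "k \<in> \<Lambda>"
  shows "mix (\<lambda>l. 1 - fejer_weight n l) c (\<Lambda> \<times> {- int n..int n}) \<omega> z k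
    = (\<omega> k - fejer_mean \<beta> n (\<omega> k)) + noise c (\<Lambda> \<times> {- int n..int n}) z k"
proof -
  let ?I = "\<Lambda> \<times> {- int n..int n}"
  have "(\<Sum>i\<in>?I. if fst i = k then (fejer_weight n (snd i) * coord i \<omega>) *\<^sub>R phi \<beta> (snd i) else 0)
     = (\<Sum>j\<in>\<Lambda>. \<Sum>l\<in>{- int n..int n}. if j = k then (fejer_weight n l * coord (k, l) \<omega>) *\<^sub>R phi \<beta> l else 0)"
    unfolding sum.cartesian_product by (rule sum.cong) auto
  also have "\<dots> = (\<Sum>j\<in>\<Lambda>. if j = k then fejer_mean \<beta> n (\<omega> k) else 0)"
    by (rule sum.cong) (auto simp: fejer_mean_def coord_def)
  also have "\<dots> = fejer_mean \<beta> n (\<omega> k)" using assms by simp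
  finally have mean: "(\<Sum>i\<in>?I. if fst i = k then (fejer_weight n (snd i) * coord i \<omega>) *\<^sub>R phi \<beta> (snd i) else 0) = fejer_mean \<beta> n (\<omega> k)" .
  \<comment> \<open>With damping \<open>1 - fejer_weight n l\<close> the correction
    \<open>r - 1\<close> is minus the Fejer weight, so the mixture subtracts precisely the Fejer
    mean.\<close>
  have "mix (\<lambda>l. 1 - fejer_weight n l) c ?I \<omega> z k = \<omega> k + (\<Sum>i\<in>?I. (if fst i = k then (c (snd i) * coord i z) *\<^sub>R phi \<beta> (snd i) else 0)
      - (if fst i = k then (fejer_weight n (snd i) * coord i \<omega>) *\<^sub>R phi \<beta> (snd i) else 0))"
    unfolding mix_def by (intro arg_cong2[where f = "(+)"] refl sum.cong) (auto simp: scaleR_diff_left scaleR_add_left)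
  then show ?thesis unfolding sum_subtractf mean by (simp add: noise_def)
qed

lemma mix_outside: "fst ` I \<subseteq> \<Lambda> \<Longrightarrow> k \<notin> \<Lambda> \<Longrightarrow> mix r c I \<omega> z k = \<omega> k"
  unfolding mix_def by (simp, intro sum.neutral) auto

lemma sets_Eabs_le:
  assumes "\<eta> \<in> Omega \<beta>"
  shows "{\<omega> \<in> Omega \<beta>. Eabs \<Lambda> (override_on \<omega> \<eta> \<Lambda>) \<le> e} \<in> sets (\<Omega> :: 'd config measure)"
proof -
  have "(\<lambda>\<omega>. override_on \<omega> \<eta> \<Lambda>) \<in> measurable \<Omega> (\<Omega> :: 'd config measure)"
    by (rule measurable_override[OF measurable_ident_sets[OF refl] measurable_const]) (use assms in simp)
  then have "(\<lambda>\<omega>. Eabs \<Lambda> (override_on \<omega> \<eta> \<Lambda>)) \<in> borel_measurable \<Omega>"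
    by (rule measurable_compose[OF _ measurable_Eabs])
  from borel_measurable_le[OF this borel_measurable_const, of e] show ?thesis by simp
qed

lemma const_in_Omega: "(\<lambda>_. const_bcontfun c) \<in> Omega \<beta>"
  by (simp add: Omega_def)

text \<open>A measure that resamples all coordinates in \<open>\<Lambda>\<close> may still be infinite on every event outside
  \<open>\<Lambda>\<close> (it could charge only very smooth loops, say). What excludes this is that the Gibbs weight has
  finite integral: averaging along Fejer means moves every loop, in the limit, into a fixed ball,
  on which the weight is bounded below.\<close>

lemma finite_on_level:
  fixes \<sigma> :: "'d config measure"
  assumes sets [measurable_cong]: "sets \<sigma> = sets \<Omega>" and \<Lambda>: "finite \<Lambda>"
    and res: "\<And>i. fst i \<in> \<Lambda> \<Longrightarrow> resamples \<sigma> i"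
    and fin: "(\<integral>\<^sup>+\<omega>. ennreal (weight \<Lambda> \<omega>) \<partial>\<sigma>) < \<infinity>"
  obtains s where "s \<ge> 0"
    "\<And>r :: nat. emeasure \<sigma> {\<omega> \<in> Omega \<beta>. Eabs \<Lambda> (override_on \<omega> (\<lambda>_. const_bcontfun s) \<Lambda>) \<le> ennreal r} < \<infinity>"
proof -
  interpret F: prob_space "free \<Lambda>" by (rule prob_space_free)
  have spc [simp]: "space \<sigma> = Omega \<beta>" using sets_eq_imp_space_eq[OF sets] by simp
  define A where "A = (\<lambda>n::nat. {z \<in> Omega \<beta> :: 'd config set. \<exists>k\<in>\<Lambda>. real n < norm (z k)})"
  have A [measurable]: "A n \<in> sets \<Omega>" for n
  proof -
    have "{z \<in> space \<Omega> :: 'd config set. \<exists>k\<in>\<Lambda>. real n < norm (z k)} \<in> sets \<Omega>" using \<Lambda> by measurable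
    then show ?thesis by (simp add: A_def)
  qed
  have "(\<lambda>n. F.prob (A n)) \<longlonglongrightarrow> F.prob (\<Inter>n. A n)"
  proof (rule F.finite_Lim_measure_decseq)
    show "decseq A"
    proof (intro decseq_SucI subsetI)
      fix n z assume "z \<in> A (Suc n)"
      then obtain k where "z \<in> Omega \<beta>" "k \<in> \<Lambda>" "real (Suc n) < norm (z k)" by (auto simp: A_def)
      then show "z \<in> A n" by (auto simp: A_def intro!: bexI[of _ k])
    qed
    show "range A \<subseteq> F.events" using A by auto
  qed
  moreover have "(\<Inter>n. A n) = {}"
  proof -
    have "\<exists>n. z \<notin> A n" for z
    proof -
      obtain n :: nat where "(\<Sum>k\<in>\<Lambda>. norm (z k)) \<le> real n" using real_arch_simple by blast
      moreover have "norm (z k) \<le> (\<Sum>k\<in>\<Lambda>. norm (z k))" if "k \<in> \<Lambda>" for k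
        using \<Lambda> that by (intro member_le_sum) auto
      ultimately have "z \<notin> A n" by (fastforce simp: A_def)
      then show ?thesis ..
    qed
    then show ?thesis by auto
  qed
  ultimately have "(\<lambda>n. F.prob (A n)) \<longlonglongrightarrow> 0" by simp
  \<comment> \<open>A quarter, because \<open>noise_bound\<close> doubles the probability and one
    half must remain for \<open>G\<close>.\<close>
  then have "eventually (\<lambda>n. F.prob (A n) < 1 / 4) sequentially" by (rule order_tendstoD) simp
  then obtain n0 where n0: "F.prob (A n0) < 1 / 4" by (auto simp: eventually_sequentially)
  \<comment> \<open>\<open>n0\<close> bounds the noise, and the extra 1 bounds what is left of a
    loop after subtracting its Fejer mean.\<close>
  define s where "s = real n0 + 1"
  have s: "s \<ge> 0" by (simp add: s_def)
  obtain c where c: "\<And>r. 0 \<le> r \<Longrightarrow> c r > 0" and weight_ge: "\<And>r \<omega>. 0 \<le> r \<Longrightarrow> (\<forall>k\<in>\<Lambda>. norm (\<omega> k) \<le> s) \<Longrightarrow>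
     Eabs \<Lambda> (override_on \<omega> (\<lambda>_. const_bcontfun s) \<Lambda>) \<le> ennreal r \<Longrightarrow> c r \<le> weight \<Lambda> \<omega>"
    by (rule weight_lower_bound[OF \<Lambda> s]) (rule that)
  define rr cc where "rr = (\<lambda>n l. 1 - fejer_weight n l)" and "cc = (\<lambda>n l. sqrt (1 - (rr n l)\<^sup>2))"
  have rr: "0 \<le> rr n l" "rr n l \<le> 1" for n l
    using fejer_weight_nonneg[of n l] fejer_weight_le_1[of n l] by (simp_all add: rr_def)
  then have rr2: "(rr n l)\<^sup>2 \<le> 1" for n l by (simp add: power_le_one)
  have rc: "(rr n l)\<^sup>2 + (cc n l)\<^sup>2 = 1" for n l using rr2[of n l] by (simp add: cc_def)
  have cc: "\<bar>cc n l\<bar> \<le> 1" for n l using rr2[of n l] by (simp add: cc_def)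
  define I where "I = (\<lambda>n::nat. \<Lambda> \<times> {- int n..int n})"
  have I: "finite (I n)" "fst ` I n \<subseteq> \<Lambda>" for n using \<Lambda> by (auto simp: I_def)
  define G where "G = (\<lambda>n. {z \<in> Omega \<beta>. \<forall>k\<in>\<Lambda>. norm (noise (cc n) (I n) z k) \<le> real n0})"
  have G [measurable]: "G n \<in> sets \<Omega>" for n
  proof -
    have "{z \<in> space \<Omega>. \<forall>k\<in>\<Lambda>. norm (noise (cc n) (I n) z k) \<le> real n0} \<in> sets \<Omega>" using \<Lambda> by measurable
    then show ?thesis by (simp add: G_def)
  qed
  have half: "1 / 2 \<le> F.prob (G n)" for n
  proof -
    have "emeasure (free \<Lambda>) {z \<in> Omega \<beta>. \<exists>k\<in>\<Lambda>. real n0 < norm (noise (cc n) (I n) z k)} \<le> 2 * emeasure (free \<Lambda>) (A n0)"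
      unfolding A_def using I \<Lambda> cc
      by (intro noise_bound sets_free prob_space_free resamples_free) auto
    also have "{z \<in> Omega \<beta>. \<exists>k\<in>\<Lambda>. real n0 < norm (noise (cc n) (I n) z k)} = space (free \<Lambda>) - G n"
      by (auto simp: G_def not_le)
    finally have "ennreal (F.prob (space (free \<Lambda>) - G n)) \<le> ennreal (2 * F.prob (A n0))"
      by (simp add: F.emeasure_eq_measure ennreal_mult)
    then have "F.prob (space (free \<Lambda>) - G n) \<le> 2 * F.prob (A n0)" by (subst (asm) ennreal_le_iff) auto
    then show ?thesis using n0 F.prob_compl[of "G n"] G[of n] by simp
  qed
  have "emeasure \<sigma> {\<omega> \<in> Omega \<beta>. Eabs \<Lambda> (override_on \<omega> (\<lambda>_. const_bcontfun s) \<Lambda>) \<le> ennreal r} < \<infinity>" for r :: nat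
  proof -
    define U where "U = {\<omega> \<in> Omega \<beta>. Eabs \<Lambda> (override_on \<omega> (\<lambda>_. const_bcontfun s) \<Lambda>) \<le> ennreal r}"
    have U [measurable]: "U \<in> sets \<Omega>" unfolding U_def by (rule sets_Eabs_le[OF const_in_Omega])
    \<comment> \<open>Mixing changes loops in \<open>\<Lambda>\<close> only and \<open>U\<close>
      looks at the others, so the moves stay in \<open>U\<close>. A cut-off involving the loops in
      \<open>\<Lambda>\<close> lacks this property in general.\<close>
    have U_mix: "mix (rr n) (cc n) (I n) \<omega> z \<in> U" if "\<omega> \<in> U" for n \<omega> z
    proof -
      have "override_on (mix (rr n) (cc n) (I n) \<omega> z) (\<lambda>_. const_bcontfun s) \<Lambda> = override_on \<omega> (\<lambda>_. const_bcontfun s) \<Lambda>"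
        using mix_outside[OF I(2)] by (auto simp: override_on_def fun_eq_iff)
      then show ?thesis using that by (simp add: U_def mix_in_Omega)
    qed
    define f where "f = (\<lambda>\<omega>. indicator U \<omega> * ennreal (weight \<Lambda> \<omega>))"
    have f [measurable]: "f \<in> borel_measurable \<Omega>" unfolding f_def by measurable
    define u where "u = (\<lambda>n \<omega>. \<integral>\<^sup>+z. f (mix (rr n) (cc n) (I n) \<omega> z) \<partial>free \<Lambda>)"
    have u [measurable]: "u n \<in> borel_measurable \<Omega>" for n unfolding u_def by measurable
    have u_int: "(\<integral>\<^sup>+\<omega>. u n \<omega> \<partial>\<sigma>) = (\<integral>\<^sup>+\<omega>. f \<omega> \<partial>\<sigma>)" for n
    proof -
      have "fst i \<in> \<Lambda>" if "i \<in> I n" for i using that by (auto simp: I_def)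
      then show ?thesis
        unfolding u_def using I \<Lambda> rc
        by (intro mix_invariant sets sets_free prob_space_free resamples_free res f) simp_all
    qed
    have u_ge: "eventually (\<lambda>n. ennreal (c r / 2) \<le> u n \<omega>) sequentially" if \<omega>: "\<omega> \<in> U" for \<omega>
    proof -
      have \<omega>\<Omega>: "\<omega> \<in> Omega \<beta>" using \<omega> by (simp add: U_def)
      have "eventually (\<lambda>n. \<forall>k\<in>\<Lambda>. norm (\<omega> k - fejer_mean \<beta> n (\<omega> k)) < 1) sequentially"
        using \<Lambda> \<omega>\<Omega> by (intro eventually_ball_finite ballI order_tendstoD(2)[OF fejer_mean_tendsto] beta_pos OmegaD) auto
      then show ?thesis
      proof eventually_elim
        case (elim n)
        have "ennreal (c r) * indicator (G n) z \<le> f (mix (rr n) (cc n) (I n) \<omega> z)" for z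
        proof (cases "z \<in> G n")
          case True
          have "norm (mix (rr n) (cc n) (I n) \<omega> z k) \<le> s" if k: "k \<in> \<Lambda>" for k
          proof -
            have "mix (rr n) (cc n) (I n) \<omega> z k = (\<omega> k - fejer_mean \<beta> n (\<omega> k)) + noise (cc n) (I n) z k"
              unfolding rr_def I_def by (rule mix_eq_noise[OF \<Lambda> k])
            moreover have "norm (\<omega> k - fejer_mean \<beta> n (\<omega> k)) < 1" "norm (noise (cc n) (I n) z k) \<le> real n0"
              using elim True k by (auto simp: G_def)
            ultimately show ?thesis unfolding s_def
              using norm_triangle_ineq[of "\<omega> k - fejer_mean \<beta> n (\<omega> k)" "noise (cc n) (I n) z k"] by simp
          qed
          moreover have mU: "mix (rr n) (cc n) (I n) \<omega> z \<in> U" by (rule U_mix[OF \<omega>])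
          ultimately have "c r \<le> weight \<Lambda> (mix (rr n) (cc n) (I n) \<omega> z)"
            by (intro weight_ge) (auto simp: U_def)
          then show ?thesis using True mU by (simp add: f_def ennreal_leI)
        qed simp
        then have "(\<integral>\<^sup>+z. ennreal (c r) * indicator (G n) z \<partial>free \<Lambda>) \<le> u n \<omega>"
          unfolding u_def by (intro nn_integral_mono)
        moreover have "(\<integral>\<^sup>+z. ennreal (c r) * indicator (G n) z \<partial>free \<Lambda>) = ennreal (c r * F.prob (G n))"
          using c[of r] by (simp add: nn_integral_cmult_indicator F.emeasure_eq_measure ennreal_mult)
        moreover have "c r / 2 \<le> c r * F.prob (G n)"
          using mult_left_mono[OF half[of n], of "c r"] c[of r] by simp
        then have "ennreal (c r / 2) \<le> ennreal (c r * F.prob (G n))" by (rule ennreal_leI)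
        ultimately show ?case by simp
      qed
    qed
    \<comment> \<open>The integrals of \<open>u n\<close> do not depend on \<open>n\<close>, whereas
      the lower bound on \<open>u n \<omega>\<close> holds only from an index depending on
      \<open>\<omega>\<close>. Fatou's lemma reconciles the two.\<close>
    have "ennreal (c r / 2) * emeasure \<sigma> U = (\<integral>\<^sup>+\<omega>. ennreal (c r / 2) * indicator U \<omega> \<partial>\<sigma>)"
      by (simp add: nn_integral_cmult_indicator)
    also have "\<dots> \<le> (\<integral>\<^sup>+\<omega>. liminf (\<lambda>n. u n \<omega>) \<partial>\<sigma>)"
    proof (intro nn_integral_mono)
      fix \<omega> show "ennreal (c r / 2) * indicator U \<omega> \<le> liminf (\<lambda>n. u n \<omega>)"
        using u_ge[of \<omega>] by (cases "\<omega> \<in> U") (auto intro: Liminf_bounded)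
    qed
    also have "\<dots> \<le> liminf (\<lambda>n. \<integral>\<^sup>+\<omega>. u n \<omega> \<partial>\<sigma>)" by (rule nn_integral_liminf) measurable
    also have "\<dots> = (\<integral>\<^sup>+\<omega>. f \<omega> \<partial>\<sigma>)" unfolding u_int by (simp add: Liminf_const)
    also have "\<dots> \<le> (\<integral>\<^sup>+\<omega>. ennreal (weight \<Lambda> \<omega>) \<partial>\<sigma>)"
      by (intro nn_integral_mono) (simp add: f_def indicator_def)
    also have "\<dots> < \<infinity>" by (rule fin)
    finally have "emeasure \<sigma> U < \<infinity>" using c[of r] by (auto simp: ennreal_mult_less_top)
    then show ?thesis by (simp add: U_def)
  qed
  with s show ?thesis by (rule that)
qed

text \<open>On each level set the measure is finite, and a rectangle splits into a condition inside
  \<open>\<Lambda>\<close>, which resampling factors off, and one outside. The level sets exhaust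
  the tempered configurations, so monotone convergence removes the restriction.\<close>

lemma integral_eq_avg:
  fixes \<sigma> :: "'d config measure"
  assumes sets [measurable_cong]: "sets \<sigma> = sets \<Omega>" and \<Lambda>: "finite \<Lambda>"
    and res: "\<And>i. fst i \<in> \<Lambda> \<Longrightarrow> resamples \<sigma> i"
    and fin: "(\<integral>\<^sup>+\<omega>. ennreal (weight \<Lambda> \<omega>) \<partial>\<sigma>) < \<infinity>"
    and AE: "AE \<omega> in \<sigma>. \<omega> \<in> Omega_t \<beta> R" and f [measurable]: "f \<in> borel_measurable \<Omega>"
  shows "(\<integral>\<^sup>+\<omega>. f \<omega> \<partial>\<sigma>) = (\<integral>\<^sup>+\<omega>. avg \<Lambda> f \<omega> \<partial>\<sigma>)"
proof -
  interpret F: prob_space "free \<Lambda>" by (rule prob_space_free)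
  have spc [simp]: "space \<sigma> = Omega \<beta>" using sets_eq_imp_space_eq[OF sets] by simp
  obtain s where s: "s \<ge> 0" and level: "\<And>r :: nat. emeasure \<sigma> {\<omega> \<in> Omega \<beta>. Eabs \<Lambda> (override_on \<omega> (\<lambda>_. const_bcontfun s) \<Lambda>) \<le> ennreal r} < \<infinity>"
    by (rule finite_on_level[OF sets \<Lambda> res fin]) (assumption, rule that)
  define U where "U = (\<lambda>r::nat. {\<omega> \<in> Omega \<beta>. Eabs \<Lambda> (override_on \<omega> (\<lambda>_. const_bcontfun s) \<Lambda>) \<le> ennreal r})"
  have U [measurable]: "U r \<in> sets \<Omega>" for r unfolding U_def by (rule sets_Eabs_le[OF const_in_Omega])
  have U_fin: "emeasure \<sigma> (U r) < \<infinity>" for r using level by (simp add: U_def)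
  have U_outside: "\<omega>' \<in> U r \<longleftrightarrow> \<omega> \<in> U r"
    if "\<omega> \<in> Omega \<beta>" "\<omega>' \<in> Omega \<beta>" "\<And>k. k \<notin> \<Lambda> \<Longrightarrow> \<omega>' k = \<omega> k" for \<omega> \<omega>' r
  proof -
    have "override_on \<omega>' (\<lambda>_. const_bcontfun s) \<Lambda> = override_on \<omega> (\<lambda>_. const_bcontfun s) \<Lambda>"
      using that(3) by (auto simp: override_on_def fun_eq_iff)
    then show ?thesis using that by (simp add: U_def)
  qed
  have local: "(\<integral>\<^sup>+\<omega>. indicator (U r) \<omega> * f \<omega> \<partial>\<sigma>) = (\<integral>\<^sup>+\<omega>. indicator (U r) \<omega> * avg \<Lambda> f \<omega> \<partial>\<sigma>)" for r
  proof -
    define \<sigma>' where "\<sigma>' = density \<sigma> (indicator (U r))"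
    have \<sigma>' [measurable_cong]: "sets \<sigma>' = sets \<Omega>" and [simp]: "space \<sigma>' = Omega \<beta>" by (simp_all add: \<sigma>'_def sets)
    define \<nu> where "\<nu> = distr (\<sigma>' \<Otimes>\<^sub>M free \<Lambda>) \<Omega> (\<lambda>p. override_on (fst p) (snd p) \<Lambda>)"
    have \<nu>: "(\<integral>\<^sup>+\<omega>. g \<omega> \<partial>\<nu>) = (\<integral>\<^sup>+\<omega>. indicator (U r) \<omega> * avg \<Lambda> g \<omega> \<partial>\<sigma>)" if g [measurable]: "g \<in> borel_measurable \<Omega>" for g
    proof -
      have "(\<integral>\<^sup>+\<omega>. g \<omega> \<partial>\<nu>) = (\<integral>\<^sup>+p. g (override_on (fst p) (snd p) \<Lambda>) \<partial>(\<sigma>' \<Otimes>\<^sub>M free \<Lambda>))"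
        unfolding \<nu>_def by (subst nn_integral_distr) measurable
      also have "\<dots> = (\<integral>\<^sup>+\<omega>. avg \<Lambda> g \<omega> \<partial>\<sigma>')"
        unfolding avg_def by (subst F.nn_integral_fst[symmetric]) simp_all
      also have "\<dots> = (\<integral>\<^sup>+\<omega>. indicator (U r) \<omega> * avg \<Lambda> g \<omega> \<partial>\<sigma>)"
        unfolding \<sigma>'_def by (subst nn_integral_density) measurable
      finally show ?thesis .
    qed
    have "\<sigma>' = \<nu>"
    proof (rule measure_eqI_rect)
      have "emeasure \<sigma>' (space \<sigma>') = (\<integral>\<^sup>+\<omega>. indicator (U r) \<omega> * indicator (space \<sigma>) \<omega> \<partial>\<sigma>)"
        unfolding \<sigma>'_def space_density
        by (rule emeasure_density[OF borel_measurable_indicator sets.top]) (simp add: sets)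
      also have "\<dots> = (\<integral>\<^sup>+\<omega>. indicator (U r) \<omega> \<partial>\<sigma>)"
        by (rule nn_integral_cong) (simp only: indicator_simps mult_1_right)
      also have "\<dots> = emeasure \<sigma> (U r)" by (rule nn_integral_indicator) (simp add: sets)
      finally show "finite_measure \<sigma>'" using U_fin[of r] by (intro finite_measureI) simp
      fix I :: "('d site \<times> int) set" and B :: "'d site \<times> int \<Rightarrow> real set"
      assume I: "finite I" and B: "\<And>i. B i \<in> sets borel"
      define I1 I2 where "I1 = {i \<in> I. fst i \<in> \<Lambda>}" and "I2 = {i \<in> I. fst i \<notin> \<Lambda>}"
      have fI: "finite I1" "finite I2" using I by (simp_all add: I1_def I2_def)
      have [measurable]: "rect I B \<in> sets \<Omega>" "rect I1 B \<in> sets \<Omega>" "rect I2 B \<in> sets \<Omega>"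
        using I fI B by (auto intro!: sets_rect)
      have "emeasure \<sigma>' (rect I B) = emeasure \<sigma> (U r \<inter> rect I B)"
        unfolding \<sigma>'_def using sets by (simp add: emeasure_density indicator_inter_arith[symmetric])
      also have "U r \<inter> rect I B = (U r \<inter> rect I2 B) \<inter> rect I1 B"
        by (auto simp: rect_def I1_def I2_def)
      \<comment> \<open>The level set together with the outside conditions plays the role of the
        invariant event.\<close>
      also have "emeasure \<sigma> \<dots> = (\<Prod>i\<in>I1. emeasure (law (snd i)) (B i)) * emeasure \<sigma> (U r \<inter> rect I2 B)"
      proof (rule resamples_rect[OF sets fI(1)])
        show "resamples \<sigma> i" if "i \<in> I1" for i using that res by (simp add: I1_def)
        show "move i t \<omega> \<in> U r \<inter> rect I2 B \<longleftrightarrow> \<omega> \<in> U r \<inter> rect I2 B" if i: "i \<in> I1" and \<omega>: "\<omega> \<in> Omega \<beta>" for i t \<omega>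
        proof -
          have "move i t \<omega> \<in> U r \<longleftrightarrow> \<omega> \<in> U r"
            using \<omega> i by (intro U_outside) (auto simp: move_apply I1_def)
          moreover have "move i t \<omega> \<in> rect I2 B \<longleftrightarrow> \<omega> \<in> rect I2 B"
          proof -
            have "i \<notin> I2" using i by (simp add: I1_def I2_def)
            then have "coord j (move i t \<omega>) = coord j \<omega>" if "j \<in> I2" for j
              using that by (auto simp: coord_move)
            then show ?thesis using \<omega> by (simp add: rect_def)
          qed
          ultimately show ?thesis by simp
        qed
      qed (use B in auto)
      \<comment> \<open>All indices of \<open>I1\<close> lie over \<open>\<Lambda>\<close>, so the
        Boolean factor of \<open>free_rect\<close> is 1.\<close>
      also have "(\<Prod>i\<in>I1. emeasure (law (snd i)) (B i)) = emeasure (free \<Lambda>) (rect I1 B)"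
      proof -
        have "{i \<in> I1. fst i \<in> \<Lambda>} = I1" by (auto simp: I1_def)
        then show ?thesis by (subst free_rect[OF \<Lambda> fI(1) B]) (auto simp: I1_def)
      qed
      finally have "emeasure \<sigma>' (rect I B) = emeasure (free \<Lambda>) (rect I1 B) * emeasure \<sigma> (U r \<inter> rect I2 B)" .
      also have "\<dots> = (\<integral>\<^sup>+\<omega>. emeasure (free \<Lambda>) (rect I1 B) * indicator (U r \<inter> rect I2 B) \<omega> \<partial>\<sigma>)"
        by (simp add: nn_integral_cmult_indicator)
      also have "\<dots> = (\<integral>\<^sup>+\<omega>. indicator (U r) \<omega> * avg \<Lambda> (indicator (rect I B)) \<omega> \<partial>\<sigma>)"
      proof (rule nn_integral_cong)
        fix \<omega> assume "\<omega> \<in> space \<sigma>"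
        then have \<omega>: "\<omega> \<in> Omega \<beta>" by simp
        have "avg \<Lambda> (indicator (rect I B)) \<omega> = (\<integral>\<^sup>+z. indicator (rect I2 B) \<omega> * indicator (rect I1 B) z \<partial>free \<Lambda>)"
          unfolding avg_def
        proof (rule nn_integral_cong)
          fix z assume "z \<in> space (free \<Lambda>)"
          then have z: "z \<in> Omega \<beta>" by simp
          have ov: "override_on \<omega> z \<Lambda> \<in> Omega \<beta>" using \<omega> z by (simp add: Omega_def override_on_def)
          have "override_on \<omega> z \<Lambda> \<in> rect I B \<longleftrightarrow> (\<forall>i\<in>I. (if fst i \<in> \<Lambda> then coord i z else coord i \<omega>) \<in> B i)"
            using ov by (simp add: rect_def coord_override)
          also have "\<dots> \<longleftrightarrow> (\<forall>i\<in>I2. coord i \<omega> \<in> B i) \<and> (\<forall>i\<in>I1. coord i z \<in> B i)"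
            unfolding I1_def I2_def by (simp only: mem_Collect_eq Ball_def) metis
          also have "\<dots> \<longleftrightarrow> \<omega> \<in> rect I2 B \<and> z \<in> rect I1 B" using \<omega> z by (simp add: rect_def)
          finally show "indicator (rect I B) (override_on \<omega> z \<Lambda>) = (indicator (rect I2 B) \<omega> * indicator (rect I1 B) z :: ennreal)"
            by (simp add: indicator_def)
        qed
        also have "\<dots> = indicator (rect I2 B) \<omega> * emeasure (free \<Lambda>) (rect I1 B)"
          by (simp add: nn_integral_cmult_indicator)
        finally show "emeasure (free \<Lambda>) (rect I1 B) * indicator (U r \<inter> rect I2 B) \<omega> = indicator (U r) \<omega> * avg \<Lambda> (indicator (rect I B)) \<omega>"
          by (simp add: indicator_def)
      qed
      also have "\<dots> = (\<integral>\<^sup>+\<omega>. indicator (rect I B) \<omega> \<partial>\<nu>)" by (rule \<nu>[symmetric]) measurable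
      also have "\<dots> = emeasure \<nu> (rect I B)" by (rule nn_integral_indicator) (simp add: \<nu>_def)
      finally show "emeasure \<sigma>' (rect I B) = emeasure \<nu> (rect I B)" .
    qed (simp_all add: \<sigma>' \<nu>_def)
    moreover have "(\<integral>\<^sup>+\<omega>. f \<omega> \<partial>\<sigma>') = (\<integral>\<^sup>+\<omega>. indicator (U r) \<omega> * f \<omega> \<partial>\<sigma>)"
      unfolding \<sigma>'_def by (subst nn_integral_density) measurable
    ultimately show ?thesis using \<nu>[OF f] by simp
  qed
  have exhaust: "(\<integral>\<^sup>+\<omega>. g \<omega> \<partial>\<sigma>) = (SUP r. \<integral>\<^sup>+\<omega>. indicator (U r) \<omega> * g \<omega> \<partial>\<sigma>)" if [measurable]: "g \<in> borel_measurable \<Omega>" for g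
  proof -
    have U_mono: "U r \<subseteq> U r'" if "r \<le> r'" for r r'
      using that by (auto simp: U_def intro: order_trans ennreal_leI)
    have "AE \<omega> in \<sigma>. g \<omega> = (SUP r. indicator (U r) \<omega> * g \<omega>)"
      using AE
    proof eventually_elim
      case (elim \<omega>)
      have \<omega>: "\<omega> \<in> Omega \<beta>" using elim Omega_t_subset by blast
      \<comment> \<open>Replacing finitely many loops keeps a configuration tempered, so its
        absolute energy is finite and some level set contains \<open>\<omega>\<close>.\<close>
      have "override_on \<omega> (\<lambda>_. const_bcontfun s) \<Lambda> \<in> Omega_t \<beta> R"
        using \<omega> by (intro Omega_t_change[OF elim])
          (auto simp: Omega_def override_on_def intro: finite_subset[OF _ \<Lambda>])
      then have "Eabs \<Lambda> (override_on \<omega> (\<lambda>_. const_bcontfun s) \<Lambda>) < \<infinity>" using \<Lambda> by (rule Eabs_finite)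
      then obtain x where x: "Eabs \<Lambda> (override_on \<omega> (\<lambda>_. const_bcontfun s) \<Lambda>) = ennreal x"
        by (cases "Eabs \<Lambda> (override_on \<omega> (\<lambda>_. const_bcontfun s) \<Lambda>)") auto
      obtain r :: nat where "x \<le> real r" using real_arch_simple by blast
      then have "Eabs \<Lambda> (override_on \<omega> (\<lambda>_. const_bcontfun s) \<Lambda>) \<le> ennreal r" unfolding x by (rule ennreal_leI)
      then have "\<omega> \<in> U r" using \<omega> by (simp add: U_def)
      then show ?case
        by (intro antisym SUP_upper2[of r] SUP_least) (auto simp: indicator_def)
    qed
    then have "(\<integral>\<^sup>+\<omega>. g \<omega> \<partial>\<sigma>) = (\<integral>\<^sup>+\<omega>. (SUP r. indicator (U r) \<omega> * g \<omega>) \<partial>\<sigma>)"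
      by (rule nn_integral_cong_AE)
    also have "\<dots> = (SUP r. \<integral>\<^sup>+\<omega>. indicator (U r) \<omega> * g \<omega> \<partial>\<sigma>)"
    proof (rule nn_integral_monotone_convergence_SUP)
      show "incseq (\<lambda>r \<omega>. indicator (U r) \<omega> * g \<omega>)"
      proof (intro incseq_SucI le_funI)
        fix r \<omega> show "indicator (U r) \<omega> * g \<omega> \<le> indicator (U (Suc r)) \<omega> * g \<omega>"
          using U_mono[of r "Suc r"] by (auto simp: indicator_def)
      qed
    qed measurable
    finally show ?thesis .
  qed
  show ?thesis unfolding exhaust[OF f] exhaust[OF measurable_avg[OF f]] local ..
qed

text \<open>Under \<open>\<mu> / w\<close> the cocycle becomes the pure tilt, so every coordinate
  over \<open>\<Lambda>\<close> is resampled. The averaging identity, applied to \<open>w\<close>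
  times the kernel and to \<open>w\<close> times the indicator, then compares two functions with
  equal averages.\<close>

lemma quasi_invariant_gibbs:
  fixes \<mu> :: "'d config measure"
  assumes \<mu>: "\<mu> \<in> tempered_quasi_invariant_measures \<beta> m a R N W V" and \<Delta> [measurable]: "\<Delta> \<in> sets \<Omega>"
    and \<Lambda>: "finite \<Lambda>"
  shows "(\<integral>\<^sup>+\<omega>. gibbs_kernel \<beta> R N W V \<gamma> \<Lambda> \<omega> \<Delta> \<partial>\<mu>) = emeasure \<mu> \<Delta>"
proof -
  have pr: "prob_space \<mu>" and sets [measurable_cong]: "sets \<mu> = sets \<Omega>"
    and quasi: "\<And>\<theta> k n A. A \<in> sets \<Omega> \<Longrightarrow> emeasure \<mu> (shift \<theta> (h_dir \<beta> k n) ` A)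
              = (\<integral>\<^sup>+\<omega>\<in>A. ennreal (shift_density \<beta> m a N W V \<theta> k n \<omega>) \<partial>\<mu>)"
    using \<mu> by (auto simp: tempered_quasi_invariant_measures_def)
  obtain p where "real CARD('d) < p" "emeasure \<mu> (Omega_p \<beta> R p) = 1"
    using \<mu> by (auto simp: tempered_quasi_invariant_measures_def)
  then have AE: "AE \<omega> in \<mu>. \<omega> \<in> Omega_t \<beta> R" using tempered_AE[OF pr] by blast
  interpret \<mu>: prob_space \<mu> by (rule pr)
  interpret F: prob_space "free \<Lambda>" by (rule prob_space_free)
  have spc [simp]: "space \<mu> = Omega \<beta>" using sets_eq_imp_space_eq[OF sets] by simp
  have quasi_int: "(\<integral>\<^sup>+\<omega>. f (move i (- \<theta>) \<omega>) \<partial>\<mu>) = (\<integral>\<^sup>+\<omega>. ennreal (cocycle \<Lambda> i \<theta> \<omega>) * f \<omega> \<partial>\<mu>)"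
    if i: "fst i \<in> \<Lambda>" and f [measurable]: "f \<in> borel_measurable \<Omega>" for f i \<theta>
  proof -
    \<comment> \<open>Quasi-invariance is given on events; as an equality of two measures it extends
      to nonnegative functions.\<close>
    have "distr \<mu> \<Omega> (move i (- \<theta>)) = density \<mu> (\<lambda>\<omega>. ennreal (cocycle \<Lambda> i \<theta> \<omega>))"
    proof (rule measure_eqI)
      fix A assume "A \<in> sets (distr \<mu> \<Omega> (move i (- \<theta>)))"
      then have A [measurable]: "A \<in> sets \<Omega>" by simp
      have "emeasure (distr \<mu> \<Omega> (move i (- \<theta>))) A = emeasure \<mu> (move i (- \<theta>) -` A \<inter> space \<mu>)"
        by (rule emeasure_distr) measurable
      also have "move i (- \<theta>) -` A \<inter> space \<mu> = shift \<theta> (h_dir \<beta> (fst i) (snd i)) ` A"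
        unfolding shift_image[OF A] by auto
      also have "emeasure \<mu> \<dots> = (\<integral>\<^sup>+\<omega>\<in>A. ennreal (shift_density \<beta> m a N W V \<theta> (fst i) (snd i) \<omega>) \<partial>\<mu>)"
        by (rule quasi[OF A])
      also have "\<dots> = (\<integral>\<^sup>+\<omega>. ennreal (cocycle \<Lambda> i \<theta> \<omega>) * indicator A \<omega> \<partial>\<mu>)"
        by (rule nn_integral_cong_AE) (use AE in \<open>eventually_elim, simp add: cocycle_eq[OF _ \<Lambda> i]\<close>)
      also have "\<dots> = emeasure (density \<mu> (\<lambda>\<omega>. ennreal (cocycle \<Lambda> i \<theta> \<omega>))) A"
        by (rule emeasure_density[symmetric]) measurable
      finally show "emeasure (distr \<mu> \<Omega> (move i (- \<theta>))) A = emeasure (density \<mu> (\<lambda>\<omega>. ennreal (cocycle \<Lambda> i \<theta> \<omega>))) A" .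
    qed (simp add: sets)
    then have "(\<integral>\<^sup>+\<omega>. f \<omega> \<partial>distr \<mu> \<Omega> (move i (- \<theta>))) = (\<integral>\<^sup>+\<omega>. f \<omega> \<partial>density \<mu> (\<lambda>\<omega>. ennreal (cocycle \<Lambda> i \<theta> \<omega>)))" by simp
    then show ?thesis by (subst (asm) nn_integral_distr, measurable, subst (asm) nn_integral_density) (simp_all add: measurable_cong_sets[OF sets refl])
  qed
  define w where "w = (\<lambda>\<omega>. ennreal (weight \<Lambda> \<omega>))"
  have w [measurable]: "w \<in> borel_measurable \<Omega>" unfolding w_def by measurable
  define v where "v = (\<lambda>\<omega>. ennreal (1 / weight \<Lambda> \<omega>))"
  have v [measurable]: "v \<in> borel_measurable \<Omega>" unfolding v_def by measurable
  have vw: "v \<omega> * w \<omega> = 1" for \<omega>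
    using weight_pos[of \<Lambda> \<omega>] by (simp add: v_def w_def ennreal_mult[symmetric])
  define \<sigma> where "\<sigma> = density \<mu> v"
  have s\<sigma> [measurable_cong]: "sets \<sigma> = sets \<Omega>" by (simp add: \<sigma>_def sets)
  have \<sigma>: "(\<integral>\<^sup>+\<omega>. f \<omega> \<partial>\<sigma>) = (\<integral>\<^sup>+\<omega>. v \<omega> * f \<omega> \<partial>\<mu>)" if [measurable]: "f \<in> borel_measurable \<Omega>" for f
    unfolding \<sigma>_def by (rule nn_integral_density) measurable
  have \<sigma>w: "(\<integral>\<^sup>+\<omega>. w \<omega> * f \<omega> \<partial>\<sigma>) = (\<integral>\<^sup>+\<omega>. f \<omega> \<partial>\<mu>)" if [measurable]: "f \<in> borel_measurable \<Omega>" for f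
    by (subst \<sigma>) (simp_all add: mult.assoc[symmetric] vw)
  \<comment> \<open>The density \<open>1 / weight\<close> is finite everywhere, which preserves
    \<open>\<sigma>\<close>-finiteness even if the total mass becomes infinite.\<close>
  have sf: "sigma_finite_measure \<sigma>"
  proof -
    have "v \<in> borel_measurable \<mu>" by measurable
    then show ?thesis unfolding \<sigma>_def by (subst \<mu>.sigma_finite_iff_density_finite) (simp_all add: v_def)
  qed
  have res: "resamples \<sigma> i" if i: "fst i \<in> \<Lambda>" for i
  proof (rule resamplesI[OF sf s\<sigma>])
    fix \<theta> and f :: "'d config \<Rightarrow> ennreal" assume f [measurable]: "f \<in> borel_measurable \<Omega>"
    have "(\<integral>\<^sup>+\<omega>. f (move i (- \<theta>) \<omega>) \<partial>\<sigma>) = (\<integral>\<^sup>+\<omega>. v (move i \<theta> (move i (- \<theta>) \<omega>)) * f (move i (- \<theta>) \<omega>) \<partial>\<mu>)"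
      by (subst \<sigma>) simp_all
    also have "\<dots> = (\<integral>\<^sup>+\<omega>. ennreal (cocycle \<Lambda> i \<theta> \<omega>) * (v (move i \<theta> \<omega>) * f \<omega>) \<partial>\<mu>)"
      by (rule quasi_int[OF i]) measurable
    also have "\<dots> = (\<integral>\<^sup>+\<omega>. v \<omega> * (f \<omega> * ennreal (tilt i \<theta> \<omega>)) \<partial>\<mu>)"
    proof (rule nn_integral_cong)
      fix \<omega>
      \<comment> \<open>Inserting \<open>v \<omega> * w \<omega> = 1\<close> lets the cocycle
        identity move the weight to the shifted configuration, where it cancels against
        \<open>v\<close>.\<close>
      have "ennreal (cocycle \<Lambda> i \<theta> \<omega>) * (v (move i \<theta> \<omega>) * f \<omega>) = (v \<omega> * w \<omega>) * (ennreal (cocycle \<Lambda> i \<theta> \<omega>) * (v (move i \<theta> \<omega>) * f \<omega>))"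
        by (simp add: vw)
      also have "\<dots> = (w \<omega> * ennreal (cocycle \<Lambda> i \<theta> \<omega>)) * (v \<omega> * (v (move i \<theta> \<omega>) * f \<omega>))" by (simp only: mult_ac)
      also have "w \<omega> * ennreal (cocycle \<Lambda> i \<theta> \<omega>) = ennreal (tilt i \<theta> \<omega>) * w (move i \<theta> \<omega>)"
        unfolding w_def by (rule weight_cocycle)
      also have "ennreal (tilt i \<theta> \<omega>) * w (move i \<theta> \<omega>) * (v \<omega> * (v (move i \<theta> \<omega>) * f \<omega>))
        = (v (move i \<theta> \<omega>) * w (move i \<theta> \<omega>)) * (v \<omega> * (f \<omega> * ennreal (tilt i \<theta> \<omega>)))" by (simp only: mult_ac)
      finally show "ennreal (cocycle \<Lambda> i \<theta> \<omega>) * (v (move i \<theta> \<omega>) * f \<omega>) = v \<omega> * (f \<omega> * ennreal (tilt i \<theta> \<omega>))"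
        by (simp add: vw)
    qed
    also have "\<dots> = (\<integral>\<^sup>+\<omega>. f \<omega> * ennreal (tilt i \<theta> \<omega>) \<partial>\<sigma>)" by (rule \<sigma>[symmetric]) measurable
    finally show "(\<integral>\<^sup>+\<omega>. f \<omega> * ennreal (tilt i \<theta> \<omega>) \<partial>\<sigma>) = (\<integral>\<^sup>+\<omega>. f (move i (- \<theta>) \<omega>) \<partial>\<sigma>)" ..
  qed
  have total: "(\<integral>\<^sup>+\<omega>. w \<omega> \<partial>\<sigma>) = 1"
    using \<sigma>w[of "\<lambda>_. 1"] \<mu>.emeasure_space_1 by simp
  have AE\<sigma>: "AE \<omega> in \<sigma>. \<omega> \<in> Omega_t \<beta> R"
    unfolding \<sigma>_def by (subst AE_density) (use AE in \<open>auto simp: measurable_cong_sets[OF sets refl] elim: eventually_mono\<close>)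
  have avg: "(\<integral>\<^sup>+\<omega>. f \<omega> \<partial>\<sigma>) = (\<integral>\<^sup>+\<omega>. avg \<Lambda> f \<omega> \<partial>\<sigma>)" if "f \<in> borel_measurable \<Omega>" for f
    by (rule integral_eq_avg[OF s\<sigma> \<Lambda> res _ AE\<sigma> that]) (use total in \<open>simp_all add: w_def\<close>)
  have "(\<integral>\<^sup>+\<omega>. avg \<Lambda> w \<omega> \<partial>\<sigma>) \<noteq> \<infinity>" using avg[OF w] total by simp
  \<comment> \<open>The partition function has the same \<open>\<sigma>\<close>-integral as
    \<open>w\<close>, namely the total mass 1 of \<open>\<mu>\<close>, and so is finite almost
    everywhere.\<close>
  then have Z_fin: "AE \<omega> in \<sigma>. avg \<Lambda> w \<omega> \<noteq> \<infinity>"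
    by (intro nn_integral_PInf_AE) measurable
  define K where "K = (\<lambda>\<xi>. avg \<Lambda> (\<lambda>\<omega>. w \<omega> * indicator \<Delta> \<omega>) \<xi> / avg \<Lambda> w \<xi>)"
  have K [measurable]: "K \<in> borel_measurable \<Omega>" unfolding K_def by measurable
  \<comment> \<open>\<open>K\<close> depends on the boundary condition only and can therefore leave
    the average.\<close>
  have K_override: "K (override_on \<xi> z \<Lambda>) = K \<xi>" for \<xi> z
  proof -
    have "override_on (override_on \<xi> z \<Lambda>) z' \<Lambda> = override_on \<xi> z' \<Lambda>" for z'
      by (auto simp: override_on_def fun_eq_iff)
    then show ?thesis by (simp add: K_def avg_def)
  qed
  have "(\<integral>\<^sup>+\<omega>. gibbs_kernel \<beta> R N W V \<gamma> \<Lambda> \<omega> \<Delta> \<partial>\<mu>) = (\<integral>\<^sup>+\<omega>. K \<omega> \<partial>\<mu>)"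
    by (rule nn_integral_cong_AE) (use AE in \<open>eventually_elim, simp add: gibbs_kernel_eq \<Delta> K_def w_def\<close>)
  also have "\<dots> = (\<integral>\<^sup>+\<omega>. w \<omega> * K \<omega> \<partial>\<sigma>)" by (rule \<sigma>w[symmetric]) measurable
  also have "\<dots> = (\<integral>\<^sup>+\<omega>. avg \<Lambda> (\<lambda>\<omega>. w \<omega> * K \<omega>) \<omega> \<partial>\<sigma>)" by (rule avg) measurable
  also have "\<dots> = (\<integral>\<^sup>+\<omega>. avg \<Lambda> (\<lambda>\<omega>. w \<omega> * indicator \<Delta> \<omega>) \<omega> \<partial>\<sigma>)"
  proof (rule nn_integral_cong_AE)
    show "AE \<omega> in \<sigma>. avg \<Lambda> (\<lambda>\<omega>. w \<omega> * K \<omega>) \<omega> = avg \<Lambda> (\<lambda>\<omega>. w \<omega> * indicator \<Delta> \<omega>) \<omega>"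
      using Z_fin AE\<sigma>
    proof eventually_elim
      case (elim \<omega>)
      have \<omega>: "\<omega> \<in> Omega \<beta>" using elim(2) Omega_t_subset by blast
      have "(\<lambda>z. w (override_on \<omega> z \<Lambda>)) \<in> borel_measurable (free \<Lambda>)"
        unfolding measurable_cong_sets[OF sets_free refl]
        by (rule measurable_compose[OF measurable_override_right[OF \<omega>] w])
      then have "avg \<Lambda> (\<lambda>\<omega>. w \<omega> * K \<omega>) \<omega> = avg \<Lambda> w \<omega> * K \<omega>"
        unfolding avg_def K_override by (rule nn_integral_multc)
      \<comment> \<open>Cancelling the partition function needs it to be neither 0, by positivity of
        the weight, nor infinite, by \<open>Z_fin\<close>.\<close>
      also have "\<dots> = avg \<Lambda> (\<lambda>\<omega>. w \<omega> * indicator \<Delta> \<omega>) \<omega>"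
        using elim(1) avg_weight_pos[OF \<omega>, of \<Lambda>, folded w_def] unfolding K_def
        by (simp add: ennreal_times_divide mult_divide_eq_ennreal mult.commute[of "avg \<Lambda> w \<omega>"])
      finally show ?case .
    qed
  qed
  also have "\<dots> = (\<integral>\<^sup>+\<omega>. w \<omega> * indicator \<Delta> \<omega> \<partial>\<sigma>)" by (rule avg[symmetric]) measurable
  also have "\<dots> = (\<integral>\<^sup>+\<omega>. indicator \<Delta> \<omega> \<partial>\<mu>)" by (rule \<sigma>w) measurable
  also have "\<dots> = emeasure \<mu> \<Delta>" using \<Delta> sets by (intro nn_integral_indicator) simp
  finally show ?thesis .
qed

end

theorem proposition4p2:
  fixes \<beta> m a R :: real and N :: enat
    and W :: "'d::finite site set \<Rightarrow> ('d site \<Rightarrow> real) \<Rightarrow> real"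
    and J :: "'d site set \<Rightarrow> real"
    and V :: "'d site \<Rightarrow> real \<Rightarrow> real"
    and \<gamma> :: "loop measure"
  assumes "\<beta> > 0" and "m > 0" and "a\<^sup>2 > 0" and "R \<ge> 2" and "N \<ge> 2"
    and "cond_W R N W J"
    and "cond_J R N J"
    and "cond_V R N J V"
    and "loop_gaussian \<beta> m a \<gamma>"
  shows "tempered_gibbs_measures \<beta> R N W V \<gamma> = tempered_quasi_invariant_measures \<beta> m a R N W V"
proof -
  have "continuous_on UNIV (V k)" for k
    using assms(8) unfolding cond_V_def C2_real_def
    by (intro continuous_at_imp_continuous_on ballI differentiable_imp_continuous_within) blast
  then interpret lattice_model \<beta> m a \<gamma> R N W J V
    using assms by unfold_locales auto
  show ?thesis
  proof (intro equalityI subsetI)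
    fix \<mu> assume "\<mu> \<in> tempered_gibbs_measures \<beta> R N W V \<gamma>"
    then show "\<mu> \<in> tempered_quasi_invariant_measures \<beta> m a R N W V"
      using gibbs_quasi_invariant[of \<mu>]
      by (simp add: tempered_quasi_invariant_measures_def tempered_gibbs_measures_def gibbs_measures_def)
  next
    fix \<mu> assume "\<mu> \<in> tempered_quasi_invariant_measures \<beta> m a R N W V"
    then show "\<mu> \<in> tempered_gibbs_measures \<beta> R N W V \<gamma>"
      using quasi_invariant_gibbs[of \<mu>]
      by (simp add: tempered_quasi_invariant_measures_def tempered_gibbs_measures_def gibbs_measures_def)
  qed
qed

end
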